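(* Let $N\ge1$ be an integer, $\kappa\in\,]0,\infty[$, $p,q>N-1$, and put $\alpha:=q-N>-1$, $\beta:=p-N>-1$. Let $z=(z_1,\ldots,z_N)\in A_N$ be the vector of the ordered zeros $z_1\le\ldots\le z_N$ of the Jacobi polynomial $P_N^{(\alpha,\beta)}$. Let $(X_t)_{t\ge0}$ be the Jacobi process with parameters $\kappa,p,q$ starting in $z$. Then, for all $t\ge0$, $$\mathbb E\Bigl(\prod_{i=1}^N(y-X_{t,i})\Bigr)=\frac{1}{l_N^{(\alpha,\beta)}}\cdot P_N^{(\alpha,\beta)}(y)\qquad\text{for } y\in\mathbb R,$$ where $l_N^{(\alpha,\beta)}$ is the leading coefficient of $P_N^{(\alpha,\beta)}$. Moreover, for $n=0,1,\ldots,N$ and all $t\ge0$, $$\mathbb E\bigl(e_n^N(X_t)\bigr)=e_n^N(z)=\frac{2^N}{\binom{2N+\alpha+\beta}{N}}\sum_{l=N-n}^N(-1)^{N-l}\binom Nl\binom l{N-n}\frac{(N+\alpha+\beta+1)_l\,(\alpha+l+1)_{N-l}}{N!\,2^l}.$$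
   Context: $A_N:=\{x\in\mathbb R^N:\ -1\le x_1\le\ldots\le x_N\le 1\}$. $(a)_k=a(a+1)\cdots(a+k-1)$ is the Pochhammer symbol, and binomial coefficients with real upper entry are the generalized ones. The elementary symmetric polynomials $e_j^m$ in $m$ variables are given by $\prod_{j=1}^m(z-x_j)=\sum_{j=0}^m(-1)^{m-j}e_{m-j}^m(x)z^j$. Jacobi polynomials: for $\alpha,\beta>-1$, $$P_n^{(\alpha,\beta)}(x)=\sum_{k=0}^n\binom nk\frac{(n+\alpha+\beta+1)_k(\alpha+k+1)_{n-k}}{n!}\Bigl(\frac{x-1}2\Bigr)^k,$$ orthogonal with respect to the weight $(1-x)^\alpha(1+x)^\beta$ on $]-1,1[$. Jacobi process: the Jacobi process $(X_t)_{t\ge0}$ with parameters $\kappa,p,q$ is the unique strong solution, with values in $A_N$, of $$dX_{t,i}=\sqrt{2(1-X_{t,i}^2)}\,dB_{t,i}+\kappa\Bigl((p-q)-(p+q)X_{t,i}+2\sum_{j:\,j\ne i}\frac{1-X_{t,i}X_{t,j}}{X_{t,i}-X_{t,j}}\Bigr)dt\qquad(i=1,\ldots,N)$$ with an $N$-dimensional Brownian motion $(B_t)_{t\ge0}$, where the paths are reflected on $\partial A_N$ and the process starts in a point in the interior of $A_N$. *)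

theory Defs
  imports "HOL-Probability.Probability" "HOL-Computational_Algebra.Polynomial"
begin

section \<open>Jacobi polynomials and elementary symmetric polynomials\<close>

definition jacobi_poly :: "nat \<Rightarrow> real \<Rightarrow> real \<Rightarrow> real poly" where
  "jacobi_poly n \<alpha> \<beta> =
     (\<Sum>k\<le>n. smult (of_nat (n choose k) * pochhammer (of_nat n + \<alpha> + \<beta> + 1) k
                    * pochhammer (\<alpha> + of_nat k + 1) (n - k) / fact n)
                  ([:-1/2, 1/2:] ^ k))"

text \<open>
  Vectors in \<open>\<real>\<^sup>N\<close> are elements of \<^typ>\<open>real ^ 'n\<close>, where the index type \<open>'n\<close> is finite and
  linearly ordered and has \<open>N = CARD('n)\<close> elements.

  The elementary symmetric polynomials are read off from
  \<open>(\<Prod>i. Z - x\<^sub>i) = (\<Sum>j\<le>N. (-1)^(N-j) * e\<^bsub>N-j\<^esub>(x) * Z^j)\<close>.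
\<close>

definition elem_sym :: "nat \<Rightarrow> real ^ 'n \<Rightarrow> real" where
  "elem_sym k x =
     (if k \<le> CARD('n) then (-1) ^ k * coeff (\<Prod>i\<in>UNIV. [:- (x $ i), 1:]) (CARD('n) - k) else 0)"

definition jacobi_alcove :: "(real ^ ('n::{finite,linorder})) set" where
  "jacobi_alcove = {x. (\<forall>i j. i \<le> j \<longrightarrow> x $ i \<le> x $ j) \<and> (\<forall>i. -1 \<le> x $ i \<and> x $ i \<le> 1)}"

text \<open>The entries of \<open>z\<close>, in increasing order, are the real zeros of \<open>P\<close>, each of them listed
  according to its multiplicity.\<close>

definition ordered_zeros :: "real poly \<Rightarrow> real ^ ('n::{finite,linorder}) \<Rightarrow> bool" where
  "ordered_zeros P z \<longleftrightarrow>
     (\<forall>i j. i \<le> j \<longrightarrow> z $ i \<le> z $ j) \<and> (\<forall>x. card {i. z $ i = x} = order x P)"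

section \<open>Brownian motion and the Ito integral\<close>

definition augmented_filtration ::
    "'a measure \<Rightarrow> (real \<Rightarrow> 'a \<Rightarrow> real ^ 'n) \<Rightarrow> real \<Rightarrow> 'a measure" where
  "augmented_filtration M B t =
     sigma (space M)
       ({B s -` A \<inter> space M | s A. 0 \<le> s \<and> s \<le> t \<and> A \<in> sets borel} \<union> null_sets M)"

definition brownian_motion ::
    "'a measure \<Rightarrow> (real \<Rightarrow> 'a measure) \<Rightarrow> (real \<Rightarrow> 'a \<Rightarrow> real ^ 'n) \<Rightarrow> bool" where
  "brownian_motion M F B \<longleftrightarrow>
     (\<forall>t\<ge>0. B t \<in> borel_measurable M \<and> B t \<in> borel_measurable (F t)) \<and>
     (AE \<omega> in M. B 0 \<omega> = 0) \<and>
     (\<forall>\<omega>\<in>space M. continuous_on {0..} (\<lambda>t. B t \<omega>)) \<and>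
     (\<forall>s t. 0 \<le> s \<and> s < t \<longrightarrow>
        prob_space.indep_set M (sets (F s))
          {(\<lambda>\<omega>. B t \<omega> - B s \<omega>) -` A \<inter> space M | A. A \<in> sets borel} \<and>
        prob_space.indep_vars M (\<lambda>_. borel) (\<lambda>i \<omega>. (B t \<omega> - B s \<omega>) $ i) UNIV \<and>
        (\<forall>i. distributed M lborel (\<lambda>\<omega>. (B t \<omega> - B s \<omega>) $ i) (normal_density 0 (sqrt (t - s)))))"

text \<open>
  \<open>n\<close>, \<open>\<tau>\<close>, \<open>\<xi>\<close> represent the simple process \<open>\<Sum>k<n. \<xi>\<^sub>k * indicator ]\<tau>\<^sub>k, \<tau>\<^bsub>k+1\<^esub>]\<close>.
\<close>

definition simple_process ::
    "'a measure \<Rightarrow> (real \<Rightarrow> 'a measure) \<Rightarrow> nat \<Rightarrow> (nat \<Rightarrow> real) \<Rightarrow> (nat \<Rightarrow> 'a \<Rightarrow> real) \<Rightarrow> bool" where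
  "simple_process M F n \<tau> \<xi> \<longleftrightarrow>
     0 \<le> \<tau> 0 \<and> (\<forall>k<n. \<tau> k \<le> \<tau> (Suc k)) \<and>
     (\<forall>k<n. \<xi> k \<in> borel_measurable (F (\<tau> k)) \<and> (\<exists>C. \<forall>\<omega>\<in>space M. \<bar>\<xi> k \<omega>\<bar> \<le> C))"

definition simple_eval :: "nat \<Rightarrow> (nat \<Rightarrow> real) \<Rightarrow> (nat \<Rightarrow> 'a \<Rightarrow> real) \<Rightarrow> real \<Rightarrow> 'a \<Rightarrow> real" where
  "simple_eval n \<tau> \<xi> s \<omega> = (\<Sum>k<n. \<xi> k \<omega> * indicator {\<tau> k<..\<tau> (Suc k)} s)"

definition simple_integral_upto ::
    "(real \<Rightarrow> 'a \<Rightarrow> real) \<Rightarrow> nat \<Rightarrow> (nat \<Rightarrow> real) \<Rightarrow> (nat \<Rightarrow> 'a \<Rightarrow> real) \<Rightarrow> real \<Rightarrow> 'a \<Rightarrow> real" where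
  "simple_integral_upto W n \<tau> \<xi> t \<omega> =
     (\<Sum>k<n. \<xi> k \<omega> * (W (min t (\<tau> (Suc k))) \<omega> - W (min t (\<tau> k)) \<omega>))"

definition progressive :: "(real \<Rightarrow> 'a measure) \<Rightarrow> (real \<Rightarrow> 'a \<Rightarrow> real) \<Rightarrow> bool" where
  "progressive F H \<longleftrightarrow>
     (\<forall>t\<ge>0. (\<lambda>(s, \<omega>). H s \<omega>) \<in> borel_measurable (restrict_space borel {0..t} \<Otimes>\<^sub>M F t))"

text \<open>
  \<open>has_ito_integral M F W H t I\<close>: the random variable \<open>I\<close> is (a version of) the Ito integral of
  \<open>H\<close> with respect to the real \<open>F\<close>-Brownian motion \<open>W\<close> over \<open>[0, t]\<close>, i.e. the
  \<open>L\<^sup>2\<close>-limit of the integrals of simple processes that converge to \<open>H\<close> in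
  \<open>L\<^sup>2([0,t] \<times> M)\<close>. By the Ito isometry \<open>I\<close> does not depend on the approximating sequence
  (up to almost sure equality).  The \<open>L\<^sup>2\<close>-theory suffices below, as the integrands are bounded.
\<close>

definition has_ito_integral ::
    "'a measure \<Rightarrow> (real \<Rightarrow> 'a measure) \<Rightarrow> (real \<Rightarrow> 'a \<Rightarrow> real) \<Rightarrow> (real \<Rightarrow> 'a \<Rightarrow> real)
      \<Rightarrow> real \<Rightarrow> ('a \<Rightarrow> real) \<Rightarrow> bool" where
  "has_ito_integral M F W H t I \<longleftrightarrow>
     progressive F H \<and> I \<in> borel_measurable M \<and>
     (\<exists>n \<tau> \<xi>. (\<forall>m. simple_process M F (n m) (\<tau> m) (\<xi> m)) \<and>
        (\<lambda>m. \<integral>\<^sup>+\<omega>. (\<integral>\<^sup>+s\<in>{0..t}. ennreal ((simple_eval (n m) (\<tau> m) (\<xi> m) s \<omega> - H s \<omega>)\<^sup>2) \<partial>lborel) \<partial>M)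
          \<longlonglongrightarrow> 0 \<and>
        (\<lambda>m. \<integral>\<^sup>+\<omega>. ennreal ((simple_integral_upto W (n m) (\<tau> m) (\<xi> m) t \<omega> - I \<omega>)\<^sup>2) \<partial>M)
          \<longlonglongrightarrow> 0)"

section \<open>Jacobi processes\<close>

definition jacobi_drift ::
    "real \<Rightarrow> real \<Rightarrow> real \<Rightarrow> 'n \<Rightarrow> real ^ ('n::finite) \<Rightarrow> real" where
  "jacobi_drift \<kappa> p q i x =
     \<kappa> * ((p - q) - (p + q) * x $ i
          + 2 * (\<Sum>j\<in>UNIV - {i}. (1 - x $ i * x $ j) / (x $ i - x $ j)))"

text \<open>
  \<open>X\<close> is a strong solution of the Jacobi SDE driven by \<open>B\<close>, i.e. a continuous solution adapted to
  the augmented filtration of \<open>B\<close>, with values in the closed alcove and started in \<open>x0\<close>. The drift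
  is singular (and takes junk values, as \<open>u / 0 = 0\<close>) only on the boundary of the alcove; that the
  paths are reflected there means that the SDE holds without further boundary terms, with a
  pathwise Lebesgue integrable drift, and that the paths spend zero Lebesgue time on the boundary.
\<close>

definition jacobi_process ::
    "'a measure \<Rightarrow> (real \<Rightarrow> 'a \<Rightarrow> real ^ ('n::{finite,linorder})) \<Rightarrow> real \<Rightarrow> real \<Rightarrow> real
      \<Rightarrow> real ^ ('n::{finite,linorder}) \<Rightarrow> (real \<Rightarrow> 'a \<Rightarrow> real ^ ('n::{finite,linorder})) \<Rightarrow> bool" where
  "jacobi_process M B \<kappa> p q x0 X \<longleftrightarrow>
     (let F = augmented_filtration M B in
       prob_space M \<and> brownian_motion M F B \<and>
       x0 \<in> interior jacobi_alcove \<and>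
       (\<forall>t\<ge>0. X t \<in> borel_measurable (F t)) \<and>
       (\<forall>\<omega>\<in>space M. continuous_on {0..} (\<lambda>t. X t \<omega>)) \<and>
       (\<forall>\<omega>\<in>space M. \<forall>t\<ge>0. X t \<omega> \<in> jacobi_alcove) \<and>
       (AE \<omega> in M. X 0 \<omega> = x0) \<and>
       (AE \<omega> in M. {t. 0 \<le> t \<and> X t \<omega> \<in> frontier jacobi_alcove} \<in> null_sets lborel) \<and>
       (\<forall>i. AE \<omega> in M. \<forall>t\<ge>0. set_integrable lborel {0..t} (\<lambda>s. jacobi_drift \<kappa> p q i (X s \<omega>))) \<and>
       (\<forall>i. \<forall>t\<ge>0. \<exists>I.
          has_ito_integral M F (\<lambda>s \<omega>. B s \<omega> $ i) (\<lambda>s \<omega>. sqrt (2 * (1 - (X s \<omega> $ i)\<^sup>2))) t I \<and>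
          (AE \<omega> in M. X t \<omega> $ i =
             X 0 \<omega> $ i + I \<omega> + (LINT s:{0..t}|lborel. jacobi_drift \<kappa> p q i (X s \<omega>)))))"

end

theory Submission
  imports Defs
begin

text \<open>
  The product \<open>\<Prod>i. (y - x\<^sub>i)\<close> is affine in each coordinate of \<open>x\<close>, and the coordinates of the Jacobi
  process are driven by independent Brownian motions. Hence its drift along the process contains
  no second order terms; the singularities of the repulsion terms cancel, and the drift becomes
  \<open>- \<kappa>\<close> times the Jacobi differential operator, acting in \<open>y\<close>, applied to the product. The expected
  product therefore solves a triangular linear differential equation in its coefficients with
  respect to \<open>y\<close>. The monic Jacobi polynomial is a stationary solution, and uniqueness gives the claim.

  Ito's formula is only needed in expectation and only for such products. It is obtained by
  expanding the increments of the product over a uniform mesh: the pair terms have mean zero up to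
  small errors, and all terms of higher order are negligible. The singular drift is no obstacle,
  since its total variation is bounded by a linear combination of the coordinates of the process
  and of their martingale parts, and is thus square integrable.
\<close>

section \<open>Brownian increments\<close>

text \<open>The Ito integral is available only as an L2-limit, at each fixed time separately and up
  to null sets. Nothing is known about its paths, so a pathwise stochastic calculus is avoided. Two
  facts about the martingale part over one interval ]s,t] replace it: its increment has mean zero
  against bounded weights known at time s, and it is close in L2 to the Brownian increment
  multiplied by the diffusion coefficient frozen at s. The other obstacle is the drift. The
  definition makes it integrable on almost every path, which gives no control of expectations.
  Weighting the coordinate i with the number \<open>rk i\<close> of smaller indices gives every
  repulsion term a nonnegative contribution, and this turns bounds for the coordinates and for their
  Ito integrals into a second moment of the total variation. The second moment, and not just the
  first, is what makes the sums of squared drift increments vanish. At the end a stationary mean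
  only has to be recognized: the operator that governs the mean annihilates the root polynomial of
  the starting point, for every value of \<kappa>.\<close>

lemma distributed_normal_moment:
  assumes D: "distributed M lborel X (normal_density 0 \<sigma>)" and "\<sigma> > 0"
  shows "integrable M (\<lambda>\<omega>. X \<omega> ^ k)"
    and "integral\<^sup>L M X = 0"
    and "integral\<^sup>L M (\<lambda>\<omega>. X \<omega> ^ 2) = \<sigma>\<^sup>2"
    and "integral\<^sup>L M (\<lambda>\<omega>. X \<omega> ^ 4) = 3 * \<sigma> ^ 4"
proof -
  have 1: "integrable M (\<lambda>\<omega>. f (X \<omega>)) = integrable lborel (\<lambda>x. normal_density 0 \<sigma> x * f x)"
    if "f \<in> borel_measurable borel" for f :: "real \<Rightarrow> real"
    using distributed_integrable[OF D, of f] that by simp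
  have 2: "(\<integral>\<omega>. f (X \<omega>) \<partial>M) = (\<integral>x. normal_density 0 \<sigma> x * f x \<partial>lborel)"
    if "f \<in> borel_measurable borel" for f :: "real \<Rightarrow> real"
    using distributed_integral[OF D, of f] that by simp
  show "integrable M (\<lambda>\<omega>. X \<omega> ^ k)"
    using integrable_normal_moment[OF assms(2), of 0 k] by (subst 1) auto
  show "integral\<^sup>L M X = 0"
    using integral_normal_moment_odd[OF assms(2), of 0 0] by (subst 2[of "\<lambda>x. x"]) auto
  show "integral\<^sup>L M (\<lambda>\<omega>. X \<omega> ^ 2) = \<sigma>\<^sup>2"
    using integral_normal_moment_even[OF assms(2), of 0 1] assms(2) by (subst 2) auto
  show "integral\<^sup>L M (\<lambda>\<omega>. X \<omega> ^ 4) = 3 * \<sigma> ^ 4"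
    using integral_normal_moment_even[OF assms(2), of 0 2] assms(2)
    by (subst 2) (auto simp: fact_numeral power_divide simp flip: power_mult)
qed

lemma (in prob_space) indep_set_mono:
  "indep_set A C \<Longrightarrow> A' \<subseteq> A \<Longrightarrow> C' \<subseteq> C \<Longrightarrow> indep_set A' C'"
  unfolding indep_sets2_eq by (auto simp: subset_eq)

text \<open>What is kept of the augmented filtration is that it increases, consists of
  sub-sigma-algebras of \<open>M\<close> on the same space, and is independent of future Brownian
  increments; the last point is part of \<open>brownian_motion\<close>.\<close>

locale filtered_brownian_motion = prob_space M
  for M :: "'a measure" +
  fixes F :: "real \<Rightarrow> 'a measure" and B :: "real \<Rightarrow> 'a \<Rightarrow> real ^ 'n"
  assumes space_F: "space (F t) = space M"
    and sets_F: "0 \<le> t \<Longrightarrow> sets (F t) \<subseteq> sets M"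
    and sets_F_mono: "0 \<le> s \<Longrightarrow> s \<le> t \<Longrightarrow> sets (F s) \<subseteq> sets (F t)"
    and brownian: "brownian_motion M F B"
begin

lemma measurable_F_M: "0 \<le> t \<Longrightarrow> f \<in> measurable (F t) N \<Longrightarrow> f \<in> measurable M N"
  by (rule measurable_from_subalg[of M "F t"]) (auto simp: subalgebra_def space_F sets_F)

lemma measurable_F_mono: "0 \<le> s \<Longrightarrow> s \<le> t \<Longrightarrow> f \<in> measurable (F s) N \<Longrightarrow> f \<in> measurable (F t) N"
  by (rule measurable_from_subalg[of "F t" "F s"]) (auto simp: subalgebra_def space_F sets_F_mono)

lemma B_measurable_F: "0 \<le> t \<Longrightarrow> B t \<in> borel_measurable (F t)"
  and B_measurable: "0 \<le> t \<Longrightarrow> B t \<in> borel_measurable M"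
  using brownian by (auto simp: brownian_motion_def)

lemma B_nth_measurable: "0 \<le> t \<Longrightarrow> (\<lambda>\<omega>. B t \<omega> $ i) \<in> borel_measurable M"
  and B_nth_measurable_F: "0 \<le> s \<Longrightarrow> s \<le> t \<Longrightarrow> (\<lambda>\<omega>. B s \<omega> $ i) \<in> borel_measurable (F t)"
  using B_measurable[of t] measurable_F_mono[OF _ _ B_measurable_F, of s t]
  by (auto intro!: borel_measurable_continuous_on[OF _ , of "\<lambda>x. x $ i"] continuous_intros)

lemma increment_distributed:
  assumes "0 \<le> s" "s < t"
  shows "distributed M lborel (\<lambda>\<omega>. B t \<omega> $ i - B s \<omega> $ i) (normal_density 0 (sqrt (t - s)))"
  using brownian assms by (auto simp: brownian_motion_def)

text \<open>Independence is given between \<open>F s\<close> and the family of preimages under the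
  increment. The sigma-algebras generated by \<open>g\<close> and by \<open>h\<close> of the
  increment lie inside these two, and independence passes to smaller families.\<close>

lemma increment_indep:
  assumes st: "0 \<le> s" "s < t" and g: "g \<in> borel_measurable (F s)" and h: "h \<in> borel_measurable borel"
  shows "indep_var borel g borel (\<lambda>\<omega>. h (B t \<omega> - B s \<omega>))"
proof -
  let ?D = "\<lambda>\<omega>. B t \<omega> - B s \<omega>"
  have ind: "indep_set (sets (F s)) {?D -` A \<inter> space M | A. A \<in> sets borel}"
    using brownian st by (auto simp: brownian_motion_def)
  have g': "g \<in> borel_measurable M" and D: "?D \<in> borel_measurable M"
    using measurable_F_M[OF _ g] B_measurable[of s] B_measurable[of t] st by auto
  have 1: "sigma_sets (space M) {g -` A \<inter> space M | A. A \<in> sets borel} \<subseteq> sets (F s)"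
    using sets.sigma_sets_subset[of "{g -` A \<inter> space M | A. A \<in> sets borel}" "F s"]
      measurable_sets[OF g] by (auto simp: space_F)
  \<comment> \<open>The preimages of Borel sets already form a sigma-algebra, so closing a subfamily
    under \<open>sigma_sets\<close> does not leave them.\<close>
  have vim: "{?D -` A \<inter> space M | A. A \<in> sets borel} = sets (vimage_algebra (space M) ?D borel)"
    by (auto simp: sets_vimage_algebra2)
  have 2: "sigma_sets (space M) {(\<lambda>\<omega>. h (?D \<omega>)) -` A \<inter> space M | A. A \<in> sets borel}
      \<subseteq> {?D -` A \<inter> space M | A. A \<in> sets borel}"
    unfolding vim
  proof (rule sets.sigma_sets_subset[of _ "vimage_algebra (space M) ?D borel", simplified])
    have "(\<lambda>\<omega>. h (?D \<omega>)) \<in> borel_measurable (vimage_algebra (space M) ?D borel)"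
      by (rule measurable_compose[OF measurable_vimage_algebra1 h]) auto
    then show "{(\<lambda>\<omega>. h (?D \<omega>)) -` A \<inter> space M |A. A \<in> sets borel}
        \<subseteq> sets (vimage_algebra (space M) ?D borel)"
      by (auto dest: measurable_sets)
  qed
  show ?thesis
    unfolding indep_var_eq
  proof (intro conjI)
    show "indep_set (sigma_sets (space M) {g -` A \<inter> space M | A. A \<in> sets borel})
       (sigma_sets (space M) {(\<lambda>\<omega>. h (?D \<omega>)) -` A \<inter> space M | A. A \<in> sets borel})"
      by (rule indep_set_mono[OF ind 1 2])
  qed (use g' D h in auto)
qed

lemma increment_product:
  assumes st: "0 \<le> s" "s < t" and g: "g \<in> borel_measurable (F s)" "integrable M g"
    and h: "h \<in> borel_measurable borel" "integrable M (\<lambda>\<omega>. h (B t \<omega> - B s \<omega>))"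
  shows "integrable M (\<lambda>\<omega>. g \<omega> * h (B t \<omega> - B s \<omega>) :: real)"
    and "expectation (\<lambda>\<omega>. g \<omega> * h (B t \<omega> - B s \<omega>)) = expectation g * expectation (\<lambda>\<omega>. h (B t \<omega> - B s \<omega>))"
  using indep_var_integrable[OF increment_indep[OF st g(1) h(1)] g(2) h(2)]
    indep_var_lebesgue_integral[OF increment_indep[OF st g(1) h(1)] g(2) h(2)] by auto

lemma nth_borel [measurable]: "(\<lambda>x::real^'n. x $ i) \<in> borel_measurable borel"
  by (intro borel_measurable_continuous_onI continuous_intros)

lemma increment_moment:
  assumes "0 \<le> s" "s \<le> t"
  shows "integrable M (\<lambda>\<omega>. (B t \<omega> $ i - B s \<omega> $ i) ^ k)"
    and "expectation (\<lambda>\<omega>. B t \<omega> $ i - B s \<omega> $ i) = 0"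
    and "expectation (\<lambda>\<omega>. (B t \<omega> $ i - B s \<omega> $ i)\<^sup>2) = t - s"
    and "expectation (\<lambda>\<omega>. (B t \<omega> $ i - B s \<omega> $ i) ^ 4) = 3 * (t - s)\<^sup>2"
proof -
  consider "s = t" | "s < t" using assms by linarith
  then have "integrable M (\<lambda>\<omega>. (B t \<omega> $ i - B s \<omega> $ i) ^ k) \<and>
    expectation (\<lambda>\<omega>. B t \<omega> $ i - B s \<omega> $ i) = 0 \<and>
    expectation (\<lambda>\<omega>. (B t \<omega> $ i - B s \<omega> $ i)\<^sup>2) = t - s \<and>
    expectation (\<lambda>\<omega>. (B t \<omega> $ i - B s \<omega> $ i) ^ 4) = 3 * (t - s)\<^sup>2"
  proof cases
    case 1
    then show ?thesis by auto
  next
    case 2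
    have "sqrt (t - s) ^ 4 = (sqrt (t - s) ^ 2) ^ 2" by (simp flip: power_mult)
    then show ?thesis
      using distributed_normal_moment[OF increment_distributed[OF assms(1) 2, of i]] 2 by auto
  qed
  then show "integrable M (\<lambda>\<omega>. (B t \<omega> $ i - B s \<omega> $ i) ^ k)"
    and "expectation (\<lambda>\<omega>. B t \<omega> $ i - B s \<omega> $ i) = 0"
    and "expectation (\<lambda>\<omega>. (B t \<omega> $ i - B s \<omega> $ i)\<^sup>2) = t - s"
    and "expectation (\<lambda>\<omega>. (B t \<omega> $ i - B s \<omega> $ i) ^ 4) = 3 * (t - s)\<^sup>2" by auto
qed

lemma expectation_increment:
  assumes st: "0 \<le> s" "s \<le> t" and g: "g \<in> borel_measurable (F s)" "integrable M g"
  shows "integrable M (\<lambda>\<omega>. g \<omega> * (B t \<omega> $ i - B s \<omega> $ i) ^ k)"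
    and "expectation (\<lambda>\<omega>. g \<omega> * (B t \<omega> $ i - B s \<omega> $ i)) = 0"
    and "expectation (\<lambda>\<omega>. g \<omega> * (B t \<omega> $ i - B s \<omega> $ i)\<^sup>2) = (t - s) * expectation g"
proof -
  consider "s = t" | "s < t" using st by linarith
  then have "integrable M (\<lambda>\<omega>. g \<omega> * (B t \<omega> $ i - B s \<omega> $ i) ^ k) \<and>
     expectation (\<lambda>\<omega>. g \<omega> * (B t \<omega> $ i - B s \<omega> $ i)) = 0 \<and>
     expectation (\<lambda>\<omega>. g \<omega> * (B t \<omega> $ i - B s \<omega> $ i)\<^sup>2) = (t - s) * expectation g"
  proof cases
    case 1
    then show ?thesis using g by auto
  next
    case 2
    have int: "integrable M (\<lambda>\<omega>. ((B t \<omega> - B s \<omega>) $ i) ^ k)" for k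
      using increment_moment(1)[OF st, of i k] by simp
    note 3 = increment_product[OF st(1) 2 g, of "\<lambda>x. (x $ i) ^ k" for k, OF _ int]
    show ?thesis
      using 3(1)[of k] 3(2)[of 1] 3(2)[of 2] increment_moment(2,3)[OF st, of i] by simp
  qed
  then show "integrable M (\<lambda>\<omega>. g \<omega> * (B t \<omega> $ i - B s \<omega> $ i) ^ k)"
    and "expectation (\<lambda>\<omega>. g \<omega> * (B t \<omega> $ i - B s \<omega> $ i)) = 0"
    and "expectation (\<lambda>\<omega>. g \<omega> * (B t \<omega> $ i - B s \<omega> $ i)\<^sup>2) = (t - s) * expectation g" by auto
qed

text \<open>Here the independence of the driving coordinates enters. In the expansion of the product
  over a mesh it makes the second order terms, which always involve two distinct coordinates,
  centered.\<close>

lemma expectation_cross_increment: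
  assumes st: "0 \<le> s" "s \<le> t" and g: "g \<in> borel_measurable (F s)" "integrable M g" and ij: "i \<noteq> j"
  shows "integrable M (\<lambda>\<omega>. g \<omega> * ((B t \<omega> $ i - B s \<omega> $ i) * (B t \<omega> $ j - B s \<omega> $ j)))"
    and "expectation (\<lambda>\<omega>. g \<omega> * ((B t \<omega> $ i - B s \<omega> $ i) * (B t \<omega> $ j - B s \<omega> $ j))) = 0"
proof -
  consider "s = t" | "s < t" using st by linarith
  then have "integrable M (\<lambda>\<omega>. g \<omega> * ((B t \<omega> $ i - B s \<omega> $ i) * (B t \<omega> $ j - B s \<omega> $ j))) \<and>
    expectation (\<lambda>\<omega>. g \<omega> * ((B t \<omega> $ i - B s \<omega> $ i) * (B t \<omega> $ j - B s \<omega> $ j))) = 0"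
  proof cases
    case 1
    then show ?thesis using g by auto
  next
    case 2
    have "indep_vars (\<lambda>_. borel) (\<lambda>i \<omega>. (B t \<omega> - B s \<omega>) $ i) UNIV"
      using brownian st 2 by (auto simp: brownian_motion_def)
    then have ind: "indep_vars (\<lambda>_. borel) (\<lambda>i \<omega>. (B t \<omega> - B s \<omega>) $ i) {i, j}"
      by (rule indep_vars_subset) auto
    have int: "integrable M (\<lambda>\<omega>. (B t \<omega> - B s \<omega>) $ i)" for i
      using increment_moment(1)[OF st, of i 1] by simp
    show ?thesis
      using increment_product[OF st(1) 2 g, of "\<lambda>x. x $ i * x $ j"]
        indep_vars_integrable[OF _ ind int] indep_vars_lebesgue_integral[OF _ ind int]
        increment_moment(2)[OF st] ij
      by simp
  qed
  then show "integrable M (\<lambda>\<omega>. g \<omega> * ((B t \<omega> $ i - B s \<omega> $ i) * (B t \<omega> $ j - B s \<omega> $ j)))"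
    and "expectation (\<lambda>\<omega>. g \<omega> * ((B t \<omega> $ i - B s \<omega> $ i) * (B t \<omega> $ j - B s \<omega> $ j))) = 0" by auto
qed

end

section \<open>The Ito isometry for elementary integrands\<close>

context filtered_brownian_motion
begin

text \<open>The coefficients allowed in simple integrands. The clause \<open>0 \<le> a\<close> is
  included because \<open>F\<close> is known to consist of sub-sigma-algebras of \<open>M\<close>
  only at nonnegative times.\<close>

definition bounded_at :: "real \<Rightarrow> ('a \<Rightarrow> real) \<Rightarrow> bool" where
  "bounded_at a \<xi> \<longleftrightarrow> 0 \<le> a \<and> \<xi> \<in> borel_measurable (F a) \<and> (\<exists>C. \<forall>\<omega>\<in>space M. \<bar>\<xi> \<omega>\<bar> \<le> C)"

lemma bounded_at_mono: "bounded_at a \<xi> \<Longrightarrow> a \<le> b \<Longrightarrow> bounded_at b \<xi>"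
  by (auto simp: bounded_at_def intro: measurable_F_mono)

lemma bounded_at_mult:
  assumes "bounded_at a \<xi>" "bounded_at a \<eta>"
  shows "bounded_at a (\<lambda>\<omega>. \<xi> \<omega> * \<eta> \<omega>)"
proof -
  obtain C D where "\<forall>\<omega>\<in>space M. \<bar>\<xi> \<omega>\<bar> \<le> C" "\<forall>\<omega>\<in>space M. \<bar>\<eta> \<omega>\<bar> \<le> D"
    using assms by (auto simp: bounded_at_def)
  then have "\<forall>\<omega>\<in>space M. \<bar>\<xi> \<omega> * \<eta> \<omega>\<bar> \<le> C * D"
    by (fastforce simp: abs_mult intro!: mult_mono intro: order_trans[OF abs_ge_zero])
  then show ?thesis using assms by (auto simp: bounded_at_def)
qed

lemma bounded_at_measurable: "bounded_at a \<xi> \<Longrightarrow> \<xi> \<in> borel_measurable M"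
  by (auto simp: bounded_at_def intro: measurable_F_M)

lemma bounded_at_integrable_mult:
  assumes "bounded_at a \<xi>" "integrable M g"
  shows "integrable M (\<lambda>\<omega>. \<xi> \<omega> * g \<omega> :: real)"
proof -
  obtain C where C: "\<forall>\<omega>\<in>space M. \<bar>\<xi> \<omega>\<bar> \<le> C" using assms by (auto simp: bounded_at_def)
  have "AE \<omega> in M. norm (\<xi> \<omega> * g \<omega>) \<le> norm (C * \<bar>g \<omega>\<bar>)"
  proof (rule AE_I2)
    fix \<omega> assume "\<omega> \<in> space M"
    then have "\<bar>\<xi> \<omega>\<bar> \<le> C" "0 \<le> C" using C by (auto intro: order_trans[OF abs_ge_zero])
    then show "norm (\<xi> \<omega> * g \<omega>) \<le> norm (C * \<bar>g \<omega>\<bar>)" by (auto simp: abs_mult mult_right_mono)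
  qed
  moreover have "integrable M (\<lambda>\<omega>. C * \<bar>g \<omega>\<bar>)"
    by (intro integrable_mult_right integrable_abs assms)
  moreover have "(\<lambda>\<omega>. \<xi> \<omega> * g \<omega>) \<in> borel_measurable M"
    by (intro borel_measurable_times bounded_at_measurable[OF assms(1)] borel_measurable_integrable assms)
  ultimately show ?thesis using Bochner_Integration.integrable_bound by blast
qed

lemma bounded_at_integrable: "bounded_at a \<xi> \<Longrightarrow> integrable M \<xi>"
  using bounded_at_integrable_mult[of a \<xi> "\<lambda>_. 1"] unfolding mult_1_right by simp

text \<open>Both \<open>\<zeta>\<close> and the earlier increment are known at time
  \<open>c\<close>, so their product is a weight against the later, centered increment. This weight
  is unbounded, which is why \<open>expectation_increment\<close> is stated for integrable
  weights.\<close>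

lemma disjoint_increments:
  assumes t: "0 \<le> a" "a \<le> b" "b \<le> c" "c \<le> d" and \<zeta>: "bounded_at c \<zeta>"
  shows "has_bochner_integral M (\<lambda>\<omega>. \<zeta> \<omega> * (B b \<omega> $ i - B a \<omega> $ i) * (B d \<omega> $ i - B c \<omega> $ i)) 0"
proof -
  let ?g = "\<lambda>\<omega>. \<zeta> \<omega> * (B b \<omega> $ i - B a \<omega> $ i)"
  have "?g \<in> borel_measurable (F c)"
    using \<zeta> t B_nth_measurable_F[of b c i] B_nth_measurable_F[of a c i] by (auto simp: bounded_at_def)
  moreover have "integrable M ?g"
    using bounded_at_integrable_mult[OF \<zeta> increment_moment(1)[of a b i 1]] t by simp
  ultimately show ?thesis
    using expectation_increment(1)[of c d ?g i 1] expectation_increment(2)[of c d ?g i] t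
    by (auto simp: has_bochner_integral_iff)
qed

lemma squared_increment:
  assumes t: "c \<le> d" and \<zeta>: "bounded_at c \<zeta>"
  shows "has_bochner_integral M (\<lambda>\<omega>. \<zeta> \<omega> * (B d \<omega> $ i - B c \<omega> $ i) * (B d \<omega> $ i - B c \<omega> $ i))
    ((d - c) * expectation \<zeta>)"
  using expectation_increment(1)[of c d \<zeta> i 2] expectation_increment(3)[of c d \<zeta> i] t \<zeta>
    bounded_at_integrable[OF \<zeta>]
  by (auto simp: has_bochner_integral_iff power2_eq_square mult.assoc bounded_at_def)

text \<open>Two increments are correlated only through the overlap of their intervals: outside it,
  one of them lies in the future of everything else and averages to zero. The order of
  \<open>a\<close> and \<open>c\<close> is removed afterwards by symmetry.\<close>

lemma elementary_covariance_aux: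
  assumes \<xi>: "bounded_at a \<xi>" "a \<le> b" and \<eta>: "bounded_at c \<eta>" "c \<le> d" and ac: "a \<le> c"
  shows "has_bochner_integral M
    (\<lambda>\<omega>. (\<xi> \<omega> * (B b \<omega> $ i - B a \<omega> $ i)) * (\<eta> \<omega> * (B d \<omega> $ i - B c \<omega> $ i)))
    (expectation (\<lambda>\<omega>. \<xi> \<omega> * \<eta> \<omega>) * measure lborel ({a<..b} \<inter> {c<..d}))"
proof -
  define \<zeta> where "\<zeta> \<omega> = \<xi> \<omega> * \<eta> \<omega>" for \<omega>
  have a: "0 \<le> a" using \<xi> by (auto simp: bounded_at_def)
  have \<zeta>: "bounded_at c \<zeta>"
    unfolding \<zeta>_def using bounded_at_mult[OF bounded_at_mono[OF \<xi>(1) ac] \<eta>(1)] .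
  let ?D = "\<lambda>s t \<omega>. B t \<omega> $ i - B s \<omega> $ i"
  have "has_bochner_integral M (\<lambda>\<omega>. \<zeta> \<omega> * ?D a b \<omega> * ?D c d \<omega>)
     (expectation \<zeta> * measure lborel ({a<..b} \<inter> {c<..d}))"
  proof (cases "b \<le> c")
    case True
    then have e: "{a<..b} \<inter> {c<..d} = {}" by auto
    show ?thesis
      unfolding e using disjoint_increments[OF a \<xi>(2) True \<eta>(2) \<zeta>] by simp
  next
    case False
    define e where "e = min b d"
    have e: "c \<le> e" "e \<le> b" "e \<le> d" using False \<eta>(2) by (auto simp: e_def)
    have \<zeta>e: "bounded_at e \<zeta>" using bounded_at_mono[OF \<zeta> e(1)] .
    have eq: "{a<..b} \<inter> {c<..d} = {c<..e}" using ac by (auto simp: e_def)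
    note h = has_bochner_integral_add
    \<comment> \<open>Splitting at \<open>c\<close> and \<open>e\<close> gives six products of
      increments. The one over ]e,b] and ]e,d] vanishes identically, as \<open>e\<close> equals
      \<open>b\<close> or \<open>d\<close>; of the remaining five only the square over ]c,e] can
      have nonzero mean.\<close>
    have "has_bochner_integral M (\<lambda>\<omega>. \<zeta> \<omega> * ?D a c \<omega> * ?D c e \<omega> + (\<zeta> \<omega> * ?D a c \<omega> * ?D e d \<omega>
       + (\<zeta> \<omega> * ?D c e \<omega> * ?D c e \<omega> + (\<zeta> \<omega> * ?D c e \<omega> * ?D e d \<omega> + \<zeta> \<omega> * ?D c e \<omega> * ?D e b \<omega>))))
      (0 + (0 + ((e - c) * expectation \<zeta> + (0 + 0))))"
      by (intro h disjoint_increments squared_increment \<zeta> \<zeta>e) (use a ac e in auto)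
    moreover have "\<zeta> \<omega> * ?D a c \<omega> * ?D c e \<omega> + (\<zeta> \<omega> * ?D a c \<omega> * ?D e d \<omega>
       + (\<zeta> \<omega> * ?D c e \<omega> * ?D c e \<omega> + (\<zeta> \<omega> * ?D c e \<omega> * ?D e d \<omega> + \<zeta> \<omega> * ?D c e \<omega> * ?D e b \<omega>)))
       = \<zeta> \<omega> * ?D a b \<omega> * ?D c d \<omega>" for \<omega>
    proof (cases "e = b")
      case True then show ?thesis by (simp add: algebra_simps)
    next
      case False
      then have "e = d" by (auto simp: e_def min_def split: if_splits)
      then show ?thesis by (simp add: algebra_simps)
    qed
    ultimately show ?thesis unfolding eq using e by (simp add: mult.commute)
  qed
  moreover have "\<zeta> = (\<lambda>\<omega>. \<xi> \<omega> * \<eta> \<omega>)" by (simp add: \<zeta>_def fun_eq_iff)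
  ultimately show ?thesis by (simp add: mult_ac)
qed

lemma elementary_covariance:
  assumes \<xi>: "bounded_at a \<xi>" "a \<le> b" and \<eta>: "bounded_at c \<eta>" "c \<le> d"
  shows "has_bochner_integral M
    (\<lambda>\<omega>. (\<xi> \<omega> * (B b \<omega> $ i - B a \<omega> $ i)) * (\<eta> \<omega> * (B d \<omega> $ i - B c \<omega> $ i)))
    (expectation (\<lambda>\<omega>. \<xi> \<omega> * \<eta> \<omega>) * measure lborel ({a<..b} \<inter> {c<..d}))"
proof (cases "a \<le> c")
  case True
  then show ?thesis using elementary_covariance_aux[OF \<xi> \<eta>] by simp
next
  case False
  then have "c \<le> a" by simp
  from elementary_covariance_aux[OF \<eta> \<xi> this, of i] show ?thesis by (simp add: mult_ac Int_commute)
qed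

text \<open>The intervals may overlap and the index type is free. Hence the difference of two such
  integrands is again one, indexed by the disjoint sum of the index sets, and no common refinement
  has to be formed.\<close>

definition elementary :: "'k set \<Rightarrow> ('k \<Rightarrow> real) \<Rightarrow> ('k \<Rightarrow> real) \<Rightarrow> ('k \<Rightarrow> 'a \<Rightarrow> real) \<Rightarrow> bool" where
  "elementary K a b \<xi> \<longleftrightarrow> finite K \<and> (\<forall>k\<in>K. bounded_at (a k) (\<xi> k) \<and> a k \<le> b k)"

definition elementary_integral ::
    "'n \<Rightarrow> 'k set \<Rightarrow> ('k \<Rightarrow> real) \<Rightarrow> ('k \<Rightarrow> real) \<Rightarrow> ('k \<Rightarrow> 'a \<Rightarrow> real) \<Rightarrow> 'a \<Rightarrow> real" where
  "elementary_integral i K a b \<xi> \<omega> = (\<Sum>k\<in>K. \<xi> k \<omega> * (B (b k) \<omega> $ i - B (a k) \<omega> $ i))"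

definition elementary_fun ::
    "'k set \<Rightarrow> ('k \<Rightarrow> real) \<Rightarrow> ('k \<Rightarrow> real) \<Rightarrow> ('k \<Rightarrow> 'a \<Rightarrow> real) \<Rightarrow> 'a \<Rightarrow> real \<Rightarrow> real" where
  "elementary_fun K a b \<xi> \<omega> s = (\<Sum>k\<in>K. \<xi> k \<omega> * indicator {a k<..b k} s)"

lemma elementary_integral_measurable:
  "elementary K a b \<xi> \<Longrightarrow> elementary_integral i K a b \<xi> \<in> borel_measurable M"
  unfolding elementary_integral_def[abs_def]
  by (intro borel_measurable_sum borel_measurable_times borel_measurable_diff B_nth_measurable
      bounded_at_measurable) (force simp: elementary_def bounded_at_def)+

text \<open>Both sides expand into the same double sum over pairs of intervals, with entries the
  mean of \<open>\<xi> k * \<xi> l\<close> times the length of the overlap. On one side this is the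
  covariance of increments, on the other the time integral of a product of indicators.\<close>

lemma
  assumes "elementary K a b \<xi>"
  shows ito_isometry: "(\<integral>\<^sup>+\<omega>. ennreal ((elementary_integral i K a b \<xi> \<omega>)\<^sup>2) \<partial>M) =
      (\<integral>\<^sup>+\<omega>. (\<integral>\<^sup>+s. ennreal ((elementary_fun K a b \<xi> \<omega> s)\<^sup>2) \<partial>lborel) \<partial>M)"
    and integrable_elementary_integral_squared:
      "integrable M (\<lambda>\<omega>. (elementary_integral i K a b \<xi> \<omega>)\<^sup>2)"
proof -
  let ?m = "\<lambda>k l. measure lborel ({a k<..b k} \<inter> {a l<..b l})"
  have K: "finite K" and adm: "\<And>k. k \<in> K \<Longrightarrow> bounded_at (a k) (\<xi> k)" "\<And>k. k \<in> K \<Longrightarrow> a k \<le> b k"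
    using assms by (auto simp: elementary_def)
  have sq: "(elementary_integral i K a b \<xi> \<omega>)\<^sup>2 =
     (\<Sum>k\<in>K. \<Sum>l\<in>K. (\<xi> k \<omega> * (B (b k) \<omega> $ i - B (a k) \<omega> $ i)) * (\<xi> l \<omega> * (B (b l) \<omega> $ i - B (a l) \<omega> $ i)))" for \<omega>
    by (simp add: elementary_integral_def power2_eq_square sum_product)
  have J: "has_bochner_integral M (\<lambda>\<omega>. (elementary_integral i K a b \<xi> \<omega>)\<^sup>2)
     (\<Sum>k\<in>K. \<Sum>l\<in>K. expectation (\<lambda>\<omega>. \<xi> k \<omega> * \<xi> l \<omega>) * ?m k l)"
    unfolding sq by (intro has_bochner_integral_sum elementary_covariance adm)
  have ind: "has_bochner_integral lborel (\<lambda>s. x * (indicator {a k<..b k} s * indicator {a l<..b l} s)) (x * ?m k l)"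
    for x k l
  proof -
    have "emeasure lborel ({a k<..b k} \<inter> {a l<..b l}) \<le> emeasure lborel {min (a k) (a l)..max (b k) (b l)}"
      by (rule emeasure_mono) auto
    also have "\<dots> < \<infinity>" by (subst emeasure_lborel_Icc_eq) auto
    finally have "has_bochner_integral lborel (indicator ({a k<..b k} \<inter> {a l<..b l})) (?m k l)"
      by (intro has_bochner_integral_real_indicator) auto
    then have "has_bochner_integral lborel (\<lambda>s. x * indicator ({a k<..b k} \<inter> {a l<..b l}) s) (x * ?m k l)"
      by (rule has_bochner_integral_mult_right)
    then show ?thesis unfolding indicator_inter_arith .
  qed
  have in1: "(\<integral>\<^sup>+s. ennreal ((elementary_fun K a b \<xi> \<omega> s)\<^sup>2) \<partial>lborel) =
     ennreal (\<Sum>k\<in>K. \<Sum>l\<in>K. \<xi> k \<omega> * \<xi> l \<omega> * ?m k l)" 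
    and in2: "0 \<le> (\<Sum>k\<in>K. \<Sum>l\<in>K. \<xi> k \<omega> * \<xi> l \<omega> * ?m k l)" for \<omega>
  proof -
    have "has_bochner_integral lborel (\<lambda>s. \<Sum>k\<in>K. \<Sum>l\<in>K. \<xi> k \<omega> * \<xi> l \<omega> * (indicator {a k<..b k} s * indicator {a l<..b l} s))
       (\<Sum>k\<in>K. \<Sum>l\<in>K. \<xi> k \<omega> * \<xi> l \<omega> * ?m k l)"
      by (intro has_bochner_integral_sum ind)
    moreover have "(\<Sum>k\<in>K. \<Sum>l\<in>K. \<xi> k \<omega> * \<xi> l \<omega> * (indicator {a k<..b k} s * indicator {a l<..b l} s))
      = (elementary_fun K a b \<xi> \<omega> s)\<^sup>2" for s
      by (simp add: elementary_fun_def power2_eq_square sum_product mult_ac)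
    ultimately have hb: "has_bochner_integral lborel (\<lambda>s. (elementary_fun K a b \<xi> \<omega> s)\<^sup>2)
       (\<Sum>k\<in>K. \<Sum>l\<in>K. \<xi> k \<omega> * \<xi> l \<omega> * ?m k l)" by simp
    then show "0 \<le> (\<Sum>k\<in>K. \<Sum>l\<in>K. \<xi> k \<omega> * \<xi> l \<omega> * ?m k l)"
      by (metis (no_types, lifting) has_bochner_integral_iff integral_nonneg_AE AE_I2 zero_le_power2)
    show "(\<integral>\<^sup>+s. ennreal ((elementary_fun K a b \<xi> \<omega> s)\<^sup>2) \<partial>lborel) =
       ennreal (\<Sum>k\<in>K. \<Sum>l\<in>K. \<xi> k \<omega> * \<xi> l \<omega> * ?m k l)"
      using hb by (simp add: nn_integral_eq_integral has_bochner_integral_iff)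
  qed
  have int: "integrable M (\<lambda>\<omega>. \<xi> k \<omega> * \<xi> l \<omega>)" if "k \<in> K" "l \<in> K" for k l
    by (rule bounded_at_integrable_mult[OF adm(1)[OF that(1)] bounded_at_integrable[OF adm(1)[OF that(2)]]])
  then have R: "has_bochner_integral M (\<lambda>\<omega>. \<Sum>k\<in>K. \<Sum>l\<in>K. \<xi> k \<omega> * \<xi> l \<omega> * ?m k l)
     (\<Sum>k\<in>K. \<Sum>l\<in>K. expectation (\<lambda>\<omega>. \<xi> k \<omega> * \<xi> l \<omega>) * ?m k l)"
    by (intro has_bochner_integral_sum has_bochner_integral_mult_left) (auto simp: has_bochner_integral_iff)
  show "integrable M (\<lambda>\<omega>. (elementary_integral i K a b \<xi> \<omega>)\<^sup>2)" using J by (simp add: has_bochner_integral_iff)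
  have "(\<integral>\<^sup>+\<omega>. ennreal ((elementary_integral i K a b \<xi> \<omega>)\<^sup>2) \<partial>M) =
     ennreal (\<Sum>k\<in>K. \<Sum>l\<in>K. expectation (\<lambda>\<omega>. \<xi> k \<omega> * \<xi> l \<omega>) * ?m k l)"
    using J by (simp add: nn_integral_eq_integral has_bochner_integral_iff)
  also have "\<dots> = (\<integral>\<^sup>+\<omega>. (\<integral>\<^sup>+s. ennreal ((elementary_fun K a b \<xi> \<omega> s)\<^sup>2) \<partial>lborel) \<partial>M)"
    using R in2 by (simp add: in1 nn_integral_eq_integral has_bochner_integral_iff)
  finally show "(\<integral>\<^sup>+\<omega>. ennreal ((elementary_integral i K a b \<xi> \<omega>)\<^sup>2) \<partial>M) =
      (\<integral>\<^sup>+\<omega>. (\<integral>\<^sup>+s. ennreal ((elementary_fun K a b \<xi> \<omega> s)\<^sup>2) \<partial>lborel) \<partial>M)" .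
qed

end

section \<open>Increments of Ito integrals\<close>

text \<open>The squared L2-norm, with values in \<open>ennreal\<close>, so that it can be estimated
  before square integrability is known. It serves both for random variables and for processes on the
  product with Lebesgue measure.\<close>

definition sqn :: "'b measure \<Rightarrow> ('b \<Rightarrow> real) \<Rightarrow> ennreal" where
  "sqn P f = (\<integral>\<^sup>+x. ennreal ((f x)\<^sup>2) \<partial>P)"

text \<open>A substitute for the triangle inequality that stays with squares, from
  \<open>(x + y)\<^sup>2 \<le> 2 * x\<^sup>2 + 2 * y\<^sup>2\<close>. The factor 2 is harmless, as
  the results only concern finiteness, convergence to zero, or bounds up to a constant.\<close>

lemma sqn_add:
  assumes [measurable]: "f \<in> borel_measurable P" "g \<in> borel_measurable P"
  shows "sqn P (\<lambda>x. f x + g x) \<le> 2 * sqn P f + 2 * sqn P g"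
proof -
  have "ennreal ((f x + g x)\<^sup>2) \<le> 2 * ennreal ((f x)\<^sup>2) + 2 * ennreal ((g x)\<^sup>2)" for x
  proof -
    have "ennreal ((f x + g x)\<^sup>2) \<le> ennreal (2 * (f x)\<^sup>2 + 2 * (g x)\<^sup>2)"
      using sum_squares_bound[of "f x" "g x"] by (intro ennreal_leI) (simp add: power2_sum)
    then show ?thesis by (simp add: ennreal_plus ennreal_mult)
  qed
  then have "sqn P (\<lambda>x. f x + g x) \<le> (\<integral>\<^sup>+x. 2 * ennreal ((f x)\<^sup>2) + 2 * ennreal ((g x)\<^sup>2) \<partial>P)"
    unfolding sqn_def by (intro nn_integral_mono) auto
  also have "\<dots> = 2 * sqn P f + 2 * sqn P g"
    unfolding sqn_def by (simp add: nn_integral_add nn_integral_cmult)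
  finally show ?thesis .
qed

lemma sqn_uminus: "sqn P (\<lambda>x. - f x) = sqn P f"
  by (simp add: sqn_def)

lemma sqn_mono: "(\<And>x. x \<in> space P \<Longrightarrow> \<bar>f x\<bar> \<le> \<bar>g x\<bar>) \<Longrightarrow> sqn P f \<le> sqn P g"
  unfolding sqn_def by (intro nn_integral_mono ennreal_leI) (auto simp: abs_le_square_iff)

lemma sqn_iterated:
  assumes "(\<lambda>(\<omega>, s). f \<omega> s) \<in> borel_measurable (M \<Otimes>\<^sub>M lborel)"
  shows "(\<integral>\<^sup>+\<omega>. (\<integral>\<^sup>+s. ennreal ((f \<omega> s)\<^sup>2) \<partial>lborel) \<partial>M) = sqn (M \<Otimes>\<^sub>M lborel) (\<lambda>(\<omega>, s). f \<omega> s)"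
  unfolding sqn_def using assms
  by (subst lborel.nn_integral_fst[symmetric]) (auto simp: split_beta')

lemma (in prob_space) sqn_finite_integrable:
  assumes "f \<in> borel_measurable M" "sqn M f < \<infinity>"
  shows "integrable M (\<lambda>\<omega>. (f \<omega>)\<^sup>2)" "integrable M f"
proof -
  show 1: "integrable M (\<lambda>\<omega>. (f \<omega>)\<^sup>2)"
    using assms by (intro integrableI_nonneg) (auto simp: sqn_def)
  show "integrable M f" by (rule square_integrable_imp_integrable[OF assms(1) 1])
qed

text \<open>The cells that meet [s,t], possibly in a single point. The other cells would get
  reversed endpoints when truncated, which \<open>elementary\<close> excludes.\<close>

definition cut_index :: "real \<Rightarrow> real \<Rightarrow> nat \<Rightarrow> (nat \<Rightarrow> real) \<Rightarrow> nat set" where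
  "cut_index s t n \<tau> = {k. k < n \<and> max s (\<tau> k) \<le> min t (\<tau> (Suc k))}"

section \<open>Cutting simple processes to an interval and approximating increments of Ito
  integrals\<close>

context filtered_brownian_motion
begin

lemma elementary_fun_measurable:
  assumes "elementary K a b \<xi>"
  shows "(\<lambda>(\<omega>, s). elementary_fun K a b \<xi> \<omega> s) \<in> borel_measurable (M \<Otimes>\<^sub>M lborel)"
proof -
  have [measurable]: "\<xi> k \<in> borel_measurable M" if "k \<in> K" for k
    using assms that by (auto simp: elementary_def intro: bounded_at_measurable)
  show ?thesis unfolding elementary_fun_def split_beta' by measurable
qed

lemma simple_process_nonneg:
  assumes "simple_process M F n \<tau> \<xi>" "k \<le> n"
  shows "0 \<le> \<tau> k"
  using assms(2)
proof (induction k)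
  case 0 then show ?case using assms by (auto simp: simple_process_def)
next
  case (Suc k)
  then have "\<tau> k \<le> \<tau> (Suc k)" using assms(1) by (auto simp: simple_process_def)
  then show ?case using Suc by auto
qed

lemma simple_process_bounded_at:
  "simple_process M F n \<tau> \<xi> \<Longrightarrow> k < n \<Longrightarrow> bounded_at (\<tau> k) (\<xi> k)"
  using simple_process_nonneg[of n \<tau> \<xi> k] by (auto simp: simple_process_def bounded_at_def)

lemma simple_eval_measurable:
  assumes "simple_process M F n \<tau> \<xi>"
  shows "(\<lambda>(\<omega>, s). simple_eval n \<tau> \<xi> s \<omega>) \<in> borel_measurable (M \<Otimes>\<^sub>M lborel)"
proof -
  have [measurable]: "\<xi> k \<in> borel_measurable M" if "k \<in> {..<n}" for k
    using simple_process_bounded_at[OF assms, of k] that by (auto intro: bounded_at_measurable)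
  show ?thesis unfolding simple_eval_def split_beta' by measurable
qed

text \<open>Truncating every cell to [s,t] presents the increment of a simple integral as an
  elementary integral whose intervals start at \<open>s\<close> or later. This is the form that can
  be tested against weights known at time \<open>s\<close>.\<close>

lemma simple_process_cut:
  assumes sp: "simple_process M F n \<tau> \<xi>" and st: "0 \<le> s" "s \<le> t"
  defines "K \<equiv> cut_index s t n \<tau>" and "a \<equiv> \<lambda>k. max s (\<tau> k)" and "b \<equiv> \<lambda>k. min t (\<tau> (Suc k))"
  shows "elementary K a b \<xi>"
    and "elementary_integral i K a b \<xi> \<omega> =
      simple_integral_upto (\<lambda>s \<omega>. B s \<omega> $ i) n \<tau> \<xi> t \<omega> - simple_integral_upto (\<lambda>s \<omega>. B s \<omega> $ i) n \<tau> \<xi> s \<omega>"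
    and "elementary_fun K a b \<xi> \<omega> r = simple_eval n \<tau> \<xi> r \<omega> * indicator {s<..t} r"
proof -
  have K: "K \<subseteq> {..<n}" by (auto simp: K_def cut_index_def)
  have mono: "\<tau> k \<le> \<tau> (Suc k)" if "k < n" for k using sp that by (auto simp: simple_process_def)
  show "elementary K a b \<xi>"
    unfolding elementary_def
  proof (intro conjI ballI)
    show "finite K" using K finite_subset by blast
    fix k assume "k \<in> K"
    then have "k < n" using K by auto
    then show "bounded_at (a k) (\<xi> k)"
      unfolding a_def by (intro bounded_at_mono[OF simple_process_bounded_at[OF sp]]) auto
    show "a k \<le> b k" using \<open>k \<in> K\<close> by (auto simp: K_def cut_index_def a_def b_def)
  qed
  show "elementary_integral i K a b \<xi> \<omega> =
      simple_integral_upto (\<lambda>s \<omega>. B s \<omega> $ i) n \<tau> \<xi> t \<omega> - simple_integral_upto (\<lambda>s \<omega>. B s \<omega> $ i) n \<tau> \<xi> s \<omega>"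
    unfolding elementary_integral_def simple_integral_upto_def sum_subtractf[symmetric]
  proof (intro sum.mono_neutral_cong_left ballI)
    fix k assume "k \<in> {..<n} - K"
    then have "k < n" "max s (\<tau> k) > min t (\<tau> (Suc k))" by (auto simp: K_def cut_index_def)
    \<comment> \<open>A cell that is left out ends before \<open>s\<close> or begins after
      \<open>t\<close>; in both cases it contributes the same to the integrals up to
      \<open>t\<close> and up to \<open>s\<close>.\<close>
    then have "\<tau> (Suc k) < s \<or> t < \<tau> k" using mono[of k] st by (auto simp: max_def min_def split: if_splits)
    then show "\<xi> k \<omega> * (B (min t (\<tau> (Suc k))) \<omega> $ i - B (min t (\<tau> k)) \<omega> $ i) -
         \<xi> k \<omega> * (B (min s (\<tau> (Suc k))) \<omega> $ i - B (min s (\<tau> k)) \<omega> $ i) = 0"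
      using mono[of k] st \<open>k < n\<close> by (auto simp: min_def)
  next
    fix k assume "k \<in> K"
    then have k: "k < n" "s \<le> \<tau> (Suc k)" "\<tau> k \<le> t" by (auto simp: K_def cut_index_def)
    then have "min s (\<tau> (Suc k)) = s" "min t (\<tau> k) = \<tau> k" by auto
    then show "\<xi> k \<omega> * (B (b k) \<omega> $ i - B (a k) \<omega> $ i) = \<xi> k \<omega> * (B (min t (\<tau> (Suc k))) \<omega> $ i - B (min t (\<tau> k)) \<omega> $ i) -
         \<xi> k \<omega> * (B (min s (\<tau> (Suc k))) \<omega> $ i - B (min s (\<tau> k)) \<omega> $ i)"
      by (cases "s \<le> \<tau> k") (auto simp: a_def b_def algebra_simps)
  qed (use K in auto)
  show "elementary_fun K a b \<xi> \<omega> r = simple_eval n \<tau> \<xi> r \<omega> * indicator {s<..t} r"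
    unfolding elementary_fun_def simple_eval_def sum_distrib_right
  proof (intro sum.mono_neutral_cong_left ballI)
    fix k assume "k \<in> {..<n} - K"
    then have "k < n" "max s (\<tau> k) > min t (\<tau> (Suc k))" by (auto simp: K_def cut_index_def)
    then show "\<xi> k \<omega> * indicat_real {\<tau> k<..\<tau> (Suc k)} r * indicat_real {s<..t} r = 0"
      by (auto simp: indicator_def)
  next
    fix k assume "k \<in> K"
    show "\<xi> k \<omega> * indicator {a k<..b k} r = \<xi> k \<omega> * indicat_real {\<tau> k<..\<tau> (Suc k)} r * indicat_real {s<..t} r"
      by (auto simp: indicator_def a_def b_def)
  qed (use K in auto)
qed

lemma elementary_diff:
  assumes "elementary K a b \<xi>" "elementary L c d \<eta>"
  defines "\<zeta> \<equiv> case_sum \<xi> (\<lambda>l \<omega>. - \<eta> l \<omega>)"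
  shows "elementary (K <+> L) (case_sum a c) (case_sum b d) \<zeta>"
    and "elementary_integral i (K <+> L) (case_sum a c) (case_sum b d) \<zeta> \<omega> =
      elementary_integral i K a b \<xi> \<omega> - elementary_integral i L c d \<eta> \<omega>"
    and "elementary_fun (K <+> L) (case_sum a c) (case_sum b d) \<zeta> \<omega> r =
      elementary_fun K a b \<xi> \<omega> r - elementary_fun L c d \<eta> \<omega> r"
proof -
  have fin: "finite K" "finite L" using assms by (auto simp: elementary_def)
  show "elementary (K <+> L) (case_sum a c) (case_sum b d) \<zeta>"
    using assms by (auto simp: elementary_def bounded_at_def Plus_def)
  show "elementary_integral i (K <+> L) (case_sum a c) (case_sum b d) \<zeta> \<omega> =
      elementary_integral i K a b \<xi> \<omega> - elementary_integral i L c d \<eta> \<omega>"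
    using fin by (simp add: elementary_integral_def sum.Plus \<zeta>_def sum_negf)
  show "elementary_fun (K <+> L) (case_sum a c) (case_sum b d) \<zeta> \<omega> r =
      elementary_fun K a b \<xi> \<omega> r - elementary_fun L c d \<eta> \<omega> r"
    unfolding elementary_fun_def sum.Plus[OF fin] \<zeta>_def by (simp add: sum_negf comp_def)
qed

lemma ito_isometry_diff:
  assumes "elementary K a b \<xi>" "elementary L c d \<eta>"
  shows "sqn M (\<lambda>\<omega>. elementary_integral i K a b \<xi> \<omega> - elementary_integral i L c d \<eta> \<omega>) =
    sqn (M \<Otimes>\<^sub>M lborel) (\<lambda>(\<omega>, s). elementary_fun K a b \<xi> \<omega> s - elementary_fun L c d \<eta> \<omega> s)"
  using ito_isometry[OF elementary_diff(1)[OF assms], of i]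
    sqn_iterated[OF elementary_fun_measurable[OF elementary_diff(1)[OF assms]]]
  by (simp add: elementary_diff(2,3)[OF assms] sqn_def)

lemma sqn_elementary_finite:
  assumes "elementary K a b \<xi>" shows "sqn M (elementary_integral i K a b \<xi>) < \<infinity>"
  using integrable_elementary_integral_squared[OF assms, of i]
  by (simp add: sqn_def integrable_iff_bounded)

text \<open>One approximating simple integral at squared distance less than 1 is enough: it is
  square integrable by the isometry, and so is its difference from \<open>I\<close>.\<close>

lemma ito_integral_square_integrable:
  assumes I: "has_ito_integral M F (\<lambda>s \<omega>. B s \<omega> $ i) H t I" and t: "0 \<le> t"
  shows "sqn M I < \<infinity>"
proof -
  obtain n \<tau> \<xi> where sp: "\<And>m. simple_process M F (n m) (\<tau> m) (\<xi> m)"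
    and lim: "(\<lambda>m. sqn M (\<lambda>\<omega>. simple_integral_upto (\<lambda>s \<omega>. B s \<omega> $ i) (n m) (\<tau> m) (\<xi> m) t \<omega> - I \<omega>)) \<longlonglongrightarrow> 0"
    and Im: "I \<in> borel_measurable M"
    using I by (auto simp: has_ito_integral_def sqn_def)
  define S where "S m = simple_integral_upto (\<lambda>s \<omega>. B s \<omega> $ i) (n m) (\<tau> m) (\<xi> m) t" for m
  have S: "S m = elementary_integral i (cut_index 0 t (n m) (\<tau> m)) (\<lambda>k. max 0 (\<tau> m k)) (\<lambda>k. min t (\<tau> m (Suc k))) (\<xi> m)" for m
  proof
    fix \<omega>
    have "simple_integral_upto (\<lambda>s \<omega>. B s \<omega> $ i) (n m) (\<tau> m) (\<xi> m) 0 \<omega> = 0"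
      unfolding simple_integral_upto_def using simple_process_nonneg[OF sp[of m]]
      by (intro sum.neutral) auto
    then show "S m \<omega> = elementary_integral i (cut_index 0 t (n m) (\<tau> m)) (\<lambda>k. max 0 (\<tau> m k)) (\<lambda>k. min t (\<tau> m (Suc k))) (\<xi> m) \<omega>"
      using simple_process_cut(2)[OF sp[of m] order_refl t] by (simp add: S_def)
  qed
  have "eventually (\<lambda>m. sqn M (\<lambda>\<omega>. S m \<omega> - I \<omega>) < 1) sequentially"
    using order_tendstoD(2)[OF lim, of 1] by (simp add: S_def)
  then obtain m where m: "sqn M (\<lambda>\<omega>. S m \<omega> - I \<omega>) < 1" by (auto simp: eventually_sequentially)
  have el: "elementary (cut_index 0 t (n m) (\<tau> m)) (\<lambda>k. max 0 (\<tau> m k)) (\<lambda>k. min t (\<tau> m (Suc k))) (\<xi> m)"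
    using simple_process_cut(1)[OF sp[of m] order_refl t] .
  have Sm: "S m \<in> borel_measurable M" unfolding S by (rule elementary_integral_measurable[OF el])
  have "sqn M I = sqn M (\<lambda>\<omega>. S m \<omega> + - (S m \<omega> - I \<omega>))" by simp
  also have "\<dots> \<le> 2 * sqn M (S m) + 2 * sqn M (\<lambda>\<omega>. - (S m \<omega> - I \<omega>))"
    using Sm Im by (intro sqn_add) auto
  also have "\<dots> < \<infinity>"
    using sqn_elementary_finite[OF el, of i] m unfolding sqn_uminus S[symmetric]
    by (auto simp: ennreal_mult_eq_top_iff less_top[symmetric])
  finally show ?thesis .
qed

text \<open>The integrals up to \<open>t\<close> and up to \<open>s\<close> come with unrelated
  approximating sequences. Only the one for \<open>t\<close> is used, cut to ]s,t]. That its
  integrals up to \<open>s\<close> also converge to \<open>J\<close> follows from the isometry,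
  since both sequences approximate \<open>H\<close> on [0,s].\<close>

lemma ito_integral_increment_approx:
  assumes It: "has_ito_integral M F (\<lambda>s \<omega>. B s \<omega> $ i) H t I"
    and Is: "has_ito_integral M F (\<lambda>s \<omega>. B s \<omega> $ i) H s J" and st: "0 \<le> s" "s \<le> t"
    and Hm: "(\<lambda>(\<omega>, r). H r \<omega>) \<in> borel_measurable (M \<Otimes>\<^sub>M lborel)"
  obtains K :: "nat \<Rightarrow> nat set" and a b \<xi> where
    "\<And>m. elementary (K m) (a m) (b m) (\<xi> m)" "\<And>m k. s \<le> a m k"
    "(\<lambda>m. sqn (M \<Otimes>\<^sub>M lborel) (\<lambda>(\<omega>, r). elementary_fun (K m) (a m) (b m) (\<xi> m) \<omega> r - H r \<omega> * indicator {s<..t} r)) \<longlonglongrightarrow> 0"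
    "(\<lambda>m. sqn M (\<lambda>\<omega>. elementary_integral i (K m) (a m) (b m) (\<xi> m) \<omega> - (I \<omega> - J \<omega>))) \<longlonglongrightarrow> 0"
proof -
  let ?SI = "simple_integral_upto (\<lambda>s \<omega>. B s \<omega> $ i)"
  obtain n \<tau> \<xi> where sp: "\<And>m. simple_process M F (n m) (\<tau> m) (\<xi> m)"
    and l1: "(\<lambda>m. \<integral>\<^sup>+\<omega>. (\<integral>\<^sup>+r\<in>{0..t}. ennreal ((simple_eval (n m) (\<tau> m) (\<xi> m) r \<omega> - H r \<omega>)\<^sup>2) \<partial>lborel) \<partial>M)
          \<longlonglongrightarrow> 0"
    and l2: "(\<lambda>m. sqn M (\<lambda>\<omega>. ?SI (n m) (\<tau> m) (\<xi> m) t \<omega> - I \<omega>)) \<longlonglongrightarrow> 0"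
    and [measurable]: "I \<in> borel_measurable M"
    using It by (auto simp: has_ito_integral_def sqn_def)
  obtain n' \<tau>' \<xi>' where sp': "\<And>m. simple_process M F (n' m) (\<tau>' m) (\<xi>' m)"
    and l1': "(\<lambda>m. \<integral>\<^sup>+\<omega>. (\<integral>\<^sup>+r\<in>{0..s}. ennreal ((simple_eval (n' m) (\<tau>' m) (\<xi>' m) r \<omega> - H r \<omega>)\<^sup>2) \<partial>lborel) \<partial>M)
          \<longlonglongrightarrow> 0"
    and l2': "(\<lambda>m. sqn M (\<lambda>\<omega>. ?SI (n' m) (\<tau>' m) (\<xi>' m) s \<omega> - J \<omega>)) \<longlonglongrightarrow> 0"
    and [measurable]: "J \<in> borel_measurable M"
    using Is by (auto simp: has_ito_integral_def sqn_def)
  define \<phi> where "\<phi> m \<omega> r = simple_eval (n m) (\<tau> m) (\<xi> m) r \<omega>" for m \<omega> r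
  define \<phi>' where "\<phi>' m \<omega> r = simple_eval (n' m) (\<tau>' m) (\<xi>' m) r \<omega>" for m \<omega> r
  have \<phi>m: "(\<lambda>(\<omega>, r). \<phi> m \<omega> r) \<in> borel_measurable (M \<Otimes>\<^sub>M lborel)"
    and \<phi>m': "(\<lambda>(\<omega>, r). \<phi>' m \<omega> r) \<in> borel_measurable (M \<Otimes>\<^sub>M lborel)" for m
    unfolding \<phi>_def \<phi>'_def using simple_eval_measurable[OF sp] simple_eval_measurable[OF sp'] .
  have conv: "(\<integral>\<^sup>+\<omega>. (\<integral>\<^sup>+r\<in>{0..u}. ennreal ((f \<omega> r - H r \<omega>)\<^sup>2) \<partial>lborel) \<partial>M) =
      sqn (M \<Otimes>\<^sub>M lborel) (\<lambda>(\<omega>, r). (f \<omega> r - H r \<omega>) * indicator {0..u} r)"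
    if "(\<lambda>(\<omega>, r). f \<omega> r) \<in> borel_measurable (M \<Otimes>\<^sub>M lborel)" for f u
  proof -
    have "(\<lambda>(\<omega>, r). (f \<omega> r - H r \<omega>) * indicator {0..u} r) \<in> borel_measurable (M \<Otimes>\<^sub>M lborel)"
      using that Hm by (auto simp: split_beta' intro!: borel_measurable_times)
    moreover have "ennreal (x\<^sup>2) * indicator {0..u} r = ennreal ((x * indicator {0..u} r)\<^sup>2)" for x r :: real
      by (simp split: split_indicator)
    ultimately show ?thesis by (simp add: sqn_iterated)
  qed
  have l1: "(\<lambda>m. sqn (M \<Otimes>\<^sub>M lborel) (\<lambda>(\<omega>, r). (\<phi> m \<omega> r - H r \<omega>) * indicator {0..t} r)) \<longlonglongrightarrow> 0"
    using l1 conv[OF \<phi>m] by (simp add: \<phi>_def)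
  have l1': "(\<lambda>m. sqn (M \<Otimes>\<^sub>M lborel) (\<lambda>(\<omega>, r). (\<phi>' m \<omega> r - H r \<omega>) * indicator {0..s} r)) \<longlonglongrightarrow> 0"
    using l1' conv[OF \<phi>m'] by (simp add: \<phi>'_def)
  define K where "K m = cut_index s t (n m) (\<tau> m)" for m
  define a where "a m k = max s (\<tau> m k)" for m k
  define b where "b m k = min t (\<tau> m (Suc k))" for m k
  have ab: "a m = (\<lambda>k. max s (\<tau> m k))" "b m = (\<lambda>k. min t (\<tau> m (Suc k)))" for m
    by (auto simp: a_def b_def)
  note cut = simple_process_cut[OF sp st, folded K_def ab]
  note cut0 = simple_process_cut[OF sp order_refl st(1)]
  note cut0' = simple_process_cut[OF sp' order_refl st(1)]
  have SI0: "?SI (n m) (\<tau> m) (\<xi> m) 0 \<omega> = 0" "?SI (n' m) (\<tau>' m) (\<xi>' m) 0 \<omega> = 0" for m \<omega>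
    unfolding simple_integral_upto_def
    using simple_process_nonneg[OF sp[of m]] simple_process_nonneg[OF sp'[of m]]
    by (auto intro!: sum.neutral)
  have SIm: "?SI (n m) (\<tau> m) (\<xi> m) u \<in> borel_measurable M" 
    "?SI (n' m) (\<tau>' m) (\<xi>' m) u \<in> borel_measurable M" if "0 \<le> u" for m u
  proof -
    show "?SI (n m) (\<tau> m) (\<xi> m) u \<in> borel_measurable M"
      using elementary_integral_measurable[OF simple_process_cut(1)[OF sp order_refl that], of i m]
        simple_process_cut(2)[OF sp order_refl that, of i m]
      by (simp add: SI0 cong: measurable_cong)
    show "?SI (n' m) (\<tau>' m) (\<xi>' m) u \<in> borel_measurable M"
      using elementary_integral_measurable[OF simple_process_cut(1)[OF sp' order_refl that], of i m]
        simple_process_cut(2)[OF sp' order_refl that, of i m]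
      by (simp add: SI0 cong: measurable_cong)
  qed
  have t: "0 \<le> t" using st by simp
  note SIm[OF t, measurable] SIm[OF st(1), measurable] Hm[measurable] \<phi>m[measurable] \<phi>m'[measurable]
  \<comment> \<open>The isometry on ]0,s] compares the two sequences with each other;
    \<open>H\<close> is inserted as an intermediate function.\<close>
  have diff: "sqn M (\<lambda>\<omega>. ?SI (n' m) (\<tau>' m) (\<xi>' m) s \<omega> - ?SI (n m) (\<tau> m) (\<xi> m) s \<omega>) \<le>
     2 * sqn (M \<Otimes>\<^sub>M lborel) (\<lambda>(\<omega>, r). (\<phi>' m \<omega> r - H r \<omega>) * indicator {0..s} r) +
     2 * sqn (M \<Otimes>\<^sub>M lborel) (\<lambda>(\<omega>, r). (\<phi> m \<omega> r - H r \<omega>) * indicator {0..t} r)" for m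
  proof -
    have "sqn M (\<lambda>\<omega>. ?SI (n' m) (\<tau>' m) (\<xi>' m) s \<omega> - ?SI (n m) (\<tau> m) (\<xi> m) s \<omega>) =
      sqn (M \<Otimes>\<^sub>M lborel) (\<lambda>(\<omega>, r). \<phi>' m \<omega> r * indicator {0<..s} r - \<phi> m \<omega> r * indicator {0<..s} r)"
      using ito_isometry_diff[OF cut0'(1) cut0(1), of i m m]
      by (simp add: cut0'(2,3) cut0(2,3) SI0 \<phi>_def \<phi>'_def)
    also have "\<dots> \<le> sqn (M \<Otimes>\<^sub>M lborel) (\<lambda>x. (case x of (\<omega>, r) \<Rightarrow> (\<phi>' m \<omega> r - H r \<omega>) * indicator {0..s} r) +
         - (case x of (\<omega>, r) \<Rightarrow> (\<phi> m \<omega> r - H r \<omega>) * indicator {0..s} r))"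
      by (intro sqn_mono) (auto simp: indicator_def)
    also have "\<dots> \<le> 2 * sqn (M \<Otimes>\<^sub>M lborel) (\<lambda>(\<omega>, r). (\<phi>' m \<omega> r - H r \<omega>) * indicator {0..s} r) +
         2 * sqn (M \<Otimes>\<^sub>M lborel) (\<lambda>x. - (case x of (\<omega>, r) \<Rightarrow> (\<phi> m \<omega> r - H r \<omega>) * indicator {0..s} r))"
      by (intro sqn_add) measurable
    also have "\<dots> \<le> 2 * sqn (M \<Otimes>\<^sub>M lborel) (\<lambda>(\<omega>, r). (\<phi>' m \<omega> r - H r \<omega>) * indicator {0..s} r) +
       2 * sqn (M \<Otimes>\<^sub>M lborel) (\<lambda>(\<omega>, r). (\<phi> m \<omega> r - H r \<omega>) * indicator {0..t} r)"
      unfolding sqn_uminus using st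
      by (intro add_left_mono mult_left_mono sqn_mono) (auto simp: indicator_def)
    finally show ?thesis .
  qed
  show ?thesis
  proof (rule that[of K a b \<xi>])
    show "elementary (K m) (a m) (b m) (\<xi> m)" for m by (rule cut(1))
    show "s \<le> a m k" for m k by (simp add: a_def)
    show "(\<lambda>m. sqn (M \<Otimes>\<^sub>M lborel) (\<lambda>(\<omega>, r). elementary_fun (K m) (a m) (b m) (\<xi> m) \<omega> r - H r \<omega> * indicator {s<..t} r)) \<longlonglongrightarrow> 0"
    proof (rule tendsto_sandwich[OF _ _ tendsto_const l1])
      show "\<forall>\<^sub>F m in sequentially. sqn (M \<Otimes>\<^sub>M lborel) (\<lambda>(\<omega>, r). elementary_fun (K m) (a m) (b m) (\<xi> m) \<omega> r - H r \<omega> * indicator {s<..t} r)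
         \<le> sqn (M \<Otimes>\<^sub>M lborel) (\<lambda>(\<omega>, r). (\<phi> m \<omega> r - H r \<omega>) * indicator {0..t} r)"
        using st by (intro always_eventually allI sqn_mono) (auto simp: cut(3) \<phi>_def indicator_def)
    qed auto
    \<comment> \<open>Three errors add up: that of the approximation of \<open>I\<close>, that of
      \<open>J\<close>, and the discrepancy \<open>diff\<close> of the two sequences at time
      \<open>s\<close>. The factors come from repeated use of \<open>sqn_add\<close>.\<close>
    let ?R = "\<lambda>m. 2 * sqn M (\<lambda>\<omega>. ?SI (n m) (\<tau> m) (\<xi> m) t \<omega> - I \<omega>) + 2 * (
          2 * sqn M (\<lambda>\<omega>. ?SI (n' m) (\<tau>' m) (\<xi>' m) s \<omega> - J \<omega>) + 2 * (
      2 * sqn (M \<Otimes>\<^sub>M lborel) (\<lambda>(\<omega>, r). (\<phi>' m \<omega> r - H r \<omega>) * indicator {0..s} r) +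
     2 * sqn (M \<Otimes>\<^sub>M lborel) (\<lambda>(\<omega>, r). (\<phi> m \<omega> r - H r \<omega>) * indicator {0..t} r)))"
    have "?R \<longlonglongrightarrow> 2 * 0 + 2 * (2 * 0 + 2 * (2 * 0 + 2 * 0))"
      by (intro tendsto_add ennreal_tendsto_cmult l1 l1' l2 l2') auto
    then have R: "?R \<longlonglongrightarrow> 0" by simp
    show "(\<lambda>m. sqn M (\<lambda>\<omega>. elementary_integral i (K m) (a m) (b m) (\<xi> m) \<omega> - (I \<omega> - J \<omega>))) \<longlonglongrightarrow> 0"
    proof (rule tendsto_sandwich[OF _ _ tendsto_const R])
      have "sqn M (\<lambda>\<omega>. elementary_integral i (K m) (a m) (b m) (\<xi> m) \<omega> - (I \<omega> - J \<omega>)) \<le> ?R m" for m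
      proof -
        have "sqn M (\<lambda>\<omega>. elementary_integral i (K m) (a m) (b m) (\<xi> m) \<omega> - (I \<omega> - J \<omega>)) =
          sqn M (\<lambda>\<omega>. (?SI (n m) (\<tau> m) (\<xi> m) t \<omega> - I \<omega>) + (- (?SI (n' m) (\<tau>' m) (\<xi>' m) s \<omega> - J \<omega>) +
             (?SI (n' m) (\<tau>' m) (\<xi>' m) s \<omega> - ?SI (n m) (\<tau> m) (\<xi> m) s \<omega>)))"
          by (simp add: cut(2) algebra_simps)
        also have "\<dots> \<le> 2 * sqn M (\<lambda>\<omega>. ?SI (n m) (\<tau> m) (\<xi> m) t \<omega> - I \<omega>) +
           2 * sqn M (\<lambda>\<omega>. - (?SI (n' m) (\<tau>' m) (\<xi>' m) s \<omega> - J \<omega>) +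
             (?SI (n' m) (\<tau>' m) (\<xi>' m) s \<omega> - ?SI (n m) (\<tau> m) (\<xi> m) s \<omega>))"
          by (intro sqn_add) measurable
        also have "\<dots> \<le> 2 * sqn M (\<lambda>\<omega>. ?SI (n m) (\<tau> m) (\<xi> m) t \<omega> - I \<omega>) +
           2 * (2 * sqn M (\<lambda>\<omega>. - (?SI (n' m) (\<tau>' m) (\<xi>' m) s \<omega> - J \<omega>)) +
             2 * sqn M (\<lambda>\<omega>. ?SI (n' m) (\<tau>' m) (\<xi>' m) s \<omega> - ?SI (n m) (\<tau> m) (\<xi> m) s \<omega>))"
          by (intro add_left_mono mult_left_mono sqn_add) simp_all
        also have "\<dots> \<le> ?R m"
          unfolding sqn_uminus by (intro add_left_mono mult_left_mono diff) auto
        finally show ?thesis .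
      qed
      then show "\<forall>\<^sub>F m in sequentially. sqn M (\<lambda>\<omega>. elementary_integral i (K m) (a m) (b m) (\<xi> m) \<omega> - (I \<omega> - J \<omega>)) \<le> ?R m"
        by (intro always_eventually allI)
    qed auto
  qed
qed

end

section \<open>Mean and square of the increments of an Ito integral\<close>

context filtered_brownian_motion
begin

lemma expectation_elementary_integral:
  assumes el: "elementary K a b \<xi>" and g: "bounded_at s g" and a: "\<And>k. s \<le> a k"
  shows "expectation (\<lambda>\<omega>. g \<omega> * elementary_integral i K a b \<xi> \<omega>) = 0"
proof -
  have "has_bochner_integral M (\<lambda>\<omega>. (g \<omega> * \<xi> k \<omega>) * (B (b k) \<omega> $ i - B (a k) \<omega> $ i)) 0" if "k \<in> K" for k
  proof -
    have \<xi>: "bounded_at (a k) (\<xi> k)" "a k \<le> b k" using el that by (auto simp: elementary_def)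
    have k: "bounded_at (a k) (\<lambda>\<omega>. g \<omega> * \<xi> k \<omega>)" by (rule bounded_at_mult[OF bounded_at_mono[OF g a] \<xi>(1)])
    from k show ?thesis
      using expectation_increment(1)[of "a k" "b k" "\<lambda>\<omega>. g \<omega> * \<xi> k \<omega>" i 1]
        expectation_increment(2)[of "a k" "b k" "\<lambda>\<omega>. g \<omega> * \<xi> k \<omega>" i] bounded_at_integrable[OF k] \<xi>(2)
      by (auto simp: has_bochner_integral_iff bounded_at_def)
  qed
  then have "has_bochner_integral M (\<lambda>\<omega>. \<Sum>k\<in>K. (g \<omega> * \<xi> k \<omega>) * (B (b k) \<omega> $ i - B (a k) \<omega> $ i)) (\<Sum>k\<in>K. 0)"
    by (rule has_bochner_integral_sum)
  then show ?thesis
    by (simp add: elementary_integral_def sum_distrib_left mult.assoc has_bochner_integral_iff)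
qed

text \<open>Elementary integrals that start after \<open>s\<close> are centered against
  \<open>g\<close>. As \<open>g\<close> is bounded, this survives the L2-limit.\<close>

lemma ito_increment_mean:
  assumes It: "has_ito_integral M F (\<lambda>s \<omega>. B s \<omega> $ i) H t I"
    and Is: "has_ito_integral M F (\<lambda>s \<omega>. B s \<omega> $ i) H s J" and st: "0 \<le> s" "s \<le> t"
    and Hm: "(\<lambda>(\<omega>, r). H r \<omega>) \<in> borel_measurable (M \<Otimes>\<^sub>M lborel)"
    and g: "bounded_at s g"
  shows "integrable M (\<lambda>\<omega>. I \<omega> - J \<omega>)" and "expectation (\<lambda>\<omega>. g \<omega> * (I \<omega> - J \<omega>)) = 0"
proof -
  obtain K :: "nat \<Rightarrow> nat set" and a b \<xi> where el: "\<And>m. elementary (K m) (a m) (b m) (\<xi> m)"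
    and a: "\<And>m k. s \<le> a m k"
    and lim: "(\<lambda>m. sqn M (\<lambda>\<omega>. elementary_integral i (K m) (a m) (b m) (\<xi> m) \<omega> - (I \<omega> - J \<omega>))) \<longlonglongrightarrow> 0"
    by (rule ito_integral_increment_approx[OF It Is st Hm]) blast
  have IJ: "I \<in> borel_measurable M" "J \<in> borel_measurable M"
    using It Is by (auto simp: has_ito_integral_def)
  define E where "E m = elementary_integral i (K m) (a m) (b m) (\<xi> m)" for m
  have Em: "E m \<in> borel_measurable M" for m unfolding E_def by (rule elementary_integral_measurable[OF el])
  have Ei: "integrable M (E m)" for m
    using sqn_finite_integrable(2)[OF Em] sqn_elementary_finite[OF el, of i m] by (simp add: E_def)
  define D where "D m \<omega> = E m \<omega> - (I \<omega> - J \<omega>)" for m \<omega>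
  have Dm: "D m \<in> borel_measurable M" for m unfolding D_def using Em IJ by simp
  have lim: "(\<lambda>m. sqn M (D m)) \<longlonglongrightarrow> 0" using lim by (simp add: D_def[abs_def] E_def)
  have Dint: "integrable M (D m)" "integrable M (\<lambda>\<omega>. (D m \<omega>)\<^sup>2)" if "sqn M (D m) < ennreal e" for e m
    using sqn_finite_integrable[OF Dm[of m]] order.strict_trans[OF that ennreal_less_top] by auto
  have small: "\<exists>m. sqn M (D m) < ennreal e" if "e > 0" for e
    using order_tendstoD(2)[OF lim, of "ennreal e"] that by (auto simp: eventually_sequentially)
  obtain m0 where "sqn M (D m0) < ennreal 1" using small[of 1] by auto
  from Dint(1)[OF this] Ei[of m0] have "integrable M (\<lambda>\<omega>. E m0 \<omega> - D m0 \<omega>)" by auto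
  then show int: "integrable M (\<lambda>\<omega>. I \<omega> - J \<omega>)" by (simp add: D_def)
  obtain C where C: "\<And>\<omega>. \<omega> \<in> space M \<Longrightarrow> \<bar>g \<omega>\<bar> \<le> C" "C > 0"
  proof -
    obtain C0 where "\<forall>\<omega>\<in>space M. \<bar>g \<omega>\<bar> \<le> C0" using g by (auto simp: bounded_at_def)
    then show ?thesis by (intro that[of "\<bar>C0\<bar> + 1"]) auto
  qed
  let ?x = "expectation (\<lambda>\<omega>. g \<omega> * (I \<omega> - J \<omega>))"
  have le: "\<bar>?x\<bar> \<le> 2 * C * e" if e: "e > 0" for e
  proof -
    obtain m where m: "sqn M (D m) < ennreal (e\<^sup>2)" using small[of "e\<^sup>2"] e by auto
    note Di = Dint[OF m]
    have "sqn M (D m) = ennreal (expectation (\<lambda>\<omega>. (D m \<omega>)\<^sup>2))"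
      unfolding sqn_def by (rule nn_integral_eq_integral[OF Di(2)]) simp
    then have D2: "expectation (\<lambda>\<omega>. (D m \<omega>)\<^sup>2) < e\<^sup>2"
      using m by (metis ennreal_less_iff integral_nonneg_AE AE_I2 zero_le_power2)
    have "?x = expectation (\<lambda>\<omega>. g \<omega> * E m \<omega> - g \<omega> * D m \<omega>)" by (simp add: D_def algebra_simps)
    also have "\<dots> = expectation (\<lambda>\<omega>. g \<omega> * E m \<omega>) - expectation (\<lambda>\<omega>. g \<omega> * D m \<omega>)"
      by (intro Bochner_Integration.integral_diff bounded_at_integrable_mult[OF g] Ei Di)
    also have "\<dots> = - expectation (\<lambda>\<omega>. g \<omega> * D m \<omega>)"
      using expectation_elementary_integral[OF el g a, of i m] by (simp add: E_def)
    finally have "\<bar>?x\<bar> = \<bar>expectation (\<lambda>\<omega>. g \<omega> * D m \<omega>)\<bar>" by simp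
    also have "\<dots> \<le> expectation (\<lambda>\<omega>. \<bar>g \<omega> * D m \<omega>\<bar>)"
      by (rule integral_abs_bound)
    \<comment> \<open>A weighted mean inequality takes the place of Cauchy-Schwarz: since the second
      moment of \<open>D m\<close> is below \<open>e\<^sup>2\<close>, both summands are of order
      \<open>e\<close>.\<close>
    also have "\<dots> \<le> expectation (\<lambda>\<omega>. C * (e + (D m \<omega>)\<^sup>2 / e))"
    proof (rule integral_mono)
      show "integrable M (\<lambda>\<omega>. \<bar>g \<omega> * D m \<omega>\<bar>)"
        by (intro integrable_abs bounded_at_integrable_mult[OF g] Di)
      show "integrable M (\<lambda>\<omega>. C * (e + (D m \<omega>)\<^sup>2 / e))" using Di by simp
      fix \<omega> assume w: "\<omega> \<in> space M"
      have "\<bar>D m \<omega>\<bar> * e \<le> e\<^sup>2 + (D m \<omega>)\<^sup>2"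
      proof -
        have "0 \<le> (\<bar>D m \<omega>\<bar> - e)\<^sup>2" by simp
        then have "2 * (\<bar>D m \<omega>\<bar> * e) \<le> e\<^sup>2 + (D m \<omega>)\<^sup>2" by (simp add: power2_diff)
        moreover have "0 \<le> \<bar>D m \<omega>\<bar> * e" using e by simp
        ultimately show ?thesis by linarith
      qed
      then have "\<bar>D m \<omega>\<bar> \<le> e + (D m \<omega>)\<^sup>2 / e" using e by (simp add: field_simps power2_eq_square)
      then show "\<bar>g \<omega> * D m \<omega>\<bar> \<le> C * (e + (D m \<omega>)\<^sup>2 / e)"
        using C(1)[OF w] by (simp add: abs_mult mult_mono)
    qed
    also have "\<dots> = C * (e + expectation (\<lambda>\<omega>. (D m \<omega>)\<^sup>2) / e)"
      using Di by (simp add: prob_space)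
    also have "\<dots> \<le> C * (e + e\<^sup>2 / e)"
      using D2 C e by (intro mult_left_mono add_left_mono divide_right_mono) auto
    also have "\<dots> = 2 * C * e" using e by (simp add: power2_eq_square)
    finally show ?thesis .
  qed
  show "?x = 0"
  proof (rule ccontr)
    assume "?x \<noteq> 0"
    \<comment> \<open>The value of \<open>e\<close> is chosen so that \<open>2 * C * e\<close> is
      half of the number to be bounded.\<close>
    then have "\<bar>?x\<bar> \<le> \<bar>?x\<bar> / 2" using le[of "\<bar>?x\<bar> / (4 * C)"] C(2) by (simp add: field_simps)
    then show False using \<open>?x \<noteq> 0\<close> by simp
  qed
qed

text \<open>The product of \<open>\<eta>\<close> with the Brownian increment is itself an elementary
  integral with one interval, so the isometry measures its distance to the approximating integrals.
  The constant 4 results from two uses of \<open>sqn_add\<close>.\<close>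

lemma ito_increment_square:
  assumes It: "has_ito_integral M F (\<lambda>s \<omega>. B s \<omega> $ i) H t I"
    and Is: "has_ito_integral M F (\<lambda>s \<omega>. B s \<omega> $ i) H s J" and st: "0 \<le> s" "s \<le> t"
    and Hm: "(\<lambda>(\<omega>, r). H r \<omega>) \<in> borel_measurable (M \<Otimes>\<^sub>M lborel)"
    and \<eta>: "bounded_at s \<eta>"
  shows "sqn M (\<lambda>\<omega>. I \<omega> - J \<omega> - \<eta> \<omega> * (B t \<omega> $ i - B s \<omega> $ i))
    \<le> 4 * sqn (M \<Otimes>\<^sub>M lborel) (\<lambda>(\<omega>, r). (H r \<omega> - \<eta> \<omega>) * indicator {s<..t} r)"
proof -
  obtain K :: "nat \<Rightarrow> nat set" and a b \<xi> where el: "\<And>m. elementary (K m) (a m) (b m) (\<xi> m)"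
    and l1: "(\<lambda>m. sqn (M \<Otimes>\<^sub>M lborel) (\<lambda>(\<omega>, r). elementary_fun (K m) (a m) (b m) (\<xi> m) \<omega> r - H r \<omega> * indicator {s<..t} r)) \<longlonglongrightarrow> 0"
    and l2: "(\<lambda>m. sqn M (\<lambda>\<omega>. elementary_integral i (K m) (a m) (b m) (\<xi> m) \<omega> - (I \<omega> - J \<omega>))) \<longlonglongrightarrow> 0"
    by (rule ito_integral_increment_approx[OF It Is st Hm]) blast
  have [measurable]: "I \<in> borel_measurable M" "J \<in> borel_measurable M"
    using It Is by (auto simp: has_ito_integral_def)
  note Hm[measurable] elementary_integral_measurable[OF el, measurable]
    elementary_fun_measurable[OF el, measurable] bounded_at_measurable[OF \<eta>, measurable]
  have [measurable]: "(\<lambda>\<omega>. B t \<omega> $ i) \<in> borel_measurable M" "(\<lambda>\<omega>. B s \<omega> $ i) \<in> borel_measurable M"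
    using st by (auto intro: B_nth_measurable)
  have els: "elementary {()} (\<lambda>_. s) (\<lambda>_. t) (\<lambda>_. \<eta>)" using \<eta> st by (simp add: elementary_def)
  let ?L = "sqn M (\<lambda>\<omega>. I \<omega> - J \<omega> - \<eta> \<omega> * (B t \<omega> $ i - B s \<omega> $ i))"
  let ?S = "sqn (M \<Otimes>\<^sub>M lborel) (\<lambda>(\<omega>, r). (H r \<omega> - \<eta> \<omega>) * indicator {s<..t} r)"
  let ?A = "\<lambda>m. sqn (M \<Otimes>\<^sub>M lborel) (\<lambda>(\<omega>, r). elementary_fun (K m) (a m) (b m) (\<xi> m) \<omega> r - H r \<omega> * indicator {s<..t} r)"
  let ?D = "\<lambda>m. sqn M (\<lambda>\<omega>. elementary_integral i (K m) (a m) (b m) (\<xi> m) \<omega> - (I \<omega> - J \<omega>))"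
  have "?L \<le> 2 * ?D m + 2 * (2 * ?A m + 2 * ?S)" for m
  proof -
    have "?L = sqn M (\<lambda>\<omega>. - (elementary_integral i (K m) (a m) (b m) (\<xi> m) \<omega> - (I \<omega> - J \<omega>)) +
      (elementary_integral i (K m) (a m) (b m) (\<xi> m) \<omega> - elementary_integral i {()} (\<lambda>_. s) (\<lambda>_. t) (\<lambda>_. \<eta>) \<omega>))"
      by (simp add: elementary_integral_def algebra_simps)
    also have "\<dots> \<le> 2 * ?D m + 2 * sqn M (\<lambda>\<omega>. elementary_integral i (K m) (a m) (b m) (\<xi> m) \<omega> - elementary_integral i {()} (\<lambda>_. s) (\<lambda>_. t) (\<lambda>_. \<eta>) \<omega>)"
      using elementary_integral_measurable[OF els] unfolding sqn_uminus[of M, symmetric, of "\<lambda>\<omega>. elementary_integral i (K m) (a m) (b m) (\<xi> m) \<omega> - (I \<omega> - J \<omega>)"]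
      by (intro sqn_add) simp_all
    also have "sqn M (\<lambda>\<omega>. elementary_integral i (K m) (a m) (b m) (\<xi> m) \<omega> - elementary_integral i {()} (\<lambda>_. s) (\<lambda>_. t) (\<lambda>_. \<eta>) \<omega>)
      = sqn (M \<Otimes>\<^sub>M lborel) (\<lambda>x. (case x of (\<omega>, r) \<Rightarrow> elementary_fun (K m) (a m) (b m) (\<xi> m) \<omega> r - H r \<omega> * indicator {s<..t} r)
        + (case x of (\<omega>, r) \<Rightarrow> (H r \<omega> - \<eta> \<omega>) * indicator {s<..t} r))"
      unfolding ito_isometry_diff[OF el els]
      by (intro arg_cong[where f = "sqn _"]) (auto simp: elementary_fun_def fun_eq_iff algebra_simps)
    also have "\<dots> \<le> 2 * ?A m + 2 * ?S" by (intro sqn_add) measurable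
    finally show ?thesis by (simp add: add_left_mono mult_left_mono)
  qed
  moreover have "(\<lambda>m. 2 * ?D m + 2 * (2 * ?A m + 2 * ?S)) \<longlonglongrightarrow> 2 * 0 + 2 * (2 * 0 + 2 * ?S)"
    by (intro tendsto_add ennreal_tendsto_cmult l1 l2 tendsto_const) auto
  ultimately have "?L \<le> 2 * 0 + 2 * (2 * 0 + 2 * ?S)" by (intro LIMSEQ_le_const) auto
  then show ?thesis by (simp add: mult.assoc[symmetric])
qed

end

section \<open>Uniform meshes\<close>

text \<open>The interval [0,T] is divided into \<open>Suc m\<close> cells, so that the number of
  cells is positive for every \<open>m\<close>.\<close>

definition mesh :: "real \<Rightarrow> nat \<Rightarrow> nat \<Rightarrow> real" where
  "mesh T m k = T * real k / real (Suc m)"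

text \<open>The index of the cell containing \<open>s\<close>. Cells are open on the left and closed
  on the right, as for simple processes, hence the ceiling and the shift by one; the formula is
  meaningful for \<open>0 < s\<close>.\<close>

definition mesh_cell :: "real \<Rightarrow> nat \<Rightarrow> real \<Rightarrow> nat" where
  "mesh_cell T m s = nat \<lceil>s * real (Suc m) / T\<rceil> - 1"

lemma mesh_0 [simp]: "mesh T m 0 = 0" and mesh_last [simp]: "mesh T m (Suc m) = T"
  by (simp_all add: mesh_def)

lemma mesh_mono: "0 \<le> T \<Longrightarrow> k \<le> l \<Longrightarrow> mesh T m k \<le> mesh T m l"
  unfolding mesh_def by (intro divide_right_mono mult_left_mono) auto

lemma mesh_bounds:
  assumes "0 \<le> T" "k < Suc m"
  shows "0 \<le> mesh T m k" "mesh T m k \<le> mesh T m (Suc k)" "mesh T m (Suc k) \<le> T"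
  using mesh_mono[OF assms(1), of 0 k m] mesh_mono[OF assms(1), of k "Suc k" m]
    mesh_mono[OF assms(1), of "Suc k" "Suc m" m] assms by auto

lemma mesh_step: "mesh T m (Suc k) - mesh T m k = T / real (Suc m)"
  unfolding mesh_def diff_divide_distrib[symmetric] right_diff_distrib[symmetric] by simp

lemma mesh_cell:
  assumes "0 < s" "s \<le> T"
  shows "mesh_cell T m s < Suc m" "mesh T m (mesh_cell T m s) < s" "s \<le> mesh T m (Suc (mesh_cell T m s))"
proof -
  define x where "x = s * real (Suc m) / T"
  have T: "T > 0" using assms by simp
  have "s * real (Suc m) \<le> T * real (Suc m)" by (intro mult_right_mono assms) simp
  then have x: "0 < x" "x \<le> real (Suc m)"
    using assms(1) T unfolding x_def pos_divide_le_eq[OF T] mult.commute[of T] by simp_all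
  have "\<lceil>x\<rceil> \<le> int (Suc m)" using x by (simp add: ceiling_le_iff)
  moreover have "1 \<le> \<lceil>x\<rceil>" using x by (simp add: le_ceiling_iff)
  ultimately have c: "mesh_cell T m s < Suc m" "int (Suc (mesh_cell T m s)) = \<lceil>x\<rceil>"
    unfolding mesh_cell_def x_def[symmetric] by auto
  then show "mesh_cell T m s < Suc m" by simp
  have "real (Suc (mesh_cell T m s)) = of_int \<lceil>x\<rceil>" using c(2) by (metis of_int_of_nat_eq)
  then have "real (mesh_cell T m s) < x" "x \<le> real (Suc (mesh_cell T m s))"
    using ceiling_correct[of x] by auto
  then have "real (mesh_cell T m s) * T < s * real (Suc m)" "s * real (Suc m) \<le> real (Suc (mesh_cell T m s)) * T"
    unfolding x_def using T by (simp_all only: pos_less_divide_eq pos_divide_le_eq)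
  then show "mesh T m (mesh_cell T m s) < s" "s \<le> mesh T m (Suc (mesh_cell T m s))"
    unfolding mesh_def mult.commute[of T] by (simp_all only: pos_divide_less_eq pos_le_divide_eq of_nat_0_less_iff zero_less_Suc)
qed

lemma mesh_cell_unique:
  assumes "0 < T" "mesh T m k < s" "s \<le> mesh T m (Suc k)"
  shows "mesh_cell T m s = k"
proof -
  have "\<lceil>s * real (Suc m) / T\<rceil> = int (Suc k)"
  proof (rule ceiling_unique)
    have "real k * T < s * real (Suc m)" "s * real (Suc m) \<le> real (Suc k) * T"
      using assms(2,3) unfolding mesh_def mult.commute[of T]
      by (simp_all only: pos_divide_less_eq pos_le_divide_eq of_nat_0_less_iff zero_less_Suc)
    then have "real k < s * real (Suc m) / T" "s * real (Suc m) / T \<le> real (Suc k)"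
      using assms(1) by (simp_all only: pos_less_divide_eq pos_divide_le_eq)
    then show "of_int (int (Suc k)) - 1 < s * real (Suc m) / T" "s * real (Suc m) / T \<le> of_int (int (Suc k))"
      by simp_all
  qed
  then show ?thesis by (simp add: mesh_cell_def)
qed

lemma sum_mesh_indicator:
  assumes "0 < T"
  shows "(\<Sum>k<Suc m. f k * indicator {mesh T m k<..mesh T m (Suc k)} s) =
    f (mesh_cell T m s) * (indicator {0<..T} s :: 'b::semiring_1)"
proof (cases "s \<in> {0<..T}")
  case True
  have "(\<Sum>k<Suc m. f k * indicator {mesh T m k<..mesh T m (Suc k)} s) =
     (\<Sum>k\<in>{mesh_cell T m s}. f k * indicator {mesh T m k<..mesh T m (Suc k)} s)"
  proof (intro sum.mono_neutral_right ballI)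
    show "{mesh_cell T m s} \<subseteq> {..<Suc m}" using True mesh_cell(1)[of s T m] by simp
    fix k assume "k \<in> {..<Suc m} - {mesh_cell T m s}"
    then have "s \<notin> {mesh T m k<..mesh T m (Suc k)}"
      using mesh_cell_unique[OF assms, of m k s] by auto
    then show "f k * indicator {mesh T m k<..mesh T m (Suc k)} s = 0" by simp
  qed simp
  moreover have "s \<in> {mesh T m (mesh_cell T m s)<..mesh T m (Suc (mesh_cell T m s))}"
    using True mesh_cell(2,3)[of s T m] by simp
  ultimately show ?thesis using True by (simp only: sum.insert sum.empty finite.emptyI empty_iff indicator_simps if_True) simp
next
  case False
  have "s \<notin> {mesh T m k<..mesh T m (Suc k)}" if "k < Suc m" for k
    using False mesh_bounds[of T k m] assms that by auto
  then show ?thesis using False by (auto intro!: sum.neutral)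
qed

lemma mesh_cell_limit:
  assumes "0 < s" "s \<le> T"
  shows "(\<lambda>m. mesh T m (mesh_cell T m s)) \<longlonglongrightarrow> s" "(\<lambda>m. mesh T m (Suc (mesh_cell T m s))) \<longlonglongrightarrow> s"
proof -
  have z: "(\<lambda>m. T / real (Suc m)) \<longlonglongrightarrow> 0"
    by (rule LIMSEQ_Suc[OF lim_const_over_n])
  have b: "s - T / real (Suc m) \<le> mesh T m (mesh_cell T m s)" "mesh T m (mesh_cell T m s) \<le> s"
    "s \<le> mesh T m (Suc (mesh_cell T m s))" "mesh T m (Suc (mesh_cell T m s)) \<le> s + T / real (Suc m)" for m
    using mesh_cell[OF assms, of m] mesh_step[of T m "mesh_cell T m s"] by linarith+
  show "(\<lambda>m. mesh T m (mesh_cell T m s)) \<longlonglongrightarrow> s"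
    by (rule tendsto_sandwich[OF _ _ _ tendsto_const]) (use b tendsto_diff[OF tendsto_const z, of s] in auto)
  show "(\<lambda>m. mesh T m (Suc (mesh_cell T m s))) \<longlonglongrightarrow> s"
    by (rule tendsto_sandwich[OF _ _ tendsto_const]) (use b tendsto_add[OF tendsto_const z, of s] in auto)
qed

text \<open>The sum over the cells is a single integral over \<open>M\<close> and ]0,T], because at
  the point \<open>r\<close> only the cell around \<open>r\<close> contributes. As the mesh gets
  finer, both endpoints of this cell tend to \<open>r\<close>, which is the only situation in which
  \<open>h\<close> has to vanish. Dominated convergence is applied in \<open>r\<close> for almost
  every \<omega>, and then in \<omega>.\<close>

lemma mesh_dominated_convergence:
  fixes h :: "real \<Rightarrow> real \<Rightarrow> 'a \<Rightarrow> real \<Rightarrow> ennreal" and D :: "'a \<Rightarrow> real \<Rightarrow> ennreal"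
  assumes T: "0 < T"
    and hm: "\<And>a b. 0 \<le> a \<Longrightarrow> a \<le> b \<Longrightarrow> b \<le> T \<Longrightarrow> (\<lambda>(\<omega>, r). h a b \<omega> r) \<in> borel_measurable (M \<Otimes>\<^sub>M lborel)"
    and Dm: "(\<lambda>(\<omega>, r). D \<omega> r) \<in> borel_measurable (M \<Otimes>\<^sub>M lborel)"
    and Dfin: "(\<integral>\<^sup>+\<omega>. (\<integral>\<^sup>+r\<in>{0<..T}. D \<omega> r \<partial>lborel) \<partial>M) < \<infinity>"
    and hD: "\<And>a b \<omega> r. \<omega> \<in> space M \<Longrightarrow> 0 \<le> a \<Longrightarrow> a < r \<Longrightarrow> r \<le> b \<Longrightarrow> b \<le> T \<Longrightarrow> h a b \<omega> r \<le> D \<omega> r"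
    and van: "AE \<omega> in M. \<forall>r\<in>{0<..T}. \<forall>a b. (\<forall>m. 0 \<le> a m \<and> a m < r \<and> r \<le> b m \<and> b m \<le> T) \<longrightarrow>
        a \<longlonglongrightarrow> r \<longrightarrow> b \<longlonglongrightarrow> r \<longrightarrow> (\<lambda>m. h (a m) (b m) \<omega> r) \<longlonglongrightarrow> 0"
  shows "(\<lambda>m. \<Sum>k<Suc m. \<integral>\<^sup>+\<omega>. (\<integral>\<^sup>+r\<in>{mesh T m k<..mesh T m (Suc k)}.
      h (mesh T m k) (mesh T m (Suc k)) \<omega> r \<partial>lborel) \<partial>M) \<longlonglongrightarrow> 0"
proof -
  have T0: "0 \<le> T" using T by simp
  \<comment> \<open>The integrands of all cells are glued into one function, which at
    \<open>r\<close> is \<open>h\<close> with the endpoints of the cell around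
    \<open>r\<close>.\<close>
  define G where "G m \<omega> r = (\<Sum>k<Suc m. h (mesh T m k) (mesh T m (Suc k)) \<omega> r * indicator {mesh T m k<..mesh T m (Suc k)} r)" for m \<omega> r
  have [measurable]: "(\<lambda>(\<omega>, r). h (mesh T m k) (mesh T m (Suc k)) \<omega> r) \<in> borel_measurable (M \<Otimes>\<^sub>M lborel)" if "k \<in> {..<Suc m}" for k m
    using that mesh_bounds[OF T0, of k m] by (intro hm) auto
  note Dm[measurable]
  have Gm[measurable]: "(\<lambda>(\<omega>, r). G m \<omega> r) \<in> borel_measurable (M \<Otimes>\<^sub>M lborel)" for m
    unfolding G_def split_beta' by measurable
  have G: "G m \<omega> r = h (mesh T m (mesh_cell T m r)) (mesh T m (Suc (mesh_cell T m r))) \<omega> r * indicator {0<..T} r" for m \<omega> r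
    unfolding G_def by (rule sum_mesh_indicator[OF T])
  have GD: "G m \<omega> r \<le> D \<omega> r * indicator {0<..T} r" if "\<omega> \<in> space M" for m \<omega> r
    unfolding G using mesh_cell[of r T m] mesh_bounds[OF T0, of "mesh_cell T m r" m] that
    by (auto intro!: hD split: split_indicator)
  have sum: "(\<Sum>k<Suc m. \<integral>\<^sup>+\<omega>. (\<integral>\<^sup>+r\<in>{mesh T m k<..mesh T m (Suc k)}.
      h (mesh T m k) (mesh T m (Suc k)) \<omega> r \<partial>lborel) \<partial>M) = (\<integral>\<^sup>+\<omega>. (\<integral>\<^sup>+r. G m \<omega> r \<partial>lborel) \<partial>M)" for m
  proof -
    have "(\<integral>\<^sup>+\<omega>. (\<integral>\<^sup>+r. G m \<omega> r \<partial>lborel) \<partial>M) = (\<integral>\<^sup>+\<omega>. (\<Sum>k<Suc m. \<integral>\<^sup>+r\<in>{mesh T m k<..mesh T m (Suc k)}.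
      h (mesh T m k) (mesh T m (Suc k)) \<omega> r \<partial>lborel) \<partial>M)"
      unfolding G_def by (intro nn_integral_cong nn_integral_sum) measurable
    also have "\<dots> = (\<Sum>k<Suc m. \<integral>\<^sup>+\<omega>. (\<integral>\<^sup>+r\<in>{mesh T m k<..mesh T m (Suc k)}.
      h (mesh T m k) (mesh T m (Suc k)) \<omega> r \<partial>lborel) \<partial>M)"
      by (intro nn_integral_sum) measurable
    finally show ?thesis by simp
  qed
  have fin: "AE \<omega> in M. (\<integral>\<^sup>+r\<in>{0<..T}. D \<omega> r \<partial>lborel) \<noteq> \<infinity>"
    using Dfin by (intro nn_integral_PInf_AE) auto
  have "(\<lambda>m. \<integral>\<^sup>+\<omega>. (\<integral>\<^sup>+r. G m \<omega> r \<partial>lborel) \<partial>M) \<longlonglongrightarrow> (\<integral>\<^sup>+\<omega>. 0 \<partial>M)"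
  proof (rule nn_integral_dominated_convergence[where w = "\<lambda>\<omega>. \<integral>\<^sup>+r\<in>{0<..T}. D \<omega> r \<partial>lborel"])
    show "AE \<omega> in M. (\<integral>\<^sup>+r. G m \<omega> r \<partial>lborel) \<le> (\<integral>\<^sup>+r\<in>{0<..T}. D \<omega> r \<partial>lborel)" for m
      by (intro AE_I2 nn_integral_mono GD)
    show "AE \<omega> in M. (\<lambda>m. \<integral>\<^sup>+r. G m \<omega> r \<partial>lborel) \<longlonglongrightarrow> 0"
      using fin van AE_space
    proof eventually_elim
      case (elim \<omega>)
      have w: "\<omega> \<in> space M" by fact
      have "(\<lambda>m. \<integral>\<^sup>+r. G m \<omega> r \<partial>lborel) \<longlonglongrightarrow> (\<integral>\<^sup>+r. 0 \<partial>(lborel::real measure))"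
      proof (rule nn_integral_dominated_convergence[where w = "\<lambda>r. D \<omega> r * indicator {0<..T} r"])
        show "G m \<omega> \<in> borel_measurable lborel" for m
          using measurable_compose[OF measurable_Pair1'[OF w] Gm[of m]] by simp
        show "(\<lambda>r. D \<omega> r * indicator {0<..T} r) \<in> borel_measurable lborel"
          using measurable_compose[OF measurable_Pair1'[OF w] Dm] by simp
        show "AE r in lborel. G m \<omega> r \<le> D \<omega> r * indicator {0<..T} r" for m using GD[OF w] by simp
        show "(\<integral>\<^sup>+r\<in>{0<..T}. D \<omega> r \<partial>lborel) < \<infinity>" using elim by (simp add: less_top)
        show "AE r in lborel. (\<lambda>m. G m \<omega> r) \<longlonglongrightarrow> 0"
        proof (rule AE_I2)
          fix r :: real
          show "(\<lambda>m. G m \<omega> r) \<longlonglongrightarrow> 0"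
          proof (cases "r \<in> {0<..T}")
            case True
            have "(\<lambda>m. h (mesh T m (mesh_cell T m r)) (mesh T m (Suc (mesh_cell T m r))) \<omega> r) \<longlonglongrightarrow> 0"
              using True mesh_cell[of r T] mesh_bounds[OF T0, of "mesh_cell T _ r"]
              by (intro elim(2)[rule_format] conjI mesh_cell_limit) auto
            then show ?thesis using True by (simp add: G)
          qed (simp add: G)
        qed
      qed auto
      then show ?case by simp
    qed
  qed (use Dfin in auto)
  then show ?thesis unfolding sum by simp
qed

section \<open>Mesh sums that vanish in mean\<close>

text \<open>Integrability is not presupposed: if it fails, the integral on the left is 0 by
  convention.\<close>

lemma ennreal_abs_set_integral_le:
  "ennreal \<bar>LINT r:S|N. f r\<bar> \<le> (\<integral>\<^sup>+r\<in>S. ennreal \<bar>f r\<bar> \<partial>N)" for f :: "'b \<Rightarrow> real"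
proof (cases "integrable N (\<lambda>r. indicator S r *\<^sub>R f r)")
  case True
  have "ennreal \<bar>LINT r:S|N. f r\<bar> \<le> (\<integral>\<^sup>+r. ennreal (norm (indicator S r *\<^sub>R f r)) \<partial>N)"
    unfolding set_lebesgue_integral_def using integral_norm_bound_ennreal[OF True] by simp
  also have "\<dots> = (\<integral>\<^sup>+r\<in>S. ennreal \<bar>f r\<bar> \<partial>N)"
    by (intro nn_integral_cong) (auto split: split_indicator)
  finally show ?thesis .
next
  case False
  then show ?thesis by (simp add: set_lebesgue_integral_def not_integrable_integral_eq)
qed

text \<open>Expanding the square of \<open>e * \<bar>x\<bar> - \<bar>y\<bar>\<close> gives this.
  Letting the weight \<open>e\<close> be small replaces the Cauchy-Schwarz inequality in estimates
  of sums over a mesh.\<close>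

lemma ennreal_amgm:
  assumes "0 < e"
  shows "ennreal \<bar>x * y\<bar> \<le> ennreal e * ennreal (x\<^sup>2) + ennreal (1 / e) * ennreal (y\<^sup>2)"
proof -
  have "0 \<le> (e * \<bar>x\<bar> - \<bar>y\<bar>)\<^sup>2" by simp
  then have "2 * (e * \<bar>x\<bar> * \<bar>y\<bar>) \<le> (e * \<bar>x\<bar>)\<^sup>2 + y\<^sup>2" by (simp add: power2_diff)
  moreover have "0 \<le> e * \<bar>x\<bar> * \<bar>y\<bar>" using assms by simp
  ultimately have "e * \<bar>x * y\<bar> \<le> e * (e * x\<^sup>2) + y\<^sup>2"
    by (simp add: abs_mult power_mult_distrib power2_eq_square mult_ac)
  then have "\<bar>x * y\<bar> \<le> e * x\<^sup>2 + (1 / e) * y\<^sup>2" using assms by (simp add: field_simps)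
  then have "ennreal \<bar>x * y\<bar> \<le> ennreal (e * x\<^sup>2 + (1 / e) * y\<^sup>2)" by (rule ennreal_leI)
  also have "\<dots> = ennreal e * ennreal (x\<^sup>2) + ennreal (1 / e) * ennreal (y\<^sup>2)"
    using assms by (simp only: ennreal_plus ennreal_mult mult_nonneg_nonneg zero_le_power2 less_imp_le
        zero_le_divide_1_iff)
  finally show ?thesis .
qed

text \<open>Arrays indexed by a mesh and its cells whose sums over the mesh vanish in mean, absolutely
  (\<open>small\<close>) or after cancellation (\<open>negligible_sums\<close>).\<close>

definition small :: "'a measure \<Rightarrow> (nat \<Rightarrow> nat \<Rightarrow> 'a \<Rightarrow> real) \<Rightarrow> bool" where
  "small M Z \<longleftrightarrow> (\<forall>m. \<forall>k<Suc m. Z m k \<in> borel_measurable M) \<and>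
     (\<lambda>m. \<Sum>k<Suc m. \<integral>\<^sup>+\<omega>. ennreal \<bar>Z m k \<omega>\<bar> \<partial>M) \<longlonglongrightarrow> 0"

definition negligible_sums :: "'a measure \<Rightarrow> (nat \<Rightarrow> nat \<Rightarrow> 'a \<Rightarrow> real) \<Rightarrow> bool" where
  "negligible_sums M Z \<longleftrightarrow> (\<forall>\<^sub>F m in sequentially. \<forall>k<Suc m. integrable M (Z m k)) \<and>
     (\<lambda>m. \<Sum>k<Suc m. \<integral>\<omega>. Z m k \<omega> \<partial>M) \<longlonglongrightarrow> 0"

lemma smallD: "small M Z \<Longrightarrow> k < Suc m \<Longrightarrow> Z m k \<in> borel_measurable M"
  by (auto simp: small_def)

lemma small_le:
  assumes "\<And>m k. k < Suc m \<Longrightarrow> Z m k \<in> borel_measurable M"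
    and "\<And>m k. k < Suc m \<Longrightarrow> (\<integral>\<^sup>+\<omega>. ennreal \<bar>Z m k \<omega>\<bar> \<partial>M) \<le> C * e m k"
    and "(\<lambda>m. \<Sum>k<Suc m. e m k) \<longlonglongrightarrow> 0" and "C < \<infinity>"
  shows "small M Z"
  unfolding small_def
proof (intro conjI allI impI)
  show "(\<lambda>m. \<Sum>k<Suc m. \<integral>\<^sup>+\<omega>. ennreal \<bar>Z m k \<omega>\<bar> \<partial>M) \<longlonglongrightarrow> 0"
  proof (rule tendsto_sandwich[OF _ _ tendsto_const])
    show "(\<lambda>m. C * (\<Sum>k<Suc m. e m k)) \<longlonglongrightarrow> 0"
      using ennreal_tendsto_cmult[OF _ assms(3), of C] assms(4) by simp
    show "\<forall>\<^sub>F m in sequentially. (\<Sum>k<Suc m. \<integral>\<^sup>+\<omega>. ennreal \<bar>Z m k \<omega>\<bar> \<partial>M) \<le> C * (\<Sum>k<Suc m. e m k)"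
      unfolding sum_distrib_left by (intro always_eventually allI sum_mono assms(2)) auto
  qed simp
qed (rule assms(1))

lemma small_dominated:
  assumes Y: "small M Y" and Z: "\<And>m k. k < Suc m \<Longrightarrow> Z m k \<in> borel_measurable M"
    and le: "\<And>m k \<omega>. k < Suc m \<Longrightarrow> \<omega> \<in> space M \<Longrightarrow> \<bar>Z m k \<omega>\<bar> \<le> C * \<bar>Y m k \<omega>\<bar>"
  shows "small M Z"
proof (rule small_le[OF Z])
  fix m k assume k: "k < Suc m"
  have "(\<integral>\<^sup>+\<omega>. ennreal \<bar>Z m k \<omega>\<bar> \<partial>M) \<le> (\<integral>\<^sup>+\<omega>. ennreal \<bar>C\<bar> * ennreal \<bar>Y m k \<omega>\<bar> \<partial>M)"
  proof (intro nn_integral_mono)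
    fix \<omega> assume "\<omega> \<in> space M"
    have "\<bar>Z m k \<omega>\<bar> \<le> C * \<bar>Y m k \<omega>\<bar>" using le[OF k \<open>\<omega> \<in> space M\<close>] .
    also have "\<dots> \<le> \<bar>C\<bar> * \<bar>Y m k \<omega>\<bar>" by (intro mult_right_mono) auto
    finally show "ennreal \<bar>Z m k \<omega>\<bar> \<le> ennreal \<bar>C\<bar> * ennreal \<bar>Y m k \<omega>\<bar>"
      by (simp add: ennreal_leI flip: ennreal_mult)
  qed
  also have "\<dots> = ennreal \<bar>C\<bar> * (\<integral>\<^sup>+\<omega>. ennreal \<bar>Y m k \<omega>\<bar> \<partial>M)"
    using smallD[OF Y k] by (intro nn_integral_cmult) auto
  finally show "(\<integral>\<^sup>+\<omega>. ennreal \<bar>Z m k \<omega>\<bar> \<partial>M) \<le> ennreal \<bar>C\<bar> * (\<integral>\<^sup>+\<omega>. ennreal \<bar>Y m k \<omega>\<bar> \<partial>M)" .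
qed (use Y in \<open>auto simp: small_def\<close>)

lemma small_add:
  assumes "small M Y" "small M Z"
  shows "small M (\<lambda>m k \<omega>. Y m k \<omega> + Z m k \<omega>)"
proof (rule small_le)
  fix m k assume k: "k < Suc m"
  note [measurable] = smallD[OF assms(1) k] smallD[OF assms(2) k]
  show "(\<lambda>\<omega>. Y m k \<omega> + Z m k \<omega>) \<in> borel_measurable M" by measurable
  have "(\<integral>\<^sup>+\<omega>. ennreal \<bar>Y m k \<omega> + Z m k \<omega>\<bar> \<partial>M) \<le> (\<integral>\<^sup>+\<omega>. ennreal \<bar>Y m k \<omega>\<bar> + ennreal \<bar>Z m k \<omega>\<bar> \<partial>M)"
    by (intro nn_integral_mono) (auto simp: ennreal_plus[symmetric] simp del: ennreal_plus intro!: ennreal_leI)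
  also have "\<dots> = 1 * ((\<integral>\<^sup>+\<omega>. ennreal \<bar>Y m k \<omega>\<bar> \<partial>M) + (\<integral>\<^sup>+\<omega>. ennreal \<bar>Z m k \<omega>\<bar> \<partial>M))"
    by (simp add: nn_integral_add)
  finally show "(\<integral>\<^sup>+\<omega>. ennreal \<bar>Y m k \<omega> + Z m k \<omega>\<bar> \<partial>M) \<le> \<dots>" .
next
  show "(\<lambda>m. \<Sum>k<Suc m. (\<integral>\<^sup>+\<omega>. ennreal \<bar>Y m k \<omega>\<bar> \<partial>M) + (\<integral>\<^sup>+\<omega>. ennreal \<bar>Z m k \<omega>\<bar> \<partial>M)) \<longlonglongrightarrow> 0"
    unfolding sum.distrib using assms by (auto simp: small_def intro: tendsto_eq_intros)
qed simp

lemma small_cmult: "small M Y \<Longrightarrow> small M (\<lambda>m k \<omega>. c * Y m k \<omega>)"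
  by (rule small_dominated[where Y = Y and C = "\<bar>c\<bar>"]) (auto simp: abs_mult dest: smallD)

text \<open>In effect the Cauchy-Schwarz inequality over cells and sample points together: one
  factor has bounded square sums, those of the other tend to zero. The weight in
  \<open>ennreal_amgm\<close> is fixed before the mesh is refined.\<close>

lemma small_mult_bounded:
  assumes Z: "small M (\<lambda>m k \<omega>. (Z m k \<omega>)\<^sup>2)"
    and Zm: "\<And>m k. k < Suc m \<Longrightarrow> Z m k \<in> borel_measurable M"
    and Ym: "\<And>m k. k < Suc m \<Longrightarrow> Y m k \<in> borel_measurable M"
    and K: "\<forall>\<^sub>F m in sequentially. (\<Sum>k<Suc m. sqn M (Y m k)) \<le> ennreal K" "K \<ge> 0"
  shows "small M (\<lambda>m k \<omega>. Y m k \<omega> * Z m k \<omega>)"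
  unfolding small_def
proof (intro conjI allI impI)
  fix m k assume "k < Suc m"
  then show "(\<lambda>\<omega>. Y m k \<omega> * Z m k \<omega>) \<in> borel_measurable M" using Ym Zm by auto
next
  let ?S = "\<lambda>m. \<Sum>k<Suc m. \<integral>\<^sup>+\<omega>. ennreal \<bar>Y m k \<omega> * Z m k \<omega>\<bar> \<partial>M"
  let ?T = "\<lambda>m. \<Sum>k<Suc m. \<integral>\<^sup>+\<omega>. ennreal \<bar>(Z m k \<omega>)\<^sup>2\<bar> \<partial>M"
  have le: "?S m \<le> ennreal e * (\<Sum>k<Suc m. sqn M (Y m k)) + ennreal (1 / e) * ?T m" if e: "e > 0" for e m
  proof -
    have "(\<integral>\<^sup>+\<omega>. ennreal \<bar>Y m k \<omega> * Z m k \<omega>\<bar> \<partial>M) \<le>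
        ennreal e * sqn M (Y m k) + ennreal (1 / e) * (\<integral>\<^sup>+\<omega>. ennreal \<bar>(Z m k \<omega>)\<^sup>2\<bar> \<partial>M)" if k: "k < Suc m" for k
    proof -
      note [measurable] = Zm[OF k] Ym[OF k]
      have "(\<integral>\<^sup>+\<omega>. ennreal \<bar>Y m k \<omega> * Z m k \<omega>\<bar> \<partial>M) \<le>
         (\<integral>\<^sup>+\<omega>. ennreal e * ennreal ((Y m k \<omega>)\<^sup>2) + ennreal (1 / e) * ennreal ((Z m k \<omega>)\<^sup>2) \<partial>M)"
        by (intro nn_integral_mono ennreal_amgm e)
      then show ?thesis by (simp add: nn_integral_add nn_integral_cmult sqn_def)
    qed
    then show ?thesis unfolding sum_distrib_left sum.distrib[symmetric] by (intro sum_mono) auto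
  qed
  show "?S \<longlonglongrightarrow> 0"
  proof (rule order_tendstoI)
    fix a :: ennreal assume a: "0 < a"
    obtain d where d: "0 < d" "ennreal d < a"
      using ennreal_rat_dense[OF a] a
      by (metis dense ennreal_cases ennreal_less_zero_iff not_less_iff_gr_or_eq order.strict_trans top.not_eq_extremum)
    \<comment> \<open>This makes \<open>e * K\<close> at most half of \<open>d\<close>; the summand
      1 covers the case that \<open>K\<close> is 0. The other half is left for the vanishing
      sums.\<close>
    define e where "e = d / (2 * (K + 1))"
    have e: "e > 0" "e * K \<le> d / 2" using d(1) K(2) by (auto simp: e_def field_simps)
    have "(\<lambda>m. ennreal (1 / e) * ?T m) \<longlonglongrightarrow> 0"
      using ennreal_tendsto_cmult[of "ennreal (1 / e)" ?T 0] Z by (auto simp: small_def)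
    then have "\<forall>\<^sub>F m in sequentially. ennreal (1 / e) * ?T m < ennreal (d / 2)"
      using d(1) by (intro order_tendstoD(2)) auto
    with K(1) show "\<forall>\<^sub>F m in sequentially. ?S m < a"
    proof eventually_elim
      case (elim m)
      have "?S m \<le> ennreal e * ennreal K + ennreal (d / 2)"
        using elim by (intro order_trans[OF le[OF e(1)]] add_mono mult_left_mono) auto
      also have "\<dots> = ennreal (e * K + d / 2)" using e d K by (simp add: ennreal_mult)
      also have "\<dots> \<le> ennreal d" using e by (intro ennreal_leI) auto
      also have "\<dots> < a" by fact
      finally show ?case .
    qed
  qed auto
qed

text \<open>The absolute sums are known to be finite only from some \<open>m\<close> on. This is the
  reason for the eventual quantifier in the integrability clause of
  \<open>negligible_sums\<close>.\<close>

lemma small_negligible: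
  assumes "small M Z" shows "negligible_sums M Z"
proof -
  let ?S = "\<lambda>m. \<Sum>k<Suc m. \<integral>\<^sup>+\<omega>. ennreal \<bar>Z m k \<omega>\<bar> \<partial>M"
  have S: "?S \<longlonglongrightarrow> 0" using assms by (simp add: small_def)
  then have "\<forall>\<^sub>F m in sequentially. ?S m < \<infinity>" by (rule order_tendstoD(2)) simp
  then have ev: "\<forall>\<^sub>F m in sequentially. \<forall>k<Suc m. integrable M (Z m k)"
  proof eventually_elim
    case (elim m)
    show ?case
    proof (intro allI impI)
      fix k assume k: "k < Suc m"
      then have "(\<integral>\<^sup>+\<omega>. ennreal \<bar>Z m k \<omega>\<bar> \<partial>M) \<le> ?S m" by (intro member_le_sum) auto
      with elim have "(\<integral>\<^sup>+\<omega>. ennreal \<bar>Z m k \<omega>\<bar> \<partial>M) < \<infinity>" by (rule order.strict_trans1[rotated])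
      then show "integrable M (Z m k)" using smallD[OF assms k] by (simp add: integrable_iff_bounded)
    qed
  qed
  moreover have "(\<lambda>m. \<Sum>k<Suc m. \<integral>\<omega>. Z m k \<omega> \<partial>M) \<longlonglongrightarrow> 0"
  proof (rule tendsto_rabs_zero_cancel)
    have b: "ennreal \<bar>\<Sum>k<Suc m. \<integral>\<omega>. Z m k \<omega> \<partial>M\<bar> \<le> ?S m" for m
    proof -
      have "ennreal \<bar>\<Sum>k<Suc m. \<integral>\<omega>. Z m k \<omega> \<partial>M\<bar> \<le> ennreal (\<Sum>k<Suc m. \<bar>\<integral>\<omega>. Z m k \<omega> \<partial>M\<bar>)"
        by (intro ennreal_leI sum_abs)
      also have "\<dots> = (\<Sum>k<Suc m. ennreal \<bar>\<integral>\<omega>. Z m k \<omega> \<partial>M\<bar>)" by (simp add: sum_ennreal)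
      also have "\<dots> \<le> ?S m"
        using ennreal_abs_set_integral_le[where S = UNIV and N = M]
        by (intro sum_mono) (simp add: set_lebesgue_integral_def)
      finally show ?thesis .
    qed
    have "(\<lambda>m. ennreal \<bar>\<Sum>k<Suc m. \<integral>\<omega>. Z m k \<omega> \<partial>M\<bar>) \<longlonglongrightarrow> ennreal 0"
      using tendsto_sandwich[OF _ _ tendsto_const S] b by (auto simp: ennreal_0)
    then show "(\<lambda>m. \<bar>\<Sum>k<Suc m. \<integral>\<omega>. Z m k \<omega> \<partial>M\<bar>) \<longlonglongrightarrow> 0"
      by (subst (asm) tendsto_ennreal_iff) auto
  qed
  ultimately show ?thesis by (simp add: negligible_sums_def)
qed

lemma negligible_sums_add:
  assumes "negligible_sums M Y" "negligible_sums M Z"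
  shows "negligible_sums M (\<lambda>m k \<omega>. Y m k \<omega> + Z m k \<omega>)"
proof -
  have ev: "\<forall>\<^sub>F m in sequentially. \<forall>k<Suc m. integrable M (Y m k) \<and> integrable M (Z m k)"
    using assms by (auto simp: negligible_sums_def elim: eventually_elim2)
  then have eq: "\<forall>\<^sub>F m in sequentially. (\<Sum>k<Suc m. \<integral>\<omega>. Y m k \<omega> \<partial>M) + (\<Sum>k<Suc m. \<integral>\<omega>. Z m k \<omega> \<partial>M) =
     (\<Sum>k<Suc m. \<integral>\<omega>. Y m k \<omega> + Z m k \<omega> \<partial>M)"
    by eventually_elim (auto simp: sum.distrib[symmetric] intro!: sum.cong)
  have "(\<lambda>m. (\<Sum>k<Suc m. \<integral>\<omega>. Y m k \<omega> \<partial>M) + (\<Sum>k<Suc m. \<integral>\<omega>. Z m k \<omega> \<partial>M)) \<longlonglongrightarrow> 0"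
    using assms by (auto simp: negligible_sums_def intro: tendsto_eq_intros)
  then have "(\<lambda>m. \<Sum>k<Suc m. \<integral>\<omega>. Y m k \<omega> + Z m k \<omega> \<partial>M) \<longlonglongrightarrow> 0"
    using tendsto_cong[OF eq] by simp
  then show ?thesis using ev by (auto simp: negligible_sums_def elim: eventually_mono)
qed

lemma negligible_sums_zero_mean:
  assumes "\<And>m k. k < Suc m \<Longrightarrow> has_bochner_integral M (Z m k) 0"
  shows "negligible_sums M Z"
  using assms by (auto simp: negligible_sums_def has_bochner_integral_iff)

lemma negligible_sums_sum:
  assumes "\<And>i. i \<in> I \<Longrightarrow> negligible_sums M (Z i)"
  shows "negligible_sums M (\<lambda>m k \<omega>. \<Sum>i\<in>I. Z i m k \<omega>)"
  using assms
proof (induction I rule: infinite_finite_induct)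
  case (insert i I)
  then show ?case using negligible_sums_add[of M "Z i" "\<lambda>m k \<omega>. \<Sum>i\<in>I. Z i m k \<omega>"] by auto
qed (auto intro: negligible_sums_zero_mean)

section \<open>Diffusions with bounded state space\<close>

text \<open>The stochastic differential equation is stated with closed time intervals, while mesh
  cells and additivity use intervals that are open on the left.\<close>

lemma set_integral_Icc_Ioc:
  fixes f :: "real \<Rightarrow> real"
  assumes [measurable]: "f \<in> borel_measurable lborel"
  shows "(LINT r:{a..b}|lborel. f r) = (LINT r:{a<..b}|lborel. f r)"
proof -
  have "AE r in lborel. indicat_real {a..b} r *\<^sub>R f r = indicat_real {a<..b} r *\<^sub>R f r"
    using AE_lborel_singleton[of a] by eventually_elim (auto split: split_indicator)
  then show ?thesis
    unfolding set_lebesgue_integral_def by (intro Bochner_Integration.integral_cong_AE) auto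
qed

text \<open>The drift \<open>b\<close> may be singular: it is Borel measurable, and the time
  integral of its absolute value has a finite second moment. The diffusion coefficient is
  continuous, and state space and coefficient are bounded along the process. The equation holds at
  each fixed time, with an integral and a null set depending on that time.\<close>

locale bounded_diffusion = filtered_brownian_motion M F B
  for M :: "'a measure" and F :: "real \<Rightarrow> 'a measure" and B :: "real \<Rightarrow> 'a \<Rightarrow> real ^ 'n" +
  fixes X :: "real \<Rightarrow> 'a \<Rightarrow> real ^ 'n" and sg b :: "'n \<Rightarrow> real ^ 'n \<Rightarrow> real" and R c :: real
  assumes X_adapted: "0 \<le> t \<Longrightarrow> X t \<in> borel_measurable (F t)"
    and X_joint: "(\<lambda>(\<omega>, r). X r \<omega>) \<in> borel_measurable (M \<Otimes>\<^sub>M lborel)"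
    and X_continuous: "\<omega> \<in> space M \<Longrightarrow> continuous_on UNIV (\<lambda>t. X t \<omega>)"
    and X_bounded: "\<omega> \<in> space M \<Longrightarrow> \<bar>X t \<omega> $ i\<bar> \<le> R"
    and sg_continuous: "continuous_on UNIV (sg i)"
    and sg_bounded: "\<omega> \<in> space M \<Longrightarrow> \<bar>sg i (X t \<omega>)\<bar> \<le> c"
    and b_measurable [measurable]: "b i \<in> borel_measurable borel"
    and drift_square_integrable:
      "(\<integral>\<^sup>+\<omega>. (\<integral>\<^sup>+r\<in>{0<..T}. ennreal (\<Sum>i\<in>UNIV. \<bar>b i (X r \<omega>)\<bar>) \<partial>lborel)\<^sup>2 \<partial>M) < \<infinity>"
    and sde: "0 \<le> t \<Longrightarrow> \<exists>I. has_ito_integral M F (\<lambda>s \<omega>. B s \<omega> $ i) (\<lambda>s \<omega>. sg i (X s \<omega>)) t I \<and>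
      (AE \<omega> in M. X t \<omega> $ i = X 0 \<omega> $ i + I \<omega> + (LINT s:{0..t}|lborel. b i (X s \<omega>)))"
begin

lemma R_nonneg: "0 \<le> R" and c_nonneg: "0 \<le> c"
proof -
  obtain \<omega> where "\<omega> \<in> space M" using not_empty by auto
  then show "0 \<le> R" "0 \<le> c" using X_bounded[of \<omega>] sg_bounded[of \<omega>] by (meson abs_ge_zero order_trans)+
qed

lemma sg_borel [measurable]: "sg i \<in> borel_measurable borel"
  by (intro borel_measurable_continuous_onI sg_continuous)

definition drift_total :: "'a \<Rightarrow> real \<Rightarrow> real" where
  "drift_total \<omega> r = (\<Sum>i\<in>UNIV. \<bar>b i (X r \<omega>)\<bar>)"

text \<open>Taken in \<open>ennreal\<close>, as finiteness holds only almost surely.\<close>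

definition variation :: "real \<Rightarrow> real \<Rightarrow> 'a \<Rightarrow> ennreal" where
  "variation s t \<omega> = (\<integral>\<^sup>+r\<in>{s<..t}. ennreal (drift_total \<omega> r) \<partial>lborel)"

definition drift_integral :: "'n \<Rightarrow> real \<Rightarrow> real \<Rightarrow> 'a \<Rightarrow> real" where
  "drift_integral i s t \<omega> = (LINT r:{s<..t}|lborel. b i (X r \<omega>))"

declare X_joint [measurable]

lemma drift_total_nonneg: "0 \<le> drift_total \<omega> r" and b_le_drift_total: "\<bar>b i (X r \<omega>)\<bar> \<le> drift_total \<omega> r"
  by (auto simp: drift_total_def intro!: sum_nonneg member_le_sum)

lemma drift_total_measurable [measurable]:
  "(\<lambda>(\<omega>, r). drift_total \<omega> r) \<in> borel_measurable (M \<Otimes>\<^sub>M lborel)"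
  unfolding drift_total_def split_beta' by measurable

lemma variation_measurable [measurable]: "variation s t \<in> borel_measurable M"
  unfolding variation_def[abs_def] by measurable

lemma X_measurable: "0 \<le> t \<Longrightarrow> X t \<in> borel_measurable M"
  using X_adapted measurable_F_M by blast

lemma path_measurable: "\<omega> \<in> space M \<Longrightarrow> (\<lambda>r. X r \<omega>) \<in> borel_measurable lborel"
  using measurable_compose[OF measurable_Pair1' X_joint] by simp

lemma variation_square: "(\<integral>\<^sup>+\<omega>. (variation 0 T \<omega>)\<^sup>2 \<partial>M) < \<infinity>"
  using drift_square_integrable[of T] by (simp add: variation_def drift_total_def)

lemma variation_integrable: "(\<integral>\<^sup>+\<omega>. variation 0 T \<omega> \<partial>M) < \<infinity>"
proof -
  have le: "x \<le> 1 + x\<^sup>2" for x :: ennreal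
  proof (cases "x \<le> 1")
    case True then show ?thesis by (simp add: add_increasing2)
  next
    case False
    then have "x * 1 \<le> x * x" by (intro mult_left_mono) auto
    then show ?thesis by (simp add: power2_eq_square add_increasing)
  qed
  have "(\<integral>\<^sup>+\<omega>. variation 0 T \<omega> \<partial>M) \<le> (\<integral>\<^sup>+\<omega>. 1 + (variation 0 T \<omega>)\<^sup>2 \<partial>M)"
    by (intro nn_integral_mono le)
  also have "\<dots> = 1 + (\<integral>\<^sup>+\<omega>. (variation 0 T \<omega>)\<^sup>2 \<partial>M)" by (simp add: nn_integral_add emeasure_space_1)
  also have "\<dots> < \<infinity>" using variation_square[of T] by simp
  finally show ?thesis .
qed

lemma variation_finite: "AE \<omega> in M. variation 0 T \<omega> < \<infinity>"
  using nn_integral_PInf_AE[of "variation 0 T" M] variation_integrable[of T] by (auto simp: less_top)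

lemma variation_mono: "s' \<le> s \<Longrightarrow> t \<le> t' \<Longrightarrow> variation s t \<omega> \<le> variation s' t' \<omega>"
  unfolding variation_def by (intro nn_integral_mono) (auto split: split_indicator)

lemma drift_weighted_integrable:
  assumes w: "\<omega> \<in> space M" and fin: "variation 0 T \<omega> < \<infinity>" and st: "0 \<le> s" "t \<le> T"
    and g: "g \<in> borel_measurable lborel" "\<And>r. \<bar>g r\<bar> \<le> C"
  shows "set_integrable lborel {s<..t} (\<lambda>r. g r * b i (X r \<omega>))"
proof -
  note [measurable] = path_measurable[OF w] g(1)
  have "(\<integral>\<^sup>+r. ennreal (norm (indicator {s<..t} r *\<^sub>R (g r * b i (X r \<omega>)))) \<partial>lborel)
     \<le> (\<integral>\<^sup>+r. ennreal \<bar>C\<bar> * (ennreal (drift_total \<omega> r) * indicator {0<..T} r) \<partial>lborel)"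
  proof (intro nn_integral_mono)
    fix r :: real
    have "\<bar>g r\<bar> * \<bar>b i (X r \<omega>)\<bar> \<le> \<bar>C\<bar> * drift_total \<omega> r"
      using g(2)[of r] b_le_drift_total[of i r \<omega>] by (intro mult_mono) auto
    then show "ennreal (norm (indicator {s<..t} r *\<^sub>R (g r * b i (X r \<omega>)))) \<le>
        ennreal \<bar>C\<bar> * (ennreal (drift_total \<omega> r) * indicator {0<..T} r)"
      using st drift_total_nonneg
      by (auto split: split_indicator simp: abs_mult ennreal_mult[symmetric] intro!: ennreal_leI)
  qed
  also have "\<dots> = ennreal \<bar>C\<bar> * variation 0 T \<omega>"
    unfolding variation_def using measurable_compose[OF measurable_Pair1'[OF w] drift_total_measurable]
    by (intro nn_integral_cmult) simp
  also have "\<dots> < \<infinity>" using fin by (simp add: ennreal_mult_less_top)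
  finally show ?thesis by (simp add: set_integrable_def integrable_iff_bounded)
qed

lemma drift_integrable:
  "\<omega> \<in> space M \<Longrightarrow> variation 0 T \<omega> < \<infinity> \<Longrightarrow> 0 \<le> s \<Longrightarrow> t \<le> T \<Longrightarrow>
    set_integrable lborel {s<..t} (\<lambda>r. b i (X r \<omega>))"
  using drift_weighted_integrable[of \<omega> T s t "\<lambda>_. 1" 1 i] by simp

lemma drift_integral_measurable [measurable]: "drift_integral i s t \<in> borel_measurable M"
  unfolding drift_integral_def[abs_def] set_lebesgue_integral_def by measurable

lemma drift_integral_le_variation: "ennreal \<bar>drift_integral i s t \<omega>\<bar> \<le> variation s t \<omega>"
proof -
  have "ennreal \<bar>drift_integral i s t \<omega>\<bar> \<le> (\<integral>\<^sup>+r\<in>{s<..t}. ennreal \<bar>b i (X r \<omega>)\<bar> \<partial>lborel)"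
    unfolding drift_integral_def by (rule ennreal_abs_set_integral_le)
  also have "\<dots> \<le> variation s t \<omega>"
    unfolding variation_def by (intro nn_integral_mono mult_right_mono ennreal_leI b_le_drift_total) auto
  finally show ?thesis .
qed

lemma sg_joint: "(\<lambda>(\<omega>, r). sg i (X r \<omega>)) \<in> borel_measurable (M \<Otimes>\<^sub>M lborel)"
  unfolding split_beta' by measurable

lemma bounded_at_state:
  assumes "0 \<le> t" "f \<in> borel_measurable borel" "\<And>\<omega>. \<omega> \<in> space M \<Longrightarrow> \<bar>f (X t \<omega>)\<bar> \<le> C"
  shows "bounded_at t (\<lambda>\<omega>. f (X t \<omega>))"
  unfolding bounded_at_def using assms measurable_compose[OF X_adapted[OF assms(1)] assms(2)] by auto

text \<open>The equation is used at \<open>t\<close> and at \<open>s\<close> with separately chosen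
  integrals \<open>I\<close> and \<open>J\<close>, which is why increments of Ito integrals were
  treated as differences of two such integrals. Splitting the drift at \<open>s\<close> requires
  finite variation of the path, hence the exceptional null set.\<close>

lemma martingale_increment:
  assumes st: "0 \<le> s" "s \<le> t"
  obtains I J where
    "has_ito_integral M F (\<lambda>s \<omega>. B s \<omega> $ i) (\<lambda>s \<omega>. sg i (X s \<omega>)) t I"
    "has_ito_integral M F (\<lambda>s \<omega>. B s \<omega> $ i) (\<lambda>s \<omega>. sg i (X s \<omega>)) s J"
    "AE \<omega> in M. X t \<omega> $ i - X s \<omega> $ i - drift_integral i s t \<omega> = I \<omega> - J \<omega>"
proof -
  obtain I where I: "has_ito_integral M F (\<lambda>s \<omega>. B s \<omega> $ i) (\<lambda>s \<omega>. sg i (X s \<omega>)) t I"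
    "AE \<omega> in M. X t \<omega> $ i = X 0 \<omega> $ i + I \<omega> + (LINT s:{0..t}|lborel. b i (X s \<omega>))"
    using sde[of t i] st by auto
  obtain J where J: "has_ito_integral M F (\<lambda>s \<omega>. B s \<omega> $ i) (\<lambda>s \<omega>. sg i (X s \<omega>)) s J"
    "AE \<omega> in M. X s \<omega> $ i = X 0 \<omega> $ i + J \<omega> + (LINT s:{0..s}|lborel. b i (X s \<omega>))"
    using sde[of s i] st by auto
  have "AE \<omega> in M. X t \<omega> $ i - X s \<omega> $ i - drift_integral i s t \<omega> = I \<omega> - J \<omega>"
    using I(2) J(2) variation_finite[of t] AE_space
  proof eventually_elim
    case (elim \<omega>)
    have "{0<..t} = {0<..s} \<union> {s<..t}" using st by auto
    then have "(LINT r:{0<..t}|lborel. b i (X r \<omega>)) = drift_integral i 0 s \<omega> + drift_integral i s t \<omega>"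
      unfolding drift_integral_def using elim st
      by (simp add: set_integral_Un drift_integrable[of \<omega> t])
    moreover have "(\<lambda>r. b i (X r \<omega>)) \<in> borel_measurable lborel"
      using path_measurable elim(4) by measurable
    ultimately show ?case using elim by (simp add: set_integral_Icc_Ioc drift_integral_def)
  qed
  with I(1) J(1) show ?thesis by (rule that)
qed

lemma martingale_mean:
  assumes st: "0 \<le> s" "s \<le> t" and g: "bounded_at s g"
  shows "has_bochner_integral M (\<lambda>\<omega>. g \<omega> * (X t \<omega> $ i - X s \<omega> $ i - drift_integral i s t \<omega>)) 0"
proof -
  obtain I J where IJ: "has_ito_integral M F (\<lambda>s \<omega>. B s \<omega> $ i) (\<lambda>s \<omega>. sg i (X s \<omega>)) t I"
    "has_ito_integral M F (\<lambda>s \<omega>. B s \<omega> $ i) (\<lambda>s \<omega>. sg i (X s \<omega>)) s J"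
    "AE \<omega> in M. X t \<omega> $ i - X s \<omega> $ i - drift_integral i s t \<omega> = I \<omega> - J \<omega>"
    by (rule martingale_increment[OF st, of i])
  note m = ito_increment_mean[OF IJ(1,2) st sg_joint g]
  have "has_bochner_integral M (\<lambda>\<omega>. g \<omega> * (I \<omega> - J \<omega>)) 0"
    using bounded_at_integrable_mult[OF g m(1)] m(2) by (simp add: has_bochner_integral_iff)
  moreover have "(\<lambda>\<omega>. g \<omega> * (X t \<omega> $ i - X s \<omega> $ i - drift_integral i s t \<omega>)) \<in> borel_measurable M"
    using bounded_at_measurable[OF g] X_measurable[of s] X_measurable[of t] st by simp
  ultimately show ?thesis
    using IJ(3) by (subst has_bochner_integral_cong_AE) (auto simp: has_bochner_integral_iff)
qed

text \<open>The integrand is frozen at its value at time \<open>s\<close>, which is bounded and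
  known at \<open>s\<close>, so that \<open>ito_increment_square\<close> applies.\<close>

lemma martingale_euler_error:
  assumes st: "0 \<le> s" "s \<le> t"
  shows "sqn M (\<lambda>\<omega>. X t \<omega> $ i - X s \<omega> $ i - drift_integral i s t \<omega> - sg i (X s \<omega>) * (B t \<omega> $ i - B s \<omega> $ i))
    \<le> 4 * (\<integral>\<^sup>+\<omega>. (\<integral>\<^sup>+r\<in>{s<..t}. ennreal ((sg i (X r \<omega>) - sg i (X s \<omega>))\<^sup>2) \<partial>lborel) \<partial>M)"
proof -
  obtain I J where IJ: "has_ito_integral M F (\<lambda>s \<omega>. B s \<omega> $ i) (\<lambda>s \<omega>. sg i (X s \<omega>)) t I"
    "has_ito_integral M F (\<lambda>s \<omega>. B s \<omega> $ i) (\<lambda>s \<omega>. sg i (X s \<omega>)) s J"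
    "AE \<omega> in M. X t \<omega> $ i - X s \<omega> $ i - drift_integral i s t \<omega> = I \<omega> - J \<omega>"
    by (rule martingale_increment[OF st, of i])
  have "bounded_at s (\<lambda>\<omega>. sg i (X s \<omega>))" using st sg_bounded by (intro bounded_at_state) auto
  note m = ito_increment_square[OF IJ(1,2) st sg_joint this]
  have [measurable]: "X s \<in> borel_measurable M" using st X_measurable by auto
  have "(\<lambda>(\<omega>, r). (sg i (X r \<omega>) - sg i (X s \<omega>)) * indicator {s<..t} r) \<in> borel_measurable (M \<Otimes>\<^sub>M lborel)"
    unfolding split_beta' by measurable
  from sqn_iterated[OF this]
  have "sqn (M \<Otimes>\<^sub>M lborel) (\<lambda>(\<omega>, r). (sg i (X r \<omega>) - sg i (X s \<omega>)) * indicator {s<..t} r) =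
    (\<integral>\<^sup>+\<omega>. (\<integral>\<^sup>+r. ennreal (((sg i (X r \<omega>) - sg i (X s \<omega>)) * indicator {s<..t} r)\<^sup>2) \<partial>lborel) \<partial>M)" by simp
  also have "\<dots> = (\<integral>\<^sup>+\<omega>. (\<integral>\<^sup>+r\<in>{s<..t}. ennreal ((sg i (X r \<omega>) - sg i (X s \<omega>))\<^sup>2) \<partial>lborel) \<partial>M)"
    by (intro nn_integral_cong) (auto split: split_indicator)
  finally have 1: "sqn (M \<Otimes>\<^sub>M lborel) (\<lambda>(\<omega>, r). (sg i (X r \<omega>) - sg i (X s \<omega>)) * indicator {s<..t} r) = \<dots>" .
  have "sqn M (\<lambda>\<omega>. X t \<omega> $ i - X s \<omega> $ i - drift_integral i s t \<omega> - sg i (X s \<omega>) * (B t \<omega> $ i - B s \<omega> $ i))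
    = sqn M (\<lambda>\<omega>. I \<omega> - J \<omega> - sg i (X s \<omega>) * (B t \<omega> $ i - B s \<omega> $ i))"
    unfolding sqn_def using IJ(3) by (intro nn_integral_cong_AE) (auto elim: eventually_mono)
  then show ?thesis using m 1 by simp
qed

end

section \<open>Increments of a diffusion over a uniform mesh\<close>

context bounded_diffusion
begin

definition incr_X :: "real \<Rightarrow> 'n \<Rightarrow> nat \<Rightarrow> nat \<Rightarrow> 'a \<Rightarrow> real" where
  "incr_X T i m k \<omega> = X (mesh T m (Suc k)) \<omega> $ i - X (mesh T m k) \<omega> $ i"

definition incr_B :: "real \<Rightarrow> 'n \<Rightarrow> nat \<Rightarrow> nat \<Rightarrow> 'a \<Rightarrow> real" where
  "incr_B T i m k \<omega> = B (mesh T m (Suc k)) \<omega> $ i - B (mesh T m k) \<omega> $ i"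

definition incr_A :: "real \<Rightarrow> 'n \<Rightarrow> nat \<Rightarrow> nat \<Rightarrow> 'a \<Rightarrow> real" where
  "incr_A T i m k \<omega> = drift_integral i (mesh T m k) (mesh T m (Suc k)) \<omega>"

definition euler :: "real \<Rightarrow> 'n \<Rightarrow> nat \<Rightarrow> nat \<Rightarrow> 'a \<Rightarrow> real" where
  "euler T i m k \<omega> = sg i (X (mesh T m k) \<omega>) * incr_B T i m k \<omega>"

text \<open>This encodes the decomposition of \<open>incr_X\<close> into \<open>incr_A\<close>,
  \<open>euler\<close> and \<open>euler_error\<close>, on which all estimates over the mesh rest.
  The drift is kept out of \<open>euler\<close>, so that the latter is a centered product.\<close>

definition euler_error :: "real \<Rightarrow> 'n \<Rightarrow> nat \<Rightarrow> nat \<Rightarrow> 'a \<Rightarrow> real" where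
  "euler_error T i m k \<omega> = incr_X T i m k \<omega> - incr_A T i m k \<omega> - euler T i m k \<omega>"

lemma incr_X_bounded: "\<omega> \<in> space M \<Longrightarrow> \<bar>incr_X T i m k \<omega>\<bar> \<le> 2 * R"
  unfolding incr_X_def
  using X_bounded[of \<omega> "mesh T m k" i] X_bounded[of \<omega> "mesh T m (Suc k)" i] by linarith

lemma path_tendsto:
  "\<omega> \<in> space M \<Longrightarrow> a \<longlonglongrightarrow> r \<Longrightarrow> (\<lambda>m. X (a m) \<omega>) \<longlonglongrightarrow> X r \<omega>"
  by (rule continuous_on_tendsto_compose[OF X_continuous]) auto

context
  fixes T :: real
  assumes T: "0 < T"
begin

lemma mesh_nonneg: "k < Suc m \<Longrightarrow> 0 \<le> mesh T m k" "k < Suc m \<Longrightarrow> 0 \<le> mesh T m (Suc k)"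
  and mesh_le_Suc: "k < Suc m \<Longrightarrow> mesh T m k \<le> mesh T m (Suc k)"
  and mesh_le: "k < Suc m \<Longrightarrow> mesh T m (Suc k) \<le> T"
  using mesh_bounds[of T k m] T by auto

lemma mesh_state_measurable:
  assumes "k < Suc m"
  shows "X (mesh T m k) \<in> borel_measurable M" "X (mesh T m (Suc k)) \<in> borel_measurable M"
  by (intro X_measurable mesh_nonneg assms)+

lemma incr_measurable [measurable]:
  assumes "k < Suc m"
  shows "incr_X T i m k \<in> borel_measurable M" "incr_B T i m k \<in> borel_measurable M"
    "incr_A T i m k \<in> borel_measurable M" "euler T i m k \<in> borel_measurable M"
    "euler_error T i m k \<in> borel_measurable M"
proof -
  note [measurable] = mesh_state_measurable[OF assms]
    B_nth_measurable[OF mesh_nonneg(1)[OF assms]] B_nth_measurable[OF mesh_nonneg(2)[OF assms]]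
  show [measurable]: "incr_X T i m k \<in> borel_measurable M"
    unfolding incr_X_def[abs_def] by measurable
  show [measurable]: "incr_B T i m k \<in> borel_measurable M"
    unfolding incr_B_def[abs_def] by measurable
  show [measurable]: "incr_A T i m k \<in> borel_measurable M"
    unfolding incr_A_def[abs_def] by measurable
  show [measurable]: "euler T i m k \<in> borel_measurable M"
    unfolding euler_def[abs_def] by measurable
  show "euler_error T i m k \<in> borel_measurable M"
    unfolding euler_error_def[abs_def] by measurable
qed

text \<open>The squared oscillation of the diffusion coefficient within a cell tends to 0 by
  continuity of the paths, and it is dominated by \<open>(2 * c)\<^sup>2\<close>.\<close>

lemma small_euler_error: "small M (\<lambda>m k \<omega>. (euler_error T i m k \<omega>)\<^sup>2)"
proof (rule small_le[where C = 4])
  fix m k assume k: "k < Suc m"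
  show "(\<lambda>\<omega>. (euler_error T i m k \<omega>)\<^sup>2) \<in> borel_measurable M" using k by measurable
  have "(\<integral>\<^sup>+\<omega>. ennreal \<bar>(euler_error T i m k \<omega>)\<^sup>2\<bar> \<partial>M) = sqn M (euler_error T i m k)"
    by (simp add: sqn_def)
  also have "\<dots> \<le> 4 * (\<integral>\<^sup>+\<omega>. (\<integral>\<^sup>+r\<in>{mesh T m k<..mesh T m (Suc k)}.
      ennreal ((sg i (X r \<omega>) - sg i (X (mesh T m k) \<omega>))\<^sup>2) \<partial>lborel) \<partial>M)"
    using martingale_euler_error[OF mesh_nonneg(1)[OF k] mesh_le_Suc[OF k], of i]
    by (simp add: euler_error_def[abs_def] incr_X_def incr_A_def euler_def incr_B_def)
  finally show "(\<integral>\<^sup>+\<omega>. ennreal \<bar>(euler_error T i m k \<omega>)\<^sup>2\<bar> \<partial>M) \<le> \<dots>" .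
next
  show "(\<lambda>m. \<Sum>k<Suc m. \<integral>\<^sup>+\<omega>. (\<integral>\<^sup>+r\<in>{mesh T m k<..mesh T m (Suc k)}.
      ennreal ((sg i (X r \<omega>) - sg i (X (mesh T m k) \<omega>))\<^sup>2) \<partial>lborel) \<partial>M) \<longlonglongrightarrow> 0"
  proof (rule mesh_dominated_convergence[OF T, where D = "\<lambda>_ _. ennreal ((2 * c)\<^sup>2)"
        and h = "\<lambda>a b \<omega> r. ennreal ((sg i (X r \<omega>) - sg i (X a \<omega>))\<^sup>2)"])
    fix a b :: real assume "0 \<le> a"
    then have [measurable]: "X a \<in> borel_measurable M" by (rule X_measurable)
    show "(\<lambda>(\<omega>, r). ennreal ((sg i (X r \<omega>) - sg i (X a \<omega>))\<^sup>2)) \<in> borel_measurable (M \<Otimes>\<^sub>M lborel)"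
      unfolding split_beta' by measurable
  next
    show "(\<integral>\<^sup>+\<omega>. (\<integral>\<^sup>+r\<in>{0<..T}. ennreal ((2 * c)\<^sup>2) \<partial>(lborel :: real measure)) \<partial>M) < \<infinity>"
      using T by (simp add: nn_integral_cmult_indicator emeasure_space_1 flip: ennreal_mult)
  next
    fix a b r :: real and \<omega> assume "\<omega> \<in> space M"
    then have "\<bar>sg i (X r \<omega>) - sg i (X a \<omega>)\<bar> \<le> \<bar>2 * c\<bar>"
      using sg_bounded[of \<omega> i r] sg_bounded[of \<omega> i a] by linarith
    then show "ennreal ((sg i (X r \<omega>) - sg i (X a \<omega>))\<^sup>2) \<le> ennreal ((2 * c)\<^sup>2)"
      by (intro ennreal_leI) (simp only: abs_le_square_iff)
  next
    show "AE \<omega> in M. \<forall>r\<in>{0<..T}. \<forall>a b. (\<forall>m. 0 \<le> a m \<and> a m < r \<and> r \<le> b m \<and> b m \<le> T) \<longrightarrow>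
        a \<longlonglongrightarrow> r \<longrightarrow> b \<longlonglongrightarrow> r \<longrightarrow> (\<lambda>m. ennreal ((sg i (X r \<omega>) - sg i (X (a m) \<omega>))\<^sup>2)) \<longlonglongrightarrow> 0"
    proof (rule AE_I2, intro ballI allI impI)
      fix \<omega> r and a b :: "nat \<Rightarrow> real" assume "\<omega> \<in> space M" "a \<longlonglongrightarrow> r"
      then have "(\<lambda>m. sg i (X (a m) \<omega>)) \<longlonglongrightarrow> sg i (X r \<omega>)"
        by (intro continuous_on_tendsto_compose[OF sg_continuous path_tendsto]) auto
      then have "(\<lambda>m. (sg i (X r \<omega>) - sg i (X (a m) \<omega>))\<^sup>2) \<longlonglongrightarrow> (sg i (X r \<omega>) - sg i (X r \<omega>))\<^sup>2"
        by (intro tendsto_intros)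
      then show "(\<lambda>m. ennreal ((sg i (X r \<omega>) - sg i (X (a m) \<omega>))\<^sup>2)) \<longlonglongrightarrow> 0"
        using tendsto_ennrealI by fastforce
    qed
  qed auto
qed auto

text \<open>The square of the variation over a cell is the integral over this cell of the drift
  density weighted with that same variation. Replacing the weight by the variation over ]0,T] gives
  a dominating function with total mass \<open>(variation 0 T \<omega>)\<^sup>2\<close>; here the
  second moment is indispensable. The weight tends to 0, as a single point has no mass.\<close>

lemma small_incr_A: "small M (\<lambda>m k \<omega>. (incr_A T i m k \<omega>)\<^sup>2)"
proof (rule small_le[where C = 1])
  fix m k assume k: "k < Suc m"
  show "(\<lambda>\<omega>. (incr_A T i m k \<omega>)\<^sup>2) \<in> borel_measurable M" using k by measurable
  let ?s = "mesh T m k" and ?t = "mesh T m (Suc k)"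
  have "(\<integral>\<^sup>+\<omega>. ennreal \<bar>(incr_A T i m k \<omega>)\<^sup>2\<bar> \<partial>M) \<le> (\<integral>\<^sup>+\<omega>. variation ?s ?t \<omega> * variation ?s ?t \<omega> \<partial>M)"
  proof (intro nn_integral_mono)
    fix \<omega>
    have "ennreal \<bar>(incr_A T i m k \<omega>)\<^sup>2\<bar> = ennreal \<bar>incr_A T i m k \<omega>\<bar> * ennreal \<bar>incr_A T i m k \<omega>\<bar>"
      by (simp add: power2_eq_square abs_mult flip: ennreal_mult)
    also have "\<dots> \<le> variation ?s ?t \<omega> * variation ?s ?t \<omega>"
      unfolding incr_A_def by (intro mult_mono drift_integral_le_variation) auto
    finally show "ennreal \<bar>(incr_A T i m k \<omega>)\<^sup>2\<bar> \<le> variation ?s ?t \<omega> * variation ?s ?t \<omega>" .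
  qed
  also have "\<dots> = (\<integral>\<^sup>+\<omega>. (\<integral>\<^sup>+r\<in>{?s<..?t}. variation ?s ?t \<omega> * ennreal (drift_total \<omega> r) \<partial>lborel) \<partial>M)"
  proof (rule nn_integral_cong)
    fix \<omega> assume w: "\<omega> \<in> space M"
    show "variation ?s ?t \<omega> * variation ?s ?t \<omega> = (\<integral>\<^sup>+r\<in>{?s<..?t}. variation ?s ?t \<omega> * ennreal (drift_total \<omega> r) \<partial>lborel)"
      using measurable_compose[OF measurable_Pair1'[OF w] drift_total_measurable]
      by (subst (2) variation_def) (simp add: nn_integral_cmult mult.assoc)
  qed
  finally show "(\<integral>\<^sup>+\<omega>. ennreal \<bar>(incr_A T i m k \<omega>)\<^sup>2\<bar> \<partial>M) \<le>
     1 * (\<integral>\<^sup>+\<omega>. (\<integral>\<^sup>+r\<in>{?s<..?t}. variation ?s ?t \<omega> * ennreal (drift_total \<omega> r) \<partial>lborel) \<partial>M)" by simp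
next
  show "(\<lambda>m. \<Sum>k<Suc m. \<integral>\<^sup>+\<omega>. (\<integral>\<^sup>+r\<in>{mesh T m k<..mesh T m (Suc k)}.
      variation (mesh T m k) (mesh T m (Suc k)) \<omega> * ennreal (drift_total \<omega> r) \<partial>lborel) \<partial>M) \<longlonglongrightarrow> 0"
  proof (rule mesh_dominated_convergence[OF T, where D = "\<lambda>\<omega> r. variation 0 T \<omega> * ennreal (drift_total \<omega> r)"
        and h = "\<lambda>a b \<omega> r. variation a b \<omega> * ennreal (drift_total \<omega> r)"])
    show "(\<lambda>(\<omega>, r). variation a b \<omega> * ennreal (drift_total \<omega> r)) \<in> borel_measurable (M \<Otimes>\<^sub>M lborel)" for a b
      unfolding split_beta' by measurable
    then show "(\<lambda>(\<omega>, r). variation 0 T \<omega> * ennreal (drift_total \<omega> r)) \<in> borel_measurable (M \<Otimes>\<^sub>M lborel)" .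
    have "(\<integral>\<^sup>+r\<in>{0<..T}. variation 0 T \<omega> * ennreal (drift_total \<omega> r) \<partial>lborel) = (variation 0 T \<omega>)\<^sup>2"
      if w: "\<omega> \<in> space M" for \<omega>
      using measurable_compose[OF measurable_Pair1'[OF w] drift_total_measurable]
      unfolding power2_eq_square by (subst (3) variation_def) (simp add: nn_integral_cmult mult.assoc)
    then have "(\<integral>\<^sup>+\<omega>. (\<integral>\<^sup>+r\<in>{0<..T}. variation 0 T \<omega> * ennreal (drift_total \<omega> r) \<partial>lborel) \<partial>M) =
       (\<integral>\<^sup>+\<omega>. (variation 0 T \<omega>)\<^sup>2 \<partial>M)" by (intro nn_integral_cong)
    then show "(\<integral>\<^sup>+\<omega>. (\<integral>\<^sup>+r\<in>{0<..T}. variation 0 T \<omega> * ennreal (drift_total \<omega> r) \<partial>lborel) \<partial>M) < \<infinity>"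
      using variation_square[of T] by simp
    show "variation a b \<omega> * ennreal (drift_total \<omega> r) \<le> variation 0 T \<omega> * ennreal (drift_total \<omega> r)"
      if "0 \<le> a" "b \<le> T" for a b r \<omega>
      using that by (intro mult_right_mono variation_mono) auto
    show "AE \<omega> in M. \<forall>r\<in>{0<..T}. \<forall>a b. (\<forall>m. 0 \<le> a m \<and> a m < r \<and> r \<le> b m \<and> b m \<le> T) \<longrightarrow>
        a \<longlonglongrightarrow> r \<longrightarrow> b \<longlonglongrightarrow> r \<longrightarrow> (\<lambda>m. variation (a m) (b m) \<omega> * ennreal (drift_total \<omega> r)) \<longlonglongrightarrow> 0"
      using variation_finite[of T] AE_space
    proof eventually_elim
      case (elim \<omega>)
      have [measurable]: "drift_total \<omega> \<in> borel_measurable lborel"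
        using measurable_compose[OF measurable_Pair1'[OF elim(2)] drift_total_measurable] by simp
      show ?case
      proof (intro ballI allI impI)
        fix r and a b :: "nat \<Rightarrow> real"
        assume r: "r \<in> {0<..T}" and ab: "\<forall>m. 0 \<le> a m \<and> a m < r \<and> r \<le> b m \<and> b m \<le> T"
          and a: "a \<longlonglongrightarrow> r" and b: "b \<longlonglongrightarrow> r"
        have "(\<lambda>m. \<integral>\<^sup>+s\<in>{a m<..b m}. ennreal (drift_total \<omega> s) \<partial>lborel) \<longlonglongrightarrow> (\<integral>\<^sup>+s. 0 \<partial>(lborel::real measure))"
        proof (rule nn_integral_dominated_convergence[where w = "\<lambda>s. ennreal (drift_total \<omega> s) * indicator {0<..T} s"])
          show "AE s in lborel. ennreal (drift_total \<omega> s) * indicator {a m<..b m} s \<le>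
              ennreal (drift_total \<omega> s) * indicator {0<..T} s" for m
            using ab[rule_format, of m] by (intro AE_I2) (auto split: split_indicator)
          show "(\<integral>\<^sup>+s\<in>{0<..T}. ennreal (drift_total \<omega> s) \<partial>lborel) < \<infinity>"
            using elim(1) by (simp add: variation_def)
          show "AE s in lborel. (\<lambda>m. ennreal (drift_total \<omega> s) * indicator {a m<..b m} s) \<longlonglongrightarrow> 0"
            using AE_lborel_singleton[of r]
          proof eventually_elim
            case (elim s)
            \<comment> \<open>A time \<open>s\<close> different from \<open>r\<close> is eventually
              outside the intervals, which shrink to \<open>r\<close>.\<close>
            have "\<forall>\<^sub>F m in sequentially. s \<notin> {a m<..b m}"
            proof (cases "s < r")
              case True
              show ?thesis using order_tendstoD(1)[OF a True] by eventually_elim auto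
            next
              case False
              then have "r < s" using elim by simp
              show ?thesis using order_tendstoD(2)[OF b \<open>r < s\<close>] by eventually_elim auto
            qed
            then have "\<forall>\<^sub>F m in sequentially. ennreal (drift_total \<omega> s) * indicator {a m<..b m} s = 0"
              by eventually_elim simp
            then show ?case by (rule tendsto_eventually)
          qed
        qed measurable
        then have "(\<lambda>m. variation (a m) (b m) \<omega>) \<longlonglongrightarrow> 0" by (simp add: variation_def)
        from ennreal_tendsto_cmult[OF _ this, of "ennreal (drift_total \<omega> r)"]
        show "(\<lambda>m. variation (a m) (b m) \<omega> * ennreal (drift_total \<omega> r)) \<longlonglongrightarrow> 0"
          by (simp add: mult.commute)
      qed
    qed
  qed
qed auto

text \<open>A bounded quantity that vanishes as its cell shrinks to a point stays negligible when
  integrated against the singular drift, because the total variation has a finite mean. It is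
  applied to increments of the state and to changes of a function of the state within a
  cell.\<close>

lemma drift_weighted_mesh_limit:
  fixes \<phi> :: "real \<Rightarrow> real \<Rightarrow> 'a \<Rightarrow> real \<Rightarrow> real"
  assumes \<phi>m: "\<And>a b. 0 \<le> a \<Longrightarrow> a \<le> b \<Longrightarrow> (\<lambda>(\<omega>, r). \<phi> a b \<omega> r) \<in> borel_measurable (M \<Otimes>\<^sub>M lborel)"
    and \<phi>b: "\<And>a b \<omega> r. \<omega> \<in> space M \<Longrightarrow> \<bar>\<phi> a b \<omega> r\<bar> \<le> C"
    and van: "\<And>a b \<omega> r. \<omega> \<in> space M \<Longrightarrow> a \<longlonglongrightarrow> r \<Longrightarrow> b \<longlonglongrightarrow> r \<Longrightarrow> (\<lambda>m. \<phi> (a m) (b m) \<omega> r) \<longlonglongrightarrow> 0"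
  shows "(\<lambda>m. \<Sum>k<Suc m. \<integral>\<^sup>+\<omega>. (\<integral>\<^sup>+r\<in>{mesh T m k<..mesh T m (Suc k)}.
      ennreal (\<bar>\<phi> (mesh T m k) (mesh T m (Suc k)) \<omega> r\<bar> * drift_total \<omega> r) \<partial>lborel) \<partial>M) \<longlonglongrightarrow> 0"
proof (rule mesh_dominated_convergence[OF T, where D = "\<lambda>\<omega> r. ennreal \<bar>C\<bar> * ennreal (drift_total \<omega> r)"
      and h = "\<lambda>a b \<omega> r. ennreal (\<bar>\<phi> a b \<omega> r\<bar> * drift_total \<omega> r)"])
  fix a b :: real assume "0 \<le> a" "a \<le> b"
  note [measurable] = \<phi>m[OF this]
  show "(\<lambda>(\<omega>, r). ennreal (\<bar>\<phi> a b \<omega> r\<bar> * drift_total \<omega> r)) \<in> borel_measurable (M \<Otimes>\<^sub>M lborel)"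
    unfolding split_beta' by measurable
next
  show "(\<lambda>(\<omega>, r). ennreal \<bar>C\<bar> * ennreal (drift_total \<omega> r)) \<in> borel_measurable (M \<Otimes>\<^sub>M lborel)"
    unfolding split_beta' by measurable
  have "(\<integral>\<^sup>+r\<in>{0<..T}. ennreal \<bar>C\<bar> * ennreal (drift_total \<omega> r) \<partial>lborel) = ennreal \<bar>C\<bar> * variation 0 T \<omega>"
    if w: "\<omega> \<in> space M" for \<omega>
    using measurable_compose[OF measurable_Pair1'[OF w] drift_total_measurable]
    by (subst variation_def) (simp add: nn_integral_cmult mult.assoc)
  then have "(\<integral>\<^sup>+\<omega>. (\<integral>\<^sup>+r\<in>{0<..T}. ennreal \<bar>C\<bar> * ennreal (drift_total \<omega> r) \<partial>lborel) \<partial>M) =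
     (\<integral>\<^sup>+\<omega>. ennreal \<bar>C\<bar> * variation 0 T \<omega> \<partial>M)" by (intro nn_integral_cong)
  then show "(\<integral>\<^sup>+\<omega>. (\<integral>\<^sup>+r\<in>{0<..T}. ennreal \<bar>C\<bar> * ennreal (drift_total \<omega> r) \<partial>lborel) \<partial>M) < \<infinity>"
    using variation_integrable[of T] by (simp add: nn_integral_cmult ennreal_mult_less_top)
next
  fix a b r :: real and \<omega> assume "\<omega> \<in> space M"
  then have "\<bar>\<phi> a b \<omega> r\<bar> \<le> \<bar>C\<bar>" using \<phi>b[of \<omega> a b r] by linarith
  then show "ennreal (\<bar>\<phi> a b \<omega> r\<bar> * drift_total \<omega> r) \<le> ennreal \<bar>C\<bar> * ennreal (drift_total \<omega> r)"
    using drift_total_nonneg by (simp add: ennreal_mult[symmetric] ennreal_leI mult_right_mono)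
next
  show "AE \<omega> in M. \<forall>r\<in>{0<..T}. \<forall>a b. (\<forall>m. 0 \<le> a m \<and> a m < r \<and> r \<le> b m \<and> b m \<le> T) \<longrightarrow>
      a \<longlonglongrightarrow> r \<longrightarrow> b \<longlonglongrightarrow> r \<longrightarrow> (\<lambda>m. ennreal (\<bar>\<phi> (a m) (b m) \<omega> r\<bar> * drift_total \<omega> r)) \<longlonglongrightarrow> 0"
  proof (rule AE_I2, intro ballI allI impI)
    fix \<omega> r and a b :: "nat \<Rightarrow> real" assume "\<omega> \<in> space M" "a \<longlonglongrightarrow> r" "b \<longlonglongrightarrow> r"
    from tendsto_mult_right[OF tendsto_rabs[OF van[OF this]], of "drift_total \<omega> r"]
    show "(\<lambda>m. ennreal (\<bar>\<phi> (a m) (b m) \<omega> r\<bar> * drift_total \<omega> r)) \<longlonglongrightarrow> 0"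
      using tendsto_ennrealI by fastforce
  qed
qed

text \<open>The increment of the state is bounded and vanishes by continuity, while the drift
  increment is at most the variation over the cell.\<close>

lemma small_incr_X_incr_A: "small M (\<lambda>m k \<omega>. incr_X T i m k \<omega> * incr_A T j m k \<omega>)"
proof (rule small_le[where C = 1])
  fix m k assume k: "k < Suc m"
  show "(\<lambda>\<omega>. incr_X T i m k \<omega> * incr_A T j m k \<omega>) \<in> borel_measurable M" using k by measurable
  let ?s = "mesh T m k" and ?t = "mesh T m (Suc k)"
  have "(\<integral>\<^sup>+\<omega>. ennreal \<bar>incr_X T i m k \<omega> * incr_A T j m k \<omega>\<bar> \<partial>M) \<le>
     (\<integral>\<^sup>+\<omega>. (\<integral>\<^sup>+r\<in>{?s<..?t}. ennreal (\<bar>X ?t \<omega> $ i - X ?s \<omega> $ i\<bar> * drift_total \<omega> r) \<partial>lborel) \<partial>M)"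
  proof (intro nn_integral_mono)
    fix \<omega> assume w: "\<omega> \<in> space M"
    have "ennreal \<bar>incr_X T i m k \<omega> * incr_A T j m k \<omega>\<bar> \<le> ennreal \<bar>incr_X T i m k \<omega>\<bar> * variation ?s ?t \<omega>"
      unfolding incr_A_def abs_mult
      by (subst ennreal_mult) (auto intro!: mult_left_mono drift_integral_le_variation)
    also have "\<dots> = (\<integral>\<^sup>+r\<in>{?s<..?t}. ennreal (\<bar>X ?t \<omega> $ i - X ?s \<omega> $ i\<bar> * drift_total \<omega> r) \<partial>lborel)"
      using measurable_compose[OF measurable_Pair1'[OF w] drift_total_measurable] drift_total_nonneg
      unfolding variation_def incr_X_def
      by (simp add: nn_integral_cmult[symmetric] mult.assoc[symmetric] ennreal_mult)
    finally show "ennreal \<bar>incr_X T i m k \<omega> * incr_A T j m k \<omega>\<bar> \<le>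
      (\<integral>\<^sup>+r\<in>{?s<..?t}. ennreal (\<bar>X ?t \<omega> $ i - X ?s \<omega> $ i\<bar> * drift_total \<omega> r) \<partial>lborel)" .
  qed
  then show "(\<integral>\<^sup>+\<omega>. ennreal \<bar>incr_X T i m k \<omega> * incr_A T j m k \<omega>\<bar> \<partial>M) \<le>
     1 * (\<integral>\<^sup>+\<omega>. (\<integral>\<^sup>+r\<in>{?s<..?t}. ennreal (\<bar>X ?t \<omega> $ i - X ?s \<omega> $ i\<bar> * drift_total \<omega> r) \<partial>lborel) \<partial>M)" by simp
next
  show "(\<lambda>m. \<Sum>k<Suc m. \<integral>\<^sup>+\<omega>. (\<integral>\<^sup>+r\<in>{mesh T m k<..mesh T m (Suc k)}.
     ennreal (\<bar>X (mesh T m (Suc k)) \<omega> $ i - X (mesh T m k) \<omega> $ i\<bar> * drift_total \<omega> r) \<partial>lborel) \<partial>M) \<longlonglongrightarrow> 0"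
  proof (rule drift_weighted_mesh_limit[where \<phi> = "\<lambda>a b \<omega> r. X b \<omega> $ i - X a \<omega> $ i" and C = "2 * R"])
    fix a b :: real assume ab: "0 \<le> a" "a \<le> b"
    then have [measurable]: "X a \<in> borel_measurable M" "X b \<in> borel_measurable M"
      by (auto intro: X_measurable)
    show "(\<lambda>(\<omega>, r). X b \<omega> $ i - X a \<omega> $ i) \<in> borel_measurable (M \<Otimes>\<^sub>M lborel)"
      unfolding split_beta' by measurable
  next
    show "\<bar>X b \<omega> $ i - X a \<omega> $ i\<bar> \<le> 2 * R" if "\<omega> \<in> space M" for a b \<omega>
      using X_bounded[OF that, of a i] X_bounded[OF that, of b i] by linarith
    fix a b :: "nat \<Rightarrow> real" and \<omega> r assume "\<omega> \<in> space M" "a \<longlonglongrightarrow> r" "b \<longlonglongrightarrow> r"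
    then have "(\<lambda>m. X (b m) \<omega> $ i - X (a m) \<omega> $ i) \<longlonglongrightarrow> X r \<omega> $ i - X r \<omega> $ i"
      by (intro tendsto_intros path_tendsto)
    then show "(\<lambda>m. X (b m) \<omega> $ i - X (a m) \<omega> $ i) \<longlonglongrightarrow> 0" by simp
  qed
qed auto

lemma sqn_incr_B:
  assumes k: "k < Suc m"
  shows "sqn M (incr_B T i m k) = ennreal (T / real (Suc m))"
proof -
  have "integrable M (\<lambda>\<omega>. (incr_B T i m k \<omega>)\<^sup>2)" "expectation (\<lambda>\<omega>. (incr_B T i m k \<omega>)\<^sup>2) = T / real (Suc m)"
    using increment_moment(1)[OF mesh_nonneg(1)[OF k] mesh_le_Suc[OF k], of i 2]
      increment_moment(3)[OF mesh_nonneg(1)[OF k] mesh_le_Suc[OF k], of i]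
    unfolding mesh_step by (simp_all add: incr_B_def)
  then show ?thesis unfolding sqn_def by (subst nn_integral_eq_integral) auto
qed

text \<open>In the bound, \<open>2 * (c\<^sup>2 * T)\<close> comes from the Euler part, whose
  Brownian increments have variances adding up to \<open>T\<close>. The 8 stands for
  \<open>2 * (2 * 1 + 2 * 1)\<close>: the square sums of the Euler error and of the drift tend to
  zero and are eventually below 1.\<close>

lemma quadratic_variation_bounded:
  "\<forall>\<^sub>F m in sequentially. (\<Sum>k<Suc m. sqn M (incr_X T i m k)) \<le> ennreal (2 * (c\<^sup>2 * T) + 8)"
proof -
  let ?E = "\<lambda>m. \<Sum>k<Suc m. sqn M (euler_error T i m k)" and ?A = "\<lambda>m. \<Sum>k<Suc m. sqn M (incr_A T i m k)"
  have E: "?E \<longlonglongrightarrow> 0" using small_euler_error by (simp add: small_def sqn_def)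
  have A: "?A \<longlonglongrightarrow> 0" using small_incr_A by (simp add: small_def sqn_def)
  have eu: "sqn M (euler T i m k) \<le> ennreal (c\<^sup>2) * ennreal (T / real (Suc m))" if k: "k < Suc m" for m k
  proof -
    note [measurable] = incr_measurable(2)[OF k]
    have "sqn M (euler T i m k) \<le> (\<integral>\<^sup>+\<omega>. ennreal (c\<^sup>2) * ennreal ((incr_B T i m k \<omega>)\<^sup>2) \<partial>M)"
      unfolding sqn_def
    proof (intro nn_integral_mono)
      fix \<omega> assume "\<omega> \<in> space M"
      then have "(sg i (X (mesh T m k) \<omega>))\<^sup>2 \<le> c\<^sup>2"
        using sg_bounded[of \<omega> i "mesh T m k"] c_nonneg by (simp add: abs_le_square_iff[symmetric])
      then show "ennreal ((euler T i m k \<omega>)\<^sup>2) \<le> ennreal (c\<^sup>2) * ennreal ((incr_B T i m k \<omega>)\<^sup>2)"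
        by (simp add: euler_def power_mult_distrib ennreal_mult[symmetric] ennreal_leI mult_right_mono)
    qed
    also have "\<dots> = ennreal (c\<^sup>2) * sqn M (incr_B T i m k)"
      unfolding sqn_def by (intro nn_integral_cmult) measurable
    finally show ?thesis by (simp only: sqn_incr_B[OF k])
  qed
  have X: "sqn M (incr_X T i m k) \<le> 2 * (ennreal (c\<^sup>2) * ennreal (T / real (Suc m))) +
      2 * (2 * sqn M (euler_error T i m k) + 2 * sqn M (incr_A T i m k))" if k: "k < Suc m" for m k
  proof -
    note [measurable] = incr_measurable[OF k]
    have "sqn M (incr_X T i m k) = sqn M (\<lambda>\<omega>. euler T i m k \<omega> + (euler_error T i m k \<omega> + incr_A T i m k \<omega>))"
      by (rule arg_cong[where f = "sqn M"]) (auto simp: euler_error_def)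
    also have "\<dots> \<le> 2 * sqn M (euler T i m k) + 2 * sqn M (\<lambda>\<omega>. euler_error T i m k \<omega> + incr_A T i m k \<omega>)"
      by (intro sqn_add) measurable
    also have "\<dots> \<le> 2 * (ennreal (c\<^sup>2) * ennreal (T / real (Suc m))) +
      2 * (2 * sqn M (euler_error T i m k) + 2 * sqn M (incr_A T i m k))"
      by (intro add_mono mult_left_mono sqn_add eu k) simp_all
    finally show ?thesis .
  qed
  have "\<forall>\<^sub>F m in sequentially. ?E m < 1" "\<forall>\<^sub>F m in sequentially. ?A m < 1"
    using order_tendstoD(2)[OF E, of 1] order_tendstoD(2)[OF A, of 1] by auto
  then show ?thesis
  proof eventually_elim
    case (elim m)
    have "(\<Sum>k<Suc m. sqn M (incr_X T i m k)) \<le> (\<Sum>k<Suc m. 2 * (ennreal (c\<^sup>2) * ennreal (T / real (Suc m))) +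
      2 * (2 * sqn M (euler_error T i m k) + 2 * sqn M (incr_A T i m k)))"
      by (intro sum_mono X) auto
    also have "\<dots> = of_nat (Suc m) * (2 * (ennreal (c\<^sup>2) * ennreal (T / real (Suc m)))) + 2 * (2 * ?E m + 2 * ?A m)"
      by (simp only: sum.distrib sum_distrib_left[symmetric] sum_constant card_lessThan mult.left_commute)
    also have "\<dots> \<le> of_nat (Suc m) * (2 * (ennreal (c\<^sup>2) * ennreal (T / real (Suc m)))) + 2 * (2 * 1 + 2 * 1)"
      using elim by (intro add_left_mono mult_left_mono add_mono) auto
    also have "of_nat (Suc m) * (2 * (ennreal (c\<^sup>2) * ennreal (T / real (Suc m)))) = ennreal (2 * (c\<^sup>2 * T))"
    proof -
      have "of_nat (Suc m) * (2 * (ennreal (c\<^sup>2) * ennreal (T / real (Suc m))))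
        = ennreal (real (Suc m) * (2 * (c\<^sup>2 * (T / real (Suc m)))))"
        using T by (simp only: ennreal_of_nat_eq_real_of_nat ennreal_numeral[symmetric] ennreal_mult
            mult_nonneg_nonneg zero_le_power2 of_nat_0_le_iff divide_nonneg_nonneg less_imp_le zero_le_numeral)
      also have "real (Suc m) * (2 * (c\<^sup>2 * (T / real (Suc m)))) = 2 * (c\<^sup>2 * T)" by simp
      finally show ?thesis .
    qed
    also have "ennreal (2 * (c\<^sup>2 * T)) + 2 * (2 * 1 + 2 * 1) = ennreal (2 * (c\<^sup>2 * T) + 8)"
      using T by (simp add: ennreal_plus)
    finally show ?case .
  qed
qed

lemma small_incr_X_mult:
  assumes "small M (\<lambda>m k \<omega>. (Z m k \<omega>)\<^sup>2)" "\<And>m k. k < Suc m \<Longrightarrow> Z m k \<in> borel_measurable M"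
  shows "small M (\<lambda>m k \<omega>. incr_X T i m k \<omega> * Z m k \<omega>)"
proof (rule small_mult_bounded[OF assms(1) assms(2) _ quadratic_variation_bounded])
  show "0 \<le> 2 * (c\<^sup>2 * T) + 8" using T by (intro add_nonneg_nonneg mult_nonneg_nonneg) auto
qed (use incr_measurable in auto)

text \<open>A Gaussian increment over a cell of length h has fourth moment
  \<open>3 * h\<^sup>2\<close>, so the sum over the cells is of the order of the mesh width.\<close>

lemma small_incr_B_fourth: "small M (\<lambda>m k \<omega>. ((incr_B T i m k \<omega>)\<^sup>2)\<^sup>2)"
proof (rule small_le[where C = 1 and e = "\<lambda>m k. ennreal (3 * (T / real (Suc m))\<^sup>2)"])
  fix m k assume k: "k < Suc m"
  show "(\<lambda>\<omega>. ((incr_B T i m k \<omega>)\<^sup>2)\<^sup>2) \<in> borel_measurable M" using k by measurable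
  have "integrable M (\<lambda>\<omega>. incr_B T i m k \<omega> ^ 4)" "expectation (\<lambda>\<omega>. incr_B T i m k \<omega> ^ 4) = 3 * (T / real (Suc m))\<^sup>2"
    using increment_moment(1)[OF mesh_nonneg(1)[OF k] mesh_le_Suc[OF k], of i 4]
      increment_moment(4)[OF mesh_nonneg(1)[OF k] mesh_le_Suc[OF k], of i]
    unfolding mesh_step by (simp_all add: incr_B_def)
  then have "(\<integral>\<^sup>+\<omega>. ennreal (incr_B T i m k \<omega> ^ 4) \<partial>M) = ennreal (3 * (T / real (Suc m))\<^sup>2)"
    by (subst nn_integral_eq_integral) auto
  then show "(\<integral>\<^sup>+\<omega>. ennreal \<bar>((incr_B T i m k \<omega>)\<^sup>2)\<^sup>2\<bar> \<partial>M) \<le> 1 * ennreal (3 * (T / real (Suc m))\<^sup>2)"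
    by (simp flip: power_mult)
next
  have "(\<Sum>k<Suc m. ennreal (3 * (T / real (Suc m))\<^sup>2)) = ennreal (3 * T\<^sup>2 * (1 / real (Suc m)))" for m
  proof -
    have "(\<Sum>k<Suc m. ennreal (3 * (T / real (Suc m))\<^sup>2)) = ennreal (\<Sum>k<Suc m. 3 * (T / real (Suc m))\<^sup>2)"
      by (rule sum_ennreal) auto
    also have "(\<Sum>k<Suc m. 3 * (T / real (Suc m))\<^sup>2) = 3 * T\<^sup>2 * (1 / real (Suc m))"
      unfolding sum_constant card_lessThan by (simp add: power2_eq_square)
    finally show ?thesis .
  qed
  moreover have "(\<lambda>m. ennreal (3 * T\<^sup>2 * (1 / real (Suc m)))) \<longlonglongrightarrow> ennreal (3 * T\<^sup>2 * 0)"
    by (intro tendsto_ennrealI tendsto_mult tendsto_const LIMSEQ_Suc[OF lim_const_over_n])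
  ultimately show "(\<lambda>m. \<Sum>k<Suc m. ennreal (3 * (T / real (Suc m))\<^sup>2)) \<longlonglongrightarrow> 0" by simp
qed auto

text \<open>With \<open>r\<close> for the remainder of the state increment \<open>x\<close> beside
  its Euler part, the difference equals \<open>x i * r j + x j * r i - r i * r j\<close>. Every term
  contains a remainder, and the other factor is either a state increment, whose quadratic variation
  is bounded, or a second remainder.\<close>

lemma small_pair:
  "small M (\<lambda>m k \<omega>. incr_X T i m k \<omega> * incr_X T j m k \<omega> - euler T i m k \<omega> * euler T j m k \<omega>)"
proof -
  let ?r = "\<lambda>i m k \<omega>. euler_error T i m k \<omega> + incr_A T i m k \<omega>"
  have Xr: "small M (\<lambda>m k \<omega>. incr_X T i m k \<omega> * euler_error T j m k \<omega> + incr_X T i m k \<omega> * incr_A T j m k \<omega>)" for i j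
    by (intro small_add small_incr_X_mult small_euler_error small_incr_X_incr_A) (rule incr_measurable)
  have sq: "small M (\<lambda>m k \<omega>. (euler_error T i m k \<omega>)\<^sup>2 + (incr_A T i m k \<omega>)\<^sup>2)" for i
    by (intro small_add small_euler_error small_incr_A)
  have rr: "small M (\<lambda>m k \<omega>. ?r i m k \<omega> * ?r j m k \<omega>)"
  proof (rule small_dominated[OF small_add[OF sq[of i] sq[of j]], where C = 2])
    fix m k \<omega> assume k: "k < Suc m"
    show "(\<lambda>\<omega>. ?r i m k \<omega> * ?r j m k \<omega>) \<in> borel_measurable M"
      using incr_measurable[OF k, of i] incr_measurable[OF k, of j] by measurable
    let ?u = "euler_error T i m k \<omega>" and ?v = "incr_A T i m k \<omega>"
      and ?w = "euler_error T j m k \<omega>" and ?x = "incr_A T j m k \<omega>"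
    have a: "\<bar>x * y\<bar> \<le> (x\<^sup>2 + y\<^sup>2) / 2" for x y :: real
      using sum_squares_bound[of "\<bar>x\<bar>" "\<bar>y\<bar>"] by (simp add: abs_mult)
    have b: "(x + y)\<^sup>2 \<le> 2 * (x\<^sup>2 + y\<^sup>2)" for x y :: real
      using sum_squares_bound[of x y] by (simp add: power2_sum)
    have mean: "s \<le> 2 * x \<Longrightarrow> t \<le> 2 * y \<Longrightarrow> 0 \<le> x \<Longrightarrow> 0 \<le> y \<Longrightarrow> (s + t) / 2 \<le> 2 * (x + y)"
      for s t x y :: real by simp
    have "\<bar>(?u + ?v) * (?w + ?x)\<bar> \<le> ((?u + ?v)\<^sup>2 + (?w + ?x)\<^sup>2) / 2" by (rule a)
    also have "\<dots> \<le> 2 * (?u\<^sup>2 + ?v\<^sup>2 + (?w\<^sup>2 + ?x\<^sup>2))"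
      using b[of ?u ?v] b[of ?w ?x] by (intro mean) auto
    also have "\<dots> = 2 * \<bar>?u\<^sup>2 + ?v\<^sup>2 + (?w\<^sup>2 + ?x\<^sup>2)\<bar>" by simp
    finally show "\<bar>(?u + ?v) * (?w + ?x)\<bar> \<le> \<dots>" .
  qed
  have "small M (\<lambda>m k \<omega>. (incr_X T i m k \<omega> * euler_error T j m k \<omega> + incr_X T i m k \<omega> * incr_A T j m k \<omega>)
     + (incr_X T j m k \<omega> * euler_error T i m k \<omega> + incr_X T j m k \<omega> * incr_A T i m k \<omega>)
     + (- 1) * (?r i m k \<omega> * ?r j m k \<omega>))"
    by (intro small_add Xr small_cmult rr)
  then show ?thesis by (simp add: euler_error_def algebra_simps)
qed

text \<open>A third factor is absorbed into the quadratic variation by the inequality of the arithmetic and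
  geometric mean, since the sum of the fourth powers of the Brownian increments vanishes in mean.\<close>

lemma small_triple: "small M (\<lambda>m k \<omega>. incr_X T h m k \<omega> * incr_X T i m k \<omega> * incr_X T j m k \<omega>)"
proof -
  have 1: "small M (\<lambda>m k \<omega>. incr_X T h m k \<omega> * (incr_B T i m k \<omega>)\<^sup>2)" for h i
    by (intro small_incr_X_mult small_incr_B_fourth borel_measurable_power incr_measurable)
  have abs: "small M (\<lambda>m k \<omega>. \<bar>Z m k \<omega>\<bar>)" if "small M Z" for Z
    by (rule small_dominated[OF that, where C = 1]) (use that in \<open>auto dest: smallD\<close>)
  have 2: "small M (\<lambda>m k \<omega>. incr_X T h m k \<omega> * (incr_X T i m k \<omega>)\<^sup>2)" for h i
  proof -
    \<comment> \<open>The factor 3 comes from the square of a sum of three terms,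
      \<open>c\<^sup>2\<close> from the bound on the diffusion coefficient, and \<open>6 * R\<close>
      is 3 times the bound \<open>2 * R\<close> for a state increment.\<close>
    have S: "small M (\<lambda>m k \<omega>. 3 * c\<^sup>2 * \<bar>incr_X T h m k \<omega> * (incr_B T i m k \<omega>)\<^sup>2\<bar> +
       6 * R * \<bar>(euler_error T i m k \<omega>)\<^sup>2 + (incr_A T i m k \<omega>)\<^sup>2\<bar>)"
      by (intro small_add small_cmult abs 1 small_euler_error small_incr_A)
    show ?thesis
    proof (rule small_dominated[OF S, where C = 1])
      fix m k \<omega> assume k: "k < Suc m"
      show "(\<lambda>\<omega>. incr_X T h m k \<omega> * (incr_X T i m k \<omega>)\<^sup>2) \<in> borel_measurable M"
        using incr_measurable[OF k, of i] incr_measurable[OF k, of h] by measurable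
      assume w: "\<omega> \<in> space M"
      let ?e = "euler T i m k \<omega>" and ?u = "euler_error T i m k \<omega>" and ?v = "incr_A T i m k \<omega>"
        and ?x = "\<bar>incr_X T h m k \<omega>\<bar>" and ?b = "incr_B T i m k \<omega>"
      have b: "(x + y + z)\<^sup>2 \<le> 3 * (x\<^sup>2 + (y\<^sup>2 + z\<^sup>2))" for x y z :: real
        using sum_squares_bound[of x y] sum_squares_bound[of x z] sum_squares_bound[of y z]
        by (simp add: power2_eq_square algebra_simps)
      have "incr_X T i m k \<omega> = ?e + ?u + ?v" by (simp add: euler_error_def)
      then have "(incr_X T i m k \<omega>)\<^sup>2 \<le> 3 * (?e\<^sup>2 + (?u\<^sup>2 + ?v\<^sup>2))" using b by simp
      moreover have "?e\<^sup>2 \<le> c\<^sup>2 * ?b\<^sup>2"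
        using sg_bounded[OF w, of i "mesh T m k"] c_nonneg
        by (auto simp: euler_def power_mult_distrib abs_le_square_iff[symmetric] intro!: mult_right_mono)
      ultimately have "(incr_X T i m k \<omega>)\<^sup>2 \<le> 3 * (c\<^sup>2 * ?b\<^sup>2 + (?u\<^sup>2 + ?v\<^sup>2))"
        by (auto elim!: order_trans intro!: mult_left_mono add_right_mono)
      then have "?x * (incr_X T i m k \<omega>)\<^sup>2 \<le> ?x * (3 * (c\<^sup>2 * ?b\<^sup>2 + (?u\<^sup>2 + ?v\<^sup>2)))"
        by (intro mult_left_mono) auto
      also have "\<dots> = 3 * c\<^sup>2 * (?x * ?b\<^sup>2) + 3 * (?x * (?u\<^sup>2 + ?v\<^sup>2))" by (simp add: algebra_simps)
      also have "\<dots> \<le> 3 * c\<^sup>2 * (?x * ?b\<^sup>2) + 3 * (2 * R * (?u\<^sup>2 + ?v\<^sup>2))"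
        by (intro add_left_mono mult_left_mono mult_right_mono incr_X_bounded w) auto
      also have "\<dots> = 3 * c\<^sup>2 * \<bar>incr_X T h m k \<omega> * ?b\<^sup>2\<bar> + 6 * R * \<bar>?u\<^sup>2 + ?v\<^sup>2\<bar>"
        by (simp add: abs_mult)
      finally show "\<bar>incr_X T h m k \<omega> * (incr_X T i m k \<omega>)\<^sup>2\<bar> \<le>
        1 * \<bar>3 * c\<^sup>2 * \<bar>incr_X T h m k \<omega> * ?b\<^sup>2\<bar> + 6 * R * \<bar>?u\<^sup>2 + ?v\<^sup>2\<bar>\<bar>"
        by (simp add: abs_mult)
    qed
  qed
  have S: "small M (\<lambda>m k \<omega>. \<bar>incr_X T h m k \<omega> * (incr_X T i m k \<omega>)\<^sup>2\<bar> + \<bar>incr_X T h m k \<omega> * (incr_X T j m k \<omega>)\<^sup>2\<bar>)"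
    by (intro small_add abs 2)
  show ?thesis
  proof (rule small_dominated[OF S, where C = 1])
    fix m k \<omega> assume k: "k < Suc m"
    show "(\<lambda>\<omega>. incr_X T h m k \<omega> * incr_X T i m k \<omega> * incr_X T j m k \<omega>) \<in> borel_measurable M"
      using incr_measurable[OF k, of i] incr_measurable[OF k, of h] incr_measurable[OF k, of j] by measurable
    let ?x = "\<bar>incr_X T h m k \<omega>\<bar>" and ?y = "incr_X T i m k \<omega>" and ?z = "incr_X T j m k \<omega>"
    have "2 * \<bar>?y * ?z\<bar> \<le> ?y\<^sup>2 + ?z\<^sup>2"
      using sum_squares_bound[of "\<bar>?y\<bar>" "\<bar>?z\<bar>"] by (simp add: abs_mult)
    then have "\<bar>?y * ?z\<bar> \<le> ?y\<^sup>2 + ?z\<^sup>2" using abs_ge_zero[of "?y * ?z"] by linarith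
    then have "?x * \<bar>?y * ?z\<bar> \<le> ?x * (?y\<^sup>2 + ?z\<^sup>2)" by (intro mult_left_mono) auto
    then show "\<bar>incr_X T h m k \<omega> * ?y * ?z\<bar> \<le> 1 * \<bar>\<bar>incr_X T h m k \<omega> * ?y\<^sup>2\<bar> + \<bar>incr_X T h m k \<omega> * ?z\<^sup>2\<bar>\<bar>"
      by (simp add: abs_mult algebra_simps)
  qed
qed

end

end

section \<open>Dynkin's formula for products of linear factors\<close>

context bounded_diffusion
begin

lemma prod_state_bounded:
  assumes "\<omega> \<in> space M"
  shows "\<bar>\<Prod>i\<in>S. y - X t \<omega> $ i\<bar> \<le> (\<bar>y\<bar> + R) ^ card S"
proof -
  have "\<bar>\<Prod>i\<in>S. y - X t \<omega> $ i\<bar> = (\<Prod>i\<in>S. \<bar>y - X t \<omega> $ i\<bar>)" by (rule abs_prod)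
  also have "\<dots> \<le> (\<Prod>i\<in>S. \<bar>y\<bar> + R)"
    using X_bounded[OF assms, of t] by (intro prod_mono conjI) (auto intro: order_trans[OF abs_triangle_ineq4] add_left_mono)
  finally show ?thesis by simp
qed

lemma prod_state_borel: "(\<lambda>x::real^'n. \<Prod>i\<in>S. y - x $ i) \<in> borel_measurable borel"
  by measurable

lemma prod_state_bounded_at: "0 \<le> t \<Longrightarrow> bounded_at t (\<lambda>\<omega>. \<Prod>i\<in>S. y - X t \<omega> $ i)"
  by (rule bounded_at_state[OF _ prod_state_borel prod_state_bounded])

context
  fixes T :: real
  assumes T: "0 < T"
begin

text \<open>The coordinates in \<open>S\<close> are distinct, so no square of an increment occurs.
  For two of them the increments are replaced by their Euler parts, whose product is centered even
  after weighting with a function of the present state. For three or more, three are kept for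
  \<open>small_triple\<close> and the others are bounded by \<open>2 * R\<close>.\<close>

lemma negligible_prod:
  fixes y :: real
  assumes S: "2 \<le> card S"
  shows "negligible_sums M (\<lambda>m k \<omega>. (\<Prod>i\<in>S. - incr_X T i m k \<omega>) * (\<Prod>i\<in>UNIV - S. y - X (mesh T m k) \<omega> $ i))"
proof -
  let ?g = "\<lambda>m k \<omega>. \<Prod>i\<in>UNIV - S. y - X (mesh T m k) \<omega> $ i"
  have g: "bounded_at (mesh T m k) (?g m k)" if "k < Suc m" for m k
    by (intro prod_state_bounded_at mesh_nonneg[OF T] that)
  have gb: "\<bar>?g m k \<omega>\<bar> \<le> (\<bar>y\<bar> + R) ^ card (UNIV - S)" if "\<omega> \<in> space M" for m k \<omega>
    by (rule prod_state_bounded[OF that])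
  note inc = incr_measurable[OF T]
  consider "card S = 2" | "3 \<le> card S" using S by linarith
  then show ?thesis
  proof cases
    case 1
    then obtain i j where ij: "S = {i, j}" "i \<noteq> j" by (auto simp: card_2_iff)
    have "small M (\<lambda>m k \<omega>. ?g m k \<omega> * (incr_X T i m k \<omega> * incr_X T j m k \<omega> - euler T i m k \<omega> * euler T j m k \<omega>))"
    proof (rule small_dominated[OF small_pair[OF T, of i j], where C = "(\<bar>y\<bar> + R) ^ card (UNIV - S)"])
      fix m k \<omega> assume k: "k < Suc m"
      show "(\<lambda>\<omega>. ?g m k \<omega> * (incr_X T i m k \<omega> * incr_X T j m k \<omega> - euler T i m k \<omega> * euler T j m k \<omega>)) \<in> borel_measurable M"
        using bounded_at_measurable[OF g[OF k]] inc[OF k, of i] inc[OF k, of j] by simp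
      show "\<bar>?g m k \<omega> * (incr_X T i m k \<omega> * incr_X T j m k \<omega> - euler T i m k \<omega> * euler T j m k \<omega>)\<bar>
        \<le> (\<bar>y\<bar> + R) ^ card (UNIV - S) * \<bar>incr_X T i m k \<omega> * incr_X T j m k \<omega> - euler T i m k \<omega> * euler T j m k \<omega>\<bar>"
        if "\<omega> \<in> space M"
        unfolding abs_mult[of "?g m k \<omega>"] by (intro mult_right_mono gb that) simp
    qed
    moreover have "negligible_sums M (\<lambda>m k \<omega>. ?g m k \<omega> * (euler T i m k \<omega> * euler T j m k \<omega>))"
    proof (rule negligible_sums_zero_mean)
      fix m k assume k: "k < Suc m"
      let ?h = "\<lambda>\<omega>. ?g m k \<omega> * (sg i (X (mesh T m k) \<omega>) * sg j (X (mesh T m k) \<omega>))"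
      have "bounded_at (mesh T m k) (\<lambda>\<omega>. sg i (X (mesh T m k) \<omega>))" for i
        by (rule bounded_at_state[OF mesh_nonneg(1)[OF T k] sg_borel sg_bounded])
      then have h: "bounded_at (mesh T m k) ?h" by (intro bounded_at_mult g k)
      note cr = expectation_cross_increment[OF mesh_nonneg(1)[OF T k] mesh_le_Suc[OF T k] _ bounded_at_integrable[OF h] ij(2)]
      have "has_bochner_integral M (\<lambda>\<omega>. ?h \<omega> * (incr_B T i m k \<omega> * incr_B T j m k \<omega>)) 0"
        using cr h unfolding incr_B_def by (auto simp: has_bochner_integral_iff bounded_at_def)
      then show "has_bochner_integral M (\<lambda>\<omega>. ?g m k \<omega> * (euler T i m k \<omega> * euler T j m k \<omega>)) 0"
        by (simp add: euler_def mult_ac)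
    qed
    ultimately have "negligible_sums M (\<lambda>m k \<omega>.
        ?g m k \<omega> * (incr_X T i m k \<omega> * incr_X T j m k \<omega> - euler T i m k \<omega> * euler T j m k \<omega>) +
        ?g m k \<omega> * (euler T i m k \<omega> * euler T j m k \<omega>))"
      by (rule negligible_sums_add[OF small_negligible])
    then show ?thesis using ij(2) by (simp add: ij(1) algebra_simps)
  next
    case 2
    obtain S' where S': "S' \<subseteq> S" "card S' = 3" using obtain_subset_with_card_n[OF 2] by auto
    then obtain h i j where hij: "S' = {h, i, j}" "h \<noteq> i" "h \<noteq> j" "i \<noteq> j" by (auto simp: card_3_iff)
    let ?C = "(2 * R) ^ card (S - S') * (\<bar>y\<bar> + R) ^ card (UNIV - S)"
    have "small M (\<lambda>m k \<omega>. (\<Prod>i\<in>S. - incr_X T i m k \<omega>) * ?g m k \<omega>)"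
    proof (rule small_dominated[OF small_triple[OF T, of h i j], where C = ?C])
      fix m k \<omega> assume k: "k < Suc m"
      show "(\<lambda>\<omega>. (\<Prod>i\<in>S. - incr_X T i m k \<omega>) * ?g m k \<omega>) \<in> borel_measurable M"
        using bounded_at_measurable[OF g[OF k]] inc[OF k] by (intro borel_measurable_times borel_measurable_prod) auto
      assume w: "\<omega> \<in> space M"
      have "(\<Prod>i\<in>S. - incr_X T i m k \<omega>) = (\<Prod>i\<in>S - S'. - incr_X T i m k \<omega>) * (\<Prod>i\<in>S'. - incr_X T i m k \<omega>)"
        by (rule prod.subset_diff) (use S' in auto)
      also have "(\<Prod>i\<in>S'. - incr_X T i m k \<omega>) = - (incr_X T h m k \<omega> * incr_X T i m k \<omega> * incr_X T j m k \<omega>)"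
        using hij by simp
      finally have eq: "\<bar>(\<Prod>i\<in>S. - incr_X T i m k \<omega>) * ?g m k \<omega>\<bar> =
         \<bar>\<Prod>i\<in>S - S'. - incr_X T i m k \<omega>\<bar> * \<bar>?g m k \<omega>\<bar> * \<bar>incr_X T h m k \<omega> * incr_X T i m k \<omega> * incr_X T j m k \<omega>\<bar>"
        by (simp add: abs_mult mult_ac)
      have "\<bar>\<Prod>i\<in>S - S'. - incr_X T i m k \<omega>\<bar> \<le> (\<Prod>i\<in>S - S'. 2 * R)"
        unfolding abs_prod using incr_X_bounded[OF w] by (intro prod_mono) auto
      then show "\<bar>(\<Prod>i\<in>S. - incr_X T i m k \<omega>) * ?g m k \<omega>\<bar> \<le> ?C * \<bar>incr_X T h m k \<omega> * incr_X T i m k \<omega> * incr_X T j m k \<omega>\<bar>"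
        unfolding eq using gb[OF w] R_nonneg by (intro mult_right_mono mult_mono) auto
    qed
    then show ?thesis by (rule small_negligible)
  qed
qed

text \<open>The summed expectation of the local defects \<open>Z\<close> tends to 0 along the
  meshes, but by telescoping it does not depend on the mesh at all, so it is 0. The minus sign is
  due to the derivative of the product in the coordinate \<open>i\<close> being
  \<open>- G i\<close>.\<close>

lemma dynkin_product:
  fixes y :: real
  defines "f \<equiv> \<lambda>x::real^'n. \<Prod>i\<in>UNIV. y - x $ i" and "G \<equiv> \<lambda>i (x::real^'n). \<Prod>j\<in>UNIV - {i}. y - x $ j"
  shows "expectation (\<lambda>\<omega>. f (X T \<omega>)) = expectation (\<lambda>\<omega>. f (X 0 \<omega>)) -
    expectation (\<lambda>\<omega>. LINT r:{0<..T}|lborel. (\<Sum>i\<in>UNIV. G i (X r \<omega>) * b i (X r \<omega>)))"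
proof -
  define Q where "Q i s t \<omega> = (LINT r:{s<..t}|lborel. G i (X r \<omega>) * b i (X r \<omega>))" for i s t \<omega>
  define C where "C = (\<bar>y\<bar> + R) ^ (CARD('n) - 1)"
  have C0: "0 \<le> C" using R_nonneg by (simp add: C_def)
  have Gb: "\<bar>G i (X r \<omega>)\<bar> \<le> C" if "\<omega> \<in> space M" for i r \<omega>
    using prod_state_bounded[OF that, where S = "UNIV - {i}" and y = y and t = r]
    by (simp add: G_def C_def card_Diff_singleton)
  have G_borel [measurable]: "G i \<in> borel_measurable borel" for i
    unfolding G_def by (rule prod_state_borel)
  have Qm [measurable]: "Q i s t \<in> borel_measurable M" for i s t
    unfolding Q_def[abs_def] set_lebesgue_integral_def by measurable
  have Gint: "set_integrable lborel {s<..t} (\<lambda>r. G i (X r \<omega>) * b i (X r \<omega>))"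
    if "\<omega> \<in> space M" "variation 0 T \<omega> < \<infinity>" "0 \<le> s" "t \<le> T" for i s t \<omega>
    using that path_measurable[OF that(1)]
    by (intro drift_weighted_integrable[where T = T and C = C] Gb) (auto intro: measurable_compose[OF _ G_borel])
  have Qb: "ennreal \<bar>Q i s t \<omega>\<bar> \<le> ennreal C * variation 0 T \<omega>" if w: "\<omega> \<in> space M" and st: "0 \<le> s" "t \<le> T" for i s t \<omega>
  proof -
    have "ennreal \<bar>Q i s t \<omega>\<bar> \<le> (\<integral>\<^sup>+r\<in>{s<..t}. ennreal \<bar>G i (X r \<omega>) * b i (X r \<omega>)\<bar> \<partial>lborel)"
      unfolding Q_def by (rule ennreal_abs_set_integral_le)
    also have "\<dots> \<le> (\<integral>\<^sup>+r. ennreal C * (ennreal (drift_total \<omega> r) * indicator {0<..T} r) \<partial>lborel)"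
    proof (intro nn_integral_mono)
      fix r :: real
      have "\<bar>G i (X r \<omega>) * b i (X r \<omega>)\<bar> \<le> C * drift_total \<omega> r"
        unfolding abs_mult using Gb[OF w] b_le_drift_total C0 by (intro mult_mono) auto
      then show "ennreal \<bar>G i (X r \<omega>) * b i (X r \<omega>)\<bar> * indicator {s<..t} r \<le>
         ennreal C * (ennreal (drift_total \<omega> r) * indicator {0<..T} r)"
        using st C0 drift_total_nonneg by (auto split: split_indicator simp: ennreal_mult[symmetric] intro!: ennreal_leI)
    qed
    also have "\<dots> = ennreal C * variation 0 T \<omega>"
      unfolding variation_def using measurable_compose[OF measurable_Pair1'[OF w] drift_total_measurable]
      by (intro nn_integral_cmult) simp
    finally show ?thesis .
  qed
  have Qint: "integrable M (Q i s t)" if st: "0 \<le> s" "t \<le> T" for i s t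
  proof -
    have "(\<integral>\<^sup>+\<omega>. ennreal (norm (Q i s t \<omega>)) \<partial>M) \<le> (\<integral>\<^sup>+\<omega>. ennreal C * variation 0 T \<omega> \<partial>M)"
      using Qb st by (intro nn_integral_mono) auto
    also have "\<dots> < \<infinity>" using variation_integrable[of T] by (simp add: nn_integral_cmult ennreal_mult_less_top)
    finally show ?thesis by (simp add: integrable_iff_bounded)
  qed
  have fint: "integrable M (\<lambda>\<omega>. f (X t \<omega>))" if "0 \<le> t" for t
    unfolding f_def by (intro bounded_at_integrable[OF prod_state_bounded_at] that)
  \<comment> \<open>The defect of the claimed formula over one cell, before taking
    expectations.\<close>
  define Z where "Z m k \<omega> = f (X (mesh T m (Suc k)) \<omega>) - f (X (mesh T m k) \<omega>) +
    (\<Sum>i\<in>UNIV. Q i (mesh T m k) (mesh T m (Suc k)) \<omega>)" for m k \<omega>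
  let ?P = "\<lambda>S m k \<omega>. (\<Prod>i\<in>S. - incr_X T i m k \<omega>) * (\<Prod>i\<in>UNIV - S. y - X (mesh T m k) \<omega> $ i)"
  \<comment> \<open>The first order term is divided into a martingale increment with a weight known
    at the start of the cell, which has mean zero, and the error from freezing \<open>G i\<close> in
    the drift integral.\<close>
  let ?L = "\<lambda>i m k \<omega>. - G i (X (mesh T m k) \<omega>) * (incr_X T i m k \<omega> - incr_A T i m k \<omega>) +
     (Q i (mesh T m k) (mesh T m (Suc k)) \<omega> - G i (X (mesh T m k) \<omega>) * incr_A T i m k \<omega>)"
  have Z_eq: "Z m k \<omega> = (\<Sum>i\<in>UNIV. ?L i m k \<omega>) + (\<Sum>S\<in>{S. 2 \<le> card S}. ?P S m k \<omega>)" for m k \<omega>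
  proof -
    \<comment> \<open>Expanding the product over subsets \<open>S\<close> of changed coordinates:
      the empty set returns the old value, singletons give the first order terms, and larger sets
      are covered by \<open>negligible_prod\<close>.\<close>
    have "f (X (mesh T m (Suc k)) \<omega>) = (\<Prod>i\<in>UNIV. - incr_X T i m k \<omega> + (y - X (mesh T m k) \<omega> $ i))"
      unfolding f_def incr_X_def by (intro prod.cong) auto
    also have "\<dots> = (\<Sum>S\<in>Pow UNIV. ?P S m k \<omega>)" by (rule prod_add) simp
    also have "(Pow UNIV :: 'n set set) = insert {} (((\<lambda>i. {i}) ` UNIV) \<union> {S. 2 \<le> card S})"
    proof -
      have "S = {} \<or> S \<in> (\<lambda>i. {i}) ` UNIV \<or> 2 \<le> card S" for S :: "'n set"
      proof -
        consider "card S = 0" | "card S = 1" | "2 \<le> card S" by linarith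
        then show ?thesis by cases (auto simp: card_1_singleton_iff)
      qed
      then show ?thesis by auto
    qed
    also have "(\<Sum>S\<in>\<dots>. ?P S m k \<omega>) = f (X (mesh T m k) \<omega>) +
       ((\<Sum>S\<in>(\<lambda>i. {i}) ` UNIV. ?P S m k \<omega>) + (\<Sum>S\<in>{S. 2 \<le> card S}. ?P S m k \<omega>))"
      by (subst sum.insert, simp, force, subst sum.union_disjoint) (auto simp: f_def)
    also have "(\<Sum>S\<in>(\<lambda>i. {i}) ` UNIV. ?P S m k \<omega>) = (\<Sum>i\<in>UNIV. - incr_X T i m k \<omega> * G i (X (mesh T m k) \<omega>))"
      by (subst sum.reindex) (auto simp: G_def inj_on_def)
    finally have "Z m k \<omega> = (\<Sum>i\<in>UNIV. - incr_X T i m k \<omega> * G i (X (mesh T m k) \<omega>)) +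
      (\<Sum>i\<in>UNIV. Q i (mesh T m k) (mesh T m (Suc k)) \<omega>) + (\<Sum>S\<in>{S. 2 \<le> card S}. ?P S m k \<omega>)"
      by (simp add: Z_def)
    also have "(\<Sum>i\<in>UNIV. - incr_X T i m k \<omega> * G i (X (mesh T m k) \<omega>)) +
      (\<Sum>i\<in>UNIV. Q i (mesh T m k) (mesh T m (Suc k)) \<omega>) = (\<Sum>i\<in>UNIV. ?L i m k \<omega>)"
      unfolding sum.distrib[symmetric] by (intro sum.cong) (auto simp: algebra_simps)
    finally show ?thesis .
  qed
  have negl_L: "negligible_sums M (?L i)" for i
  proof (rule negligible_sums_add[OF _ small_negligible])
    show "negligible_sums M (\<lambda>m k \<omega>. - G i (X (mesh T m k) \<omega>) * (incr_X T i m k \<omega> - incr_A T i m k \<omega>))"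
    proof (rule negligible_sums_zero_mean)
      fix m k assume k: "k < Suc m"
      have "bounded_at (mesh T m k) (\<lambda>\<omega>. - G i (X (mesh T m k) \<omega>))"
        using Gb by (intro bounded_at_state[where C = C] mesh_nonneg[OF T] k) auto
      from martingale_mean[OF mesh_nonneg(1)[OF T k] mesh_le_Suc[OF T k] this]
      show "has_bochner_integral M (\<lambda>\<omega>. - G i (X (mesh T m k) \<omega>) * (incr_X T i m k \<omega> - incr_A T i m k \<omega>)) 0"
        by (simp add: incr_X_def incr_A_def)
    qed
    show "small M (\<lambda>m k \<omega>. Q i (mesh T m k) (mesh T m (Suc k)) \<omega> - G i (X (mesh T m k) \<omega>) * incr_A T i m k \<omega>)"
    proof (rule small_le[where C = 1])
      fix m k assume k: "k < Suc m"
      let ?s = "mesh T m k" and ?t = "mesh T m (Suc k)"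
      note [measurable] = mesh_state_measurable[OF T k] incr_measurable[OF T k]
      show "(\<lambda>\<omega>. Q i ?s ?t \<omega> - G i (X ?s \<omega>) * incr_A T i m k \<omega>) \<in> borel_measurable M" by measurable
      have "(\<integral>\<^sup>+\<omega>. ennreal \<bar>Q i ?s ?t \<omega> - G i (X ?s \<omega>) * incr_A T i m k \<omega>\<bar> \<partial>M) \<le>
        (\<integral>\<^sup>+\<omega>. (\<integral>\<^sup>+r\<in>{?s<..?t}. ennreal (\<bar>G i (X r \<omega>) - G i (X ?s \<omega>)\<bar> * drift_total \<omega> r) \<partial>lborel) \<partial>M)"
      proof (rule nn_integral_mono_AE)
        show "AE \<omega> in M. ennreal \<bar>Q i ?s ?t \<omega> - G i (X ?s \<omega>) * incr_A T i m k \<omega>\<bar> \<le>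
           (\<integral>\<^sup>+r\<in>{?s<..?t}. ennreal (\<bar>G i (X r \<omega>) - G i (X ?s \<omega>)\<bar> * drift_total \<omega> r) \<partial>lborel)"
          using variation_finite[of T] AE_space
        proof eventually_elim
          case (elim \<omega>)
          have i1: "set_integrable lborel {?s<..?t} (\<lambda>r. G i (X r \<omega>) * b i (X r \<omega>))"
            using elim k by (intro Gint mesh_nonneg[OF T] mesh_le[OF T]) auto
          have i2: "set_integrable lborel {?s<..?t} (\<lambda>r. b i (X r \<omega>))"
            using elim k by (intro drift_integrable[where T = T] mesh_nonneg[OF T] mesh_le[OF T]) auto
          have "Q i ?s ?t \<omega> - G i (X ?s \<omega>) * incr_A T i m k \<omega> =
            (LINT r:{?s<..?t}|lborel. (G i (X r \<omega>) - G i (X ?s \<omega>)) * b i (X r \<omega>))"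
            using i1 i2 unfolding Q_def incr_A_def drift_integral_def
            by (simp add: left_diff_distrib set_integral_diff)
          then have "ennreal \<bar>Q i ?s ?t \<omega> - G i (X ?s \<omega>) * incr_A T i m k \<omega>\<bar> \<le>
            (\<integral>\<^sup>+r\<in>{?s<..?t}. ennreal \<bar>(G i (X r \<omega>) - G i (X ?s \<omega>)) * b i (X r \<omega>)\<bar> \<partial>lborel)"
            by (simp only: ennreal_abs_set_integral_le)
          also have "\<dots> \<le> (\<integral>\<^sup>+r\<in>{?s<..?t}. ennreal (\<bar>G i (X r \<omega>) - G i (X ?s \<omega>)\<bar> * drift_total \<omega> r) \<partial>lborel)"
            unfolding abs_mult using b_le_drift_total
            by (intro nn_integral_mono mult_right_mono ennreal_leI mult_left_mono) auto
          finally show ?case .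
        qed
      qed
      then show "(\<integral>\<^sup>+\<omega>. ennreal \<bar>Q i ?s ?t \<omega> - G i (X ?s \<omega>) * incr_A T i m k \<omega>\<bar> \<partial>M) \<le>
        1 * (\<integral>\<^sup>+\<omega>. (\<integral>\<^sup>+r\<in>{?s<..?t}. ennreal (\<bar>G i (X r \<omega>) - G i (X ?s \<omega>)\<bar> * drift_total \<omega> r) \<partial>lborel) \<partial>M)"
        by simp
    next
      show "(\<lambda>m. \<Sum>k<Suc m. \<integral>\<^sup>+\<omega>. (\<integral>\<^sup>+r\<in>{mesh T m k<..mesh T m (Suc k)}.
         ennreal (\<bar>G i (X r \<omega>) - G i (X (mesh T m k) \<omega>)\<bar> * drift_total \<omega> r) \<partial>lborel) \<partial>M) \<longlonglongrightarrow> 0"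
      proof (rule drift_weighted_mesh_limit[OF T, where \<phi> = "\<lambda>a b \<omega> r. G i (X r \<omega>) - G i (X a \<omega>)" and C = "2 * C"])
        fix a b :: real assume "0 \<le> a"
        then have [measurable]: "X a \<in> borel_measurable M" by (rule X_measurable)
        show "(\<lambda>(\<omega>, r). G i (X r \<omega>) - G i (X a \<omega>)) \<in> borel_measurable (M \<Otimes>\<^sub>M lborel)"
          unfolding split_beta' by measurable
      next
        show "\<bar>G i (X r \<omega>) - G i (X a \<omega>)\<bar> \<le> 2 * C" if "\<omega> \<in> space M" for a r \<omega>
          using Gb[OF that, of i r] Gb[OF that, of i a] by linarith
        fix a b :: "nat \<Rightarrow> real" and \<omega> r assume "\<omega> \<in> space M" "a \<longlonglongrightarrow> r"
        then have "(\<lambda>m. G i (X r \<omega>) - G i (X (a m) \<omega>)) \<longlonglongrightarrow> G i (X r \<omega>) - G i (X r \<omega>)"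
          unfolding G_def by (intro tendsto_diff tendsto_const tendsto_prod tendsto_vec_nth path_tendsto)
        then show "(\<lambda>m. G i (X r \<omega>) - G i (X (a m) \<omega>)) \<longlonglongrightarrow> 0" by simp
      qed
    qed auto
  qed
  have "negligible_sums M (\<lambda>m k \<omega>. (\<Sum>i\<in>UNIV. ?L i m k \<omega>) + (\<Sum>S\<in>{S. 2 \<le> card S}. ?P S m k \<omega>))"
    by (rule negligible_sums_add[OF negligible_sums_sum[OF negl_L] negligible_sums_sum[OF negligible_prod]]) simp
  then have lim: "(\<lambda>m. \<Sum>k<Suc m. expectation (Z m k)) \<longlonglongrightarrow> 0"
    by (simp only: negligible_sums_def Z_eq[abs_def])
  have "(\<Sum>k<Suc m. expectation (Z m k)) = expectation (\<lambda>\<omega>. f (X T \<omega>)) - expectation (\<lambda>\<omega>. f (X 0 \<omega>)) +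
     expectation (\<lambda>\<omega>. \<Sum>i\<in>UNIV. Q i 0 T \<omega>)" for m
  proof -
    have Zi: "integrable M (Z m k)" if k: "k < Suc m" for k
      unfolding Z_def[abs_def]
      by (intro Bochner_Integration.integrable_add Bochner_Integration.integrable_diff
          Bochner_Integration.integrable_sum fint Qint mesh_nonneg[OF T] mesh_le[OF T] k)
    \<comment> \<open>Additivity of the drift integral needs integrability on each piece, so it is
      asserted only for paths of finite variation.\<close>
    have tele: "(\<Sum>k<n. Q i (mesh T m k) (mesh T m (Suc k)) \<omega>) = Q i 0 (mesh T m n) \<omega>"
      if w: "\<omega> \<in> space M" "variation 0 T \<omega> < \<infinity>" and "n \<le> Suc m" for i \<omega> n
      using that(3)
    proof (induction n)
      case 0
      then show ?case by (simp add: Q_def set_lebesgue_integral_def)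
    next
      case (Suc n)
      then have n: "n < Suc m" by simp
      have "{0<..mesh T m (Suc n)} = {0<..mesh T m n} \<union> {mesh T m n<..mesh T m (Suc n)}"
        using mesh_nonneg(1)[OF T n] mesh_le_Suc[OF T n] by auto
      moreover have "set_integrable lborel {0<..mesh T m n} (\<lambda>r. G i (X r \<omega>) * b i (X r \<omega>))"
        using order_trans[OF mesh_le_Suc[OF T n] mesh_le[OF T n]] by (intro Gint w) auto
      moreover have "set_integrable lborel {mesh T m n<..mesh T m (Suc n)} (\<lambda>r. G i (X r \<omega>) * b i (X r \<omega>))"
        by (intro Gint w mesh_nonneg[OF T n] mesh_le[OF T n])
      ultimately have "Q i 0 (mesh T m (Suc n)) \<omega> = Q i 0 (mesh T m n) \<omega> + Q i (mesh T m n) (mesh T m (Suc n)) \<omega>"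
        unfolding Q_def by (simp add: set_integral_Un)
      then show ?case using Suc by simp
    qed
    have "(\<Sum>k<Suc m. expectation (Z m k)) = expectation (\<lambda>\<omega>. \<Sum>k<Suc m. Z m k \<omega>)"
      using Zi by (intro Bochner_Integration.integral_sum[symmetric]) auto
    also have "\<dots> = expectation (\<lambda>\<omega>. f (X T \<omega>) - f (X 0 \<omega>) + (\<Sum>i\<in>UNIV. Q i 0 T \<omega>))"
    proof (rule Bochner_Integration.integral_cong_AE)
      show "(\<lambda>\<omega>. \<Sum>k<Suc m. Z m k \<omega>) \<in> borel_measurable M"
        using Zi by (intro borel_measurable_sum) auto
      show "(\<lambda>\<omega>. f (X T \<omega>) - f (X 0 \<omega>) + (\<Sum>i\<in>UNIV. Q i 0 T \<omega>)) \<in> borel_measurable M"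
        using fint[of T] fint[of 0] T by (intro borel_measurable_add borel_measurable_diff borel_measurable_sum) auto
      show "AE \<omega> in M. (\<Sum>k<Suc m. Z m k \<omega>) = f (X T \<omega>) - f (X 0 \<omega>) + (\<Sum>i\<in>UNIV. Q i 0 T \<omega>)"
        using variation_finite[of T] AE_space
      proof eventually_elim
        case (elim \<omega>)
        have "(\<Sum>k<Suc m. Z m k \<omega>) = (\<Sum>k<Suc m. f (X (mesh T m (Suc k)) \<omega>) - f (X (mesh T m k) \<omega>)) +
           (\<Sum>k<Suc m. \<Sum>i\<in>UNIV. Q i (mesh T m k) (mesh T m (Suc k)) \<omega>)"
          unfolding Z_def by (rule sum.distrib)
        also have "(\<Sum>k<Suc m. f (X (mesh T m (Suc k)) \<omega>) - f (X (mesh T m k) \<omega>)) = f (X T \<omega>) - f (X 0 \<omega>)"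
          by (subst sum_lessThan_telescope[where f = "\<lambda>k. f (X (mesh T m k) \<omega>)"]) simp
        also have "(\<Sum>k<Suc m. \<Sum>i\<in>UNIV. Q i (mesh T m k) (mesh T m (Suc k)) \<omega>) = (\<Sum>i\<in>UNIV. Q i 0 T \<omega>)"
          by (subst sum.swap) (simp only: tele[OF elim(2,1) order_refl] mesh_last)
        finally show ?case .
      qed
    qed
    also have "\<dots> = expectation (\<lambda>\<omega>. f (X T \<omega>)) - expectation (\<lambda>\<omega>. f (X 0 \<omega>)) + expectation (\<lambda>\<omega>. \<Sum>i\<in>UNIV. Q i 0 T \<omega>)"
      using fint[of T] fint[of 0] T Qint[of 0 T] by simp
    finally show ?thesis .
  qed
  with lim have "expectation (\<lambda>\<omega>. f (X T \<omega>)) - expectation (\<lambda>\<omega>. f (X 0 \<omega>)) +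
     expectation (\<lambda>\<omega>. \<Sum>i\<in>UNIV. Q i 0 T \<omega>) = 0"
    by (simp add: LIMSEQ_const_iff)
  moreover have "expectation (\<lambda>\<omega>. \<Sum>i\<in>UNIV. Q i 0 T \<omega>) =
     expectation (\<lambda>\<omega>. LINT r:{0<..T}|lborel. (\<Sum>i\<in>UNIV. G i (X r \<omega>) * b i (X r \<omega>)))"
  proof (rule Bochner_Integration.integral_cong_AE)
    show "(\<lambda>\<omega>. LINT r:{0<..T}|lborel. (\<Sum>i\<in>UNIV. G i (X r \<omega>) * b i (X r \<omega>))) \<in> borel_measurable M"
      unfolding set_lebesgue_integral_def by measurable
    show "AE \<omega> in M. (\<Sum>i\<in>UNIV. Q i 0 T \<omega>) = (LINT r:{0<..T}|lborel. (\<Sum>i\<in>UNIV. G i (X r \<omega>) * b i (X r \<omega>)))"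
      using variation_finite[of T] AE_space
    proof eventually_elim
      case (elim \<omega>)
      then show ?case
        using Gint[of \<omega> 0 T] unfolding Q_def set_lebesgue_integral_def set_integrable_def scaleR_sum_right
        by (subst Bochner_Integration.integral_sum) auto
    qed
  qed measurable
  ultimately show ?thesis by linarith
qed

end

end

section \<open>Jacobi processes\<close>

lemma augmented_filtration_brownian:
  fixes B :: "real \<Rightarrow> 'a \<Rightarrow> real ^ 'n"
  assumes "prob_space M" and B: "brownian_motion M (augmented_filtration M B) B"
  shows "filtered_brownian_motion M (augmented_filtration M B) B"
proof -
  interpret prob_space M by fact
  let ?G = "\<lambda>t. {B s -` A \<inter> space M | s A. 0 \<le> s \<and> s \<le> t \<and> A \<in> sets borel} \<union> null_sets M"
  have sub: "?G t \<subseteq> sets M" for t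
    using B by (auto simp: brownian_motion_def intro: measurable_sets)
  then have pow: "?G t \<subseteq> Pow (space M)" for t using sets.space_closed by blast
  have sets: "sets (augmented_filtration M B t) = sigma_sets (space M) (?G t)" for t
    unfolding augmented_filtration_def by (rule sets_measure_of[OF pow])
  show ?thesis
  proof
    show "space (augmented_filtration M B t) = space M" for t
      by (simp add: augmented_filtration_def space_measure_of_conv)
    show "sets (augmented_filtration M B t) \<subseteq> sets M" for t
      unfolding sets by (rule sets.sigma_sets_subset[OF sub])
    show "sets (augmented_filtration M B s) \<subseteq> sets (augmented_filtration M B t)" if "s \<le> t" for s t
      unfolding sets using that by (intro sigma_sets_mono') (auto intro: order_trans)
  qed fact
qed

text \<open>Rounding the time down to a multiple of \<open>1 / Suc m\<close> leaves countably many
  values, for which joint measurability is clear. Continuity of the paths gives convergence to the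
  process.\<close>

lemma joint_measurable_continuous_paths:
  fixes Y :: "real \<Rightarrow> 'a \<Rightarrow> 'b::{metric_space, second_countable_topology}"
  assumes Ym: "\<And>t. Y t \<in> borel_measurable M"
    and cont: "\<And>\<omega>. \<omega> \<in> space M \<Longrightarrow> continuous_on UNIV (\<lambda>t. Y t \<omega>)"
  shows "(\<lambda>(\<omega>, r). Y r \<omega>) \<in> borel_measurable (M \<Otimes>\<^sub>M lborel)"
proof (rule borel_measurable_LIMSEQ_metric)
  let ?Y = "\<lambda>m (\<omega>, r). Y (of_int \<lfloor>r * real (Suc m)\<rfloor> / real (Suc m)) \<omega>"
  fix m
  have "(\<lambda>x. Y (of_int k / real (Suc m)) (fst x)) \<in> borel_measurable (M \<Otimes>\<^sub>M lborel)" for k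
    using Ym by measurable
  moreover have "(\<lambda>x. \<lfloor>snd x * real (Suc m)\<rfloor>) \<in> measurable (M \<Otimes>\<^sub>M lborel) (count_space UNIV)"
    by measurable
  ultimately show "?Y m \<in> borel_measurable (M \<Otimes>\<^sub>M lborel)"
    unfolding split_beta' by (rule measurable_compose_countable)
next
  fix x assume "x \<in> space (M \<Otimes>\<^sub>M (lborel :: real measure))"
  then obtain \<omega> r where x: "x = (\<omega>, r)" "\<omega> \<in> space M" by (auto simp: space_pair_measure)
  have b: "r - 1 / real (Suc m) \<le> of_int \<lfloor>r * real (Suc m)\<rfloor> / real (Suc m)"
    "of_int \<lfloor>r * real (Suc m)\<rfloor> / real (Suc m) \<le> r" for m
  proof -
    have "of_int \<lfloor>r * real (Suc m)\<rfloor> \<le> r * real (Suc m)" by simp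
    then show "of_int \<lfloor>r * real (Suc m)\<rfloor> / real (Suc m) \<le> r"
      by (simp only: pos_divide_le_eq of_nat_0_less_iff zero_less_Suc)
    have "r * real (Suc m) - 1 \<le> of_int \<lfloor>r * real (Suc m)\<rfloor>" by linarith
    then have "(r - 1 / real (Suc m)) * real (Suc m) \<le> of_int \<lfloor>r * real (Suc m)\<rfloor>"
      by (simp add: left_diff_distrib del: of_nat_Suc)
    then show "r - 1 / real (Suc m) \<le> of_int \<lfloor>r * real (Suc m)\<rfloor> / real (Suc m)"
      by (simp only: pos_le_divide_eq of_nat_0_less_iff zero_less_Suc)
  qed
  have L: "(\<lambda>m. r - 1 / real (Suc m)) \<longlonglongrightarrow> r - 0"
    by (intro tendsto_diff tendsto_const LIMSEQ_Suc[OF lim_const_over_n])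
  have "(\<lambda>m. of_int \<lfloor>r * real (Suc m)\<rfloor> / real (Suc m)) \<longlonglongrightarrow> r"
    by (rule tendsto_sandwich[OF always_eventually always_eventually L[unfolded diff_0_right] tendsto_const])
      (intro allI b)+
  from continuous_on_tendsto_compose[OF cont[OF x(2)] this]
  show "(\<lambda>m. case x of (\<omega>, r) \<Rightarrow> Y (of_int \<lfloor>r * real (Suc m)\<rfloor> / real (Suc m)) \<omega>) \<longlonglongrightarrow> (case x of (\<omega>, r) \<Rightarrow> Y r \<omega>)"
    by (simp add: x)
qed

text \<open>Only the values of the integrand at nonnegative times enter. This permits a change of
  the Jacobi process at negative times.\<close>

lemma has_ito_integral_cong:
  assumes "\<And>s \<omega>. 0 \<le> s \<Longrightarrow> H s \<omega> = H' s \<omega>"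
  shows "has_ito_integral M F W H t I \<longleftrightarrow> has_ito_integral M F W H' t I"
proof -
  have "progressive F H \<longleftrightarrow> progressive F H'"
    unfolding progressive_def
    by (intro all_cong1 imp_cong refl measurable_cong)
      (auto simp: space_pair_measure space_restrict_space assms)
  moreover have "(\<integral>\<^sup>+\<omega>. (\<integral>\<^sup>+s\<in>{0..t}. ennreal ((simple_eval n \<tau> \<xi> s \<omega> - H s \<omega>)\<^sup>2) \<partial>lborel) \<partial>M) =
     (\<integral>\<^sup>+\<omega>. (\<integral>\<^sup>+s\<in>{0..t}. ennreal ((simple_eval n \<tau> \<xi> s \<omega> - H' s \<omega>)\<^sup>2) \<partial>lborel) \<partial>M)" for n \<tau> \<xi>
    by (intro nn_integral_cong) (auto simp: assms split: split_indicator)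
  ultimately show ?thesis by (simp add: has_ito_integral_def)
qed

lemma sqn_sum_finite:
  assumes "finite I" "\<And>i. i \<in> I \<Longrightarrow> f i \<in> borel_measurable P" "\<And>i. i \<in> I \<Longrightarrow> sqn P (f i) < \<infinity>"
  shows "sqn P (\<lambda>x. \<Sum>i\<in>I. f i x) < \<infinity>"
  using assms
proof (induction I rule: finite_induct)
  case empty then show ?case by (simp add: sqn_def)
next
  case (insert i I)
  have "sqn P (\<lambda>x. \<Sum>i\<in>insert i I. f i x) = sqn P (\<lambda>x. f i x + (\<Sum>i\<in>I. f i x))"
    using insert by simp
  also have "\<dots> \<le> 2 * sqn P (f i) + 2 * sqn P (\<lambda>x. \<Sum>i\<in>I. f i x)"
    using insert.prems(1) by (intro sqn_add borel_measurable_sum) auto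
  also have "\<dots> < \<infinity>" using insert by (simp add: ennreal_mult_less_top)
  finally show ?case .
qed

lemma jacobi_drift_borel: "jacobi_drift \<kappa> p q i \<in> borel_measurable borel"
  unfolding jacobi_drift_def[abs_def] by measurable

text \<open>All repulsion terms enter \<open>\<Sum>i. rk i * jacobi_drift \<kappa> p q i x\<close> with the same sign, so that
  this combination of the drifts controls their absolute values.\<close>

lemma jacobi_drift_bound:
  fixes x :: "real ^ 'n::{finite,linorder}"
  assumes x: "x \<in> jacobi_alcove" and \<kappa>: "0 \<le> \<kappa>"
  defines "rk \<equiv> \<lambda>i::'n. real (card {j. j < i})"
  shows "(\<Sum>i\<in>UNIV. \<bar>jacobi_drift \<kappa> p q i x\<bar>) \<le>
    \<kappa> * (\<bar>p - q\<bar> + \<bar>p + q\<bar>) * (real CARD('n) + 2 * (\<Sum>i\<in>UNIV. rk i)) +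
    2 * (\<Sum>i\<in>UNIV. rk i * jacobi_drift \<kappa> p q i x)"
proof -
  define u where "u i = (p - q) - (p + q) * x $ i" for i
  define U where "U = \<bar>p - q\<bar> + \<bar>p + q\<bar>"
  define h where "h i j = (1 - x $ i * x $ j) / (x $ i - x $ j)" for i j
  have xb: "\<bar>x $ i\<bar> \<le> 1" for i using x by (auto simp: jacobi_alcove_def abs_le_iff minus_le_iff)
  have u: "\<bar>u i\<bar> \<le> U" for i
  proof -
    have "\<bar>u i\<bar> \<le> \<bar>p - q\<bar> + \<bar>(p + q) * x $ i\<bar>" unfolding u_def by (rule abs_triangle_ineq4)
    also have "\<bar>(p + q) * x $ i\<bar> \<le> \<bar>p + q\<bar> * 1" unfolding abs_mult by (intro mult_left_mono xb) auto
    finally show ?thesis by (simp add: U_def)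
  qed
  \<comment> \<open>The diagonal term \<open>h i i\<close> is a quotient by 0, hence 0, so the sums
    may run over all indices. The same convention covers boundary points where two coordinates
    coincide.\<close>
  have hsum: "(\<Sum>j\<in>UNIV - {i}. g (h i j)) = (\<Sum>j\<in>UNIV. g (h i j))" if "g 0 = 0" for g :: "real \<Rightarrow> real" and i
    by (rule sum.mono_neutral_left) (auto simp: h_def that)
  have drift: "jacobi_drift \<kappa> p q i x = \<kappa> * (u i + 2 * (\<Sum>j\<in>UNIV. h i j))" for i
    using hsum[of "\<lambda>t. t" i] by (simp add: jacobi_drift_def u_def h_def)
  have anti: "h j i = - h i j" for i j
    unfolding h_def by (metis minus_diff_eq minus_divide_right mult.commute)
  \<comment> \<open>Antisymmetry of \<open>h\<close> turns \<open>2 * S\<close> into a sum of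
    \<open>(rk i - rk j) * h i j\<close>. For distinct indices the two factors have compatible signs
    and the ranks differ by at least 1, so each term dominates the absolute value of
    \<open>h i j\<close>.\<close>
  define S where "S = (\<Sum>i\<in>UNIV. rk i * (\<Sum>j\<in>UNIV. h i j))"
  have S1: "S = (\<Sum>i\<in>UNIV. \<Sum>j\<in>UNIV. rk i * h i j)" by (simp add: S_def sum_distrib_left)
  also have "\<dots> = (\<Sum>i\<in>UNIV. \<Sum>j\<in>UNIV. rk j * h j i)" by (rule sum.swap)
  also have "\<dots> = - (\<Sum>i\<in>UNIV. \<Sum>j\<in>UNIV. rk j * h i j)"
    unfolding sum_negf[symmetric] mult_minus_right[symmetric] anti[symmetric] by (rule refl)
  finally have "2 * S = (\<Sum>i\<in>UNIV. \<Sum>j\<in>UNIV. (rk i - rk j) * h i j)"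
    using S1 by (simp add: left_diff_distrib sum_subtractf)
  moreover have "\<bar>h i j\<bar> \<le> (rk i - rk j) * h i j" for i j
  proof -
    have pos: "\<bar>h i j\<bar> \<le> (rk i - rk j) * h i j" if "j < i" for i j
    proof -
      have "{k. k < j} \<subset> {k. k < i}" using that by auto
      then have "card {k. k < j} < card {k. k < i}" by (intro psubset_card_mono) auto
      then have 1: "1 \<le> rk i - rk j" by (simp add: rk_def)
      have "x $ j \<le> x $ i" using x that by (auto simp: jacobi_alcove_def)
      moreover have "x $ i * x $ j \<le> 1"
        using mult_mono[OF xb[of i] xb[of j]] abs_ge_self[of "x $ i * x $ j"] by (simp add: abs_mult)
      ultimately have "0 \<le> h i j" by (simp add: h_def)
      then show ?thesis using mult_right_mono[OF 1] by simp
    qed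
    consider "i = j" | "j < i" | "i < j" by (meson linorder_neqE)
    then show ?thesis
    proof cases
      case 1 then show ?thesis by (simp add: h_def)
    next
      case 2 then show ?thesis by (rule pos)
    next
      case 3
      have "(rk i - rk j) * h i j = (rk j - rk i) * h j i"
        unfolding anti[of j i] by (simp add: algebra_simps)
      then show ?thesis using pos[OF 3] anti[of j i] by simp
    qed
  qed
  ultimately have S2: "(\<Sum>i\<in>UNIV. \<Sum>j\<in>UNIV. \<bar>h i j\<bar>) \<le> 2 * S" by (simp add: sum_mono)
  have "(\<Sum>i\<in>UNIV. \<bar>jacobi_drift \<kappa> p q i x\<bar>) \<le> (\<Sum>i\<in>(UNIV::'n set). \<kappa> * (U + 2 * (\<Sum>j\<in>UNIV. \<bar>h i j\<bar>)))"
  proof (intro sum_mono)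
    fix i
    have "\<bar>u i + 2 * (\<Sum>j\<in>UNIV. h i j)\<bar> \<le> U + 2 * (\<Sum>j\<in>UNIV. \<bar>h i j\<bar>)"
      using u[of i] sum_abs[of "h i" UNIV] by linarith
    then show "\<bar>jacobi_drift \<kappa> p q i x\<bar> \<le> \<kappa> * (U + 2 * (\<Sum>j\<in>UNIV. \<bar>h i j\<bar>))"
      unfolding drift abs_mult using \<kappa> by (simp add: mult_left_mono)
  qed
  also have "\<dots> = \<kappa> * (real CARD('n) * U + 2 * (\<Sum>i\<in>UNIV. \<Sum>j\<in>UNIV. \<bar>h i j\<bar>))"
    by (simp add: sum_distrib_left[symmetric] sum.distrib)
  also have "\<dots> \<le> \<kappa> * (real CARD('n) * U + 2 * (2 * S))"
    using S2 \<kappa> by (intro mult_left_mono) auto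
  finally have A: "(\<Sum>i\<in>UNIV. \<bar>jacobi_drift \<kappa> p q i x\<bar>) \<le> \<kappa> * (real CARD('n) * U + 4 * S)" by simp
  have "- (U * (\<Sum>i\<in>UNIV. rk i)) \<le> (\<Sum>i\<in>UNIV. rk i * u i)"
  proof -
    have "(\<Sum>i\<in>UNIV. rk i * - U) \<le> (\<Sum>i\<in>UNIV. rk i * u i)"
      by (intro sum_mono mult_left_mono) (use u in \<open>auto simp: rk_def abs_le_iff minus_le_iff\<close>)
    then show ?thesis by (simp add: sum_distrib_right[symmetric] sum_negf mult.commute[of U])
  qed
  then have "\<kappa> * (2 * S - U * (\<Sum>i\<in>UNIV. rk i)) \<le> \<kappa> * ((\<Sum>i\<in>UNIV. rk i * u i) + 2 * S)"
    using \<kappa> by (intro mult_left_mono) auto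
  also have "\<dots> = (\<Sum>i\<in>UNIV. rk i * jacobi_drift \<kappa> p q i x)"
    by (simp add: drift S_def sum_distrib_left sum.distrib algebra_simps)
  finally have "\<kappa> * (2 * S - U * (\<Sum>i\<in>UNIV. rk i)) \<le> (\<Sum>i\<in>UNIV. rk i * jacobi_drift \<kappa> p q i x)" .
  moreover have "\<kappa> * (real CARD('n) * U + 4 * S) = \<kappa> * U * (real CARD('n) + 2 * (\<Sum>i\<in>UNIV. rk i)) +
     2 * (\<kappa> * (2 * S - U * (\<Sum>i\<in>UNIV. rk i)))" by (simp add: algebra_simps)
  ultimately show ?thesis using A unfolding U_def by linarith
qed

text \<open>If two coordinates agree, raising the one with the smaller index by an arbitrarily small
  amount violates the ordering.\<close>

lemma interior_jacobi_alcove_neq: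
  fixes x :: "real ^ 'n::{finite,linorder}"
  assumes x: "x \<in> interior jacobi_alcove" and "i \<noteq> j"
  shows "x $ i \<noteq> x $ j"
proof
  have neq: False if ij: "i < j" and eq: "x $ i = x $ j" for i j
  proof -
    obtain e where e: "e > 0" "ball x e \<subseteq> jacobi_alcove" using x by (auto simp: mem_interior)
    have "axis i (e / 2) = (e / 2) *\<^sub>R axis i (1::real)" by (simp add: vec_eq_iff axis_def)
    then have "norm (axis i (e / 2)) < e" using e(1) by simp
    then have "x + axis i (e / 2) \<in> ball x e" by (simp add: dist_norm)
    then have "x + axis i (e / 2) \<in> jacobi_alcove" using e(2) by blast
    then have "(x + axis i (e / 2)) $ i \<le> (x + axis i (e / 2)) $ j"
      using ij less_imp_le[of i j] unfolding jacobi_alcove_def by blast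
    then show False using e(1) eq ij by (simp add: axis_def split: if_splits)
  qed
  assume "x $ i = x $ j"
  then show False using neq[of i j] neq[of j i] assms(2) by (metis linorder_neqE)
qed

text \<open>Freezing the paths before time \<open>0\<close> makes them continuous, hence jointly measurable, on all of \<open>\<real>\<close>.\<close>

lemma jacobi_process_diffusion:
  fixes X :: "real \<Rightarrow> 'a \<Rightarrow> real ^ 'n::{finite,linorder}"
  assumes J: "jacobi_process M B \<kappa> p q x0 X" and \<kappa>: "0 \<le> \<kappa>"
  defines "Y \<equiv> \<lambda>t. X (max 0 t)"
  shows "bounded_diffusion M (augmented_filtration M B) B Y (\<lambda>i x. sqrt (2 * (1 - (x $ i)\<^sup>2)))
    (jacobi_drift \<kappa> p q) 1 (sqrt 2)"
proof -
  let ?F = "augmented_filtration M B"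
  have J': "prob_space M" "brownian_motion M ?F B"
    "\<And>t. 0 \<le> t \<Longrightarrow> X t \<in> borel_measurable (?F t)"
    "\<And>\<omega>. \<omega> \<in> space M \<Longrightarrow> continuous_on {0..} (\<lambda>t. X t \<omega>)"
    "\<And>\<omega> t. \<omega> \<in> space M \<Longrightarrow> 0 \<le> t \<Longrightarrow> X t \<omega> \<in> jacobi_alcove"
    "\<And>i. AE \<omega> in M. \<forall>t\<ge>0. set_integrable lborel {0..t} (\<lambda>s. jacobi_drift \<kappa> p q i (X s \<omega>))"
    "\<And>i t. 0 \<le> t \<Longrightarrow> \<exists>I. has_ito_integral M ?F (\<lambda>s \<omega>. B s \<omega> $ i) (\<lambda>s \<omega>. sqrt (2 * (1 - (X s \<omega> $ i)\<^sup>2))) t I \<and>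
          (AE \<omega> in M. X t \<omega> $ i =
             X 0 \<omega> $ i + I \<omega> + (LINT s:{0..t}|lborel. jacobi_drift \<kappa> p q i (X s \<omega>)))"
    using J by (auto simp: jacobi_process_def Let_def)
  interpret filtered_brownian_motion M ?F B by (rule augmented_filtration_brownian[OF J'(1,2)])
  have Yalc: "Y t \<omega> \<in> jacobi_alcove" if "\<omega> \<in> space M" for t \<omega>
    using J'(5)[OF that] by (simp add: Y_def)
  have Ym: "Y t \<in> borel_measurable M" for t
    using measurable_F_M[OF _ J'(3), of "max 0 t"] by (simp add: Y_def)
  have Ycont: "continuous_on UNIV (\<lambda>t. Y t \<omega>)" if "\<omega> \<in> space M" for \<omega>
    unfolding Y_def by (rule continuous_on_compose2[OF J'(4)[OF that]]) (auto intro!: continuous_intros)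
  have joint: "(\<lambda>(\<omega>, r). Y r \<omega>) \<in> borel_measurable (M \<Otimes>\<^sub>M lborel)"
    by (rule joint_measurable_continuous_paths[OF Ym Ycont])
  have Yb: "\<bar>Y t \<omega> $ i\<bar> \<le> 1" if "\<omega> \<in> space M" for t \<omega> i
    using Yalc[OF that, of t] by (auto simp: jacobi_alcove_def abs_le_iff minus_le_iff)
  have Ydrift: "(LINT s:{0..t}|lborel. jacobi_drift \<kappa> p q i (Y s \<omega>)) =
      (LINT s:{0..t}|lborel. jacobi_drift \<kappa> p q i (X s \<omega>))" for t i \<omega>
    by (rule set_lebesgue_integral_cong) (auto simp: Y_def)
  have sde: "\<exists>I. has_ito_integral M ?F (\<lambda>s \<omega>. B s \<omega> $ i) (\<lambda>s \<omega>. sqrt (2 * (1 - (Y s \<omega> $ i)\<^sup>2))) t I \<and>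
          (AE \<omega> in M. Y t \<omega> $ i = Y 0 \<omega> $ i + I \<omega> + (LINT s:{0..t}|lborel. jacobi_drift \<kappa> p q i (Y s \<omega>)))"
    if t: "0 \<le> t" for t i
  proof -
    have "has_ito_integral M ?F (\<lambda>s \<omega>. B s \<omega> $ i) (\<lambda>s \<omega>. sqrt (2 * (1 - (Y s \<omega> $ i)\<^sup>2))) t I \<longleftrightarrow>
      has_ito_integral M ?F (\<lambda>s \<omega>. B s \<omega> $ i) (\<lambda>s \<omega>. sqrt (2 * (1 - (X s \<omega> $ i)\<^sup>2))) t I" for I
      by (rule has_ito_integral_cong) (simp add: Y_def)
    moreover have "Y t = X t" "Y 0 = X 0" using t by (simp_all add: Y_def)
    ultimately show ?thesis using J'(7)[OF t, of i] unfolding Ydrift by simp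
  qed
  have sq: "(\<integral>\<^sup>+\<omega>. (\<integral>\<^sup>+r\<in>{0<..T}. ennreal (\<Sum>i\<in>UNIV. \<bar>jacobi_drift \<kappa> p q i (Y r \<omega>)\<bar>) \<partial>lborel)\<^sup>2 \<partial>M) < \<infinity>" for T
  proof (cases "0 \<le> T")
    case False
    then have "{0<..T} = {}" by auto
    then show ?thesis by simp
  next
    case True
    define rk where "rk i = real (card {j. j < i})" for i :: 'n
    define K where "K = \<kappa> * (\<bar>p - q\<bar> + \<bar>p + q\<bar>) * (real CARD('n) + 2 * (\<Sum>i\<in>UNIV. rk i))"
    obtain I where I: "\<And>i. has_ito_integral M ?F (\<lambda>s \<omega>. B s \<omega> $ i) (\<lambda>s \<omega>. sqrt (2 * (1 - (Y s \<omega> $ i)\<^sup>2))) T (I i)"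
      "\<And>i. AE \<omega> in M. Y T \<omega> $ i = Y 0 \<omega> $ i + I i \<omega> + (LINT s:{0..T}|lborel. jacobi_drift \<kappa> p q i (Y s \<omega>))"
    proof -
      have "\<forall>i. \<exists>I. has_ito_integral M ?F (\<lambda>s \<omega>. B s \<omega> $ i) (\<lambda>s \<omega>. sqrt (2 * (1 - (Y s \<omega> $ i)\<^sup>2))) T I \<and>
          (AE \<omega> in M. Y T \<omega> $ i = Y 0 \<omega> $ i + I \<omega> + (LINT s:{0..T}|lborel. jacobi_drift \<kappa> p q i (Y s \<omega>)))"
        using sde[OF True] by (intro allI)
      from choice[OF this] show ?thesis using that by blast
    qed
    have Im: "I i \<in> borel_measurable M" for i using I(1)[of i] by (simp add: has_ito_integral_def)
    have Ifin: "sqn M (I i) < \<infinity>" for i by (rule ito_integral_square_integrable[OF I(1) True])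
    \<comment> \<open>Integrating \<open>jacobi_drift_bound\<close> gives \<open>K * T\<close> plus
      twice the weighted drift integrals. By the equation such an integral is
      \<open>Y T - Y 0\<close> minus the Ito integral \<open>I i\<close>, hence at most
      \<open>2 - I i\<close>, as coordinates lie in [-1,1]. So \<open>W\<close> is a constant plus
      square integrable terms.\<close>
    define W where "W \<omega> = (K * T + 4 * (\<Sum>i\<in>UNIV. rk i)) + (\<Sum>i\<in>UNIV. - 2 * rk i * I i \<omega>)" for \<omega>
    have AE_I: "AE \<omega> in M. \<forall>i. Y T \<omega> $ i = Y 0 \<omega> $ i + I i \<omega> + (LINT s:{0..T}|lborel. jacobi_drift \<kappa> p q i (Y s \<omega>))"
      using I(2) by (simp add: AE_all_countable)
    have AE_int: "AE \<omega> in M. \<forall>i. set_integrable lborel {0..T} (\<lambda>s. jacobi_drift \<kappa> p q i (Y s \<omega>))"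
    proof -
      have "AE \<omega> in M. set_integrable lborel {0..T} (\<lambda>s. jacobi_drift \<kappa> p q i (Y s \<omega>))" for i
        using J'(6)[of i]
      proof eventually_elim
        case (elim \<omega>)
        have "set_integrable lborel {0..T} (\<lambda>s. jacobi_drift \<kappa> p q i (X s \<omega>))" using elim True by auto
        also have "?this \<longleftrightarrow> ?case" by (intro set_integrable_cong) (auto simp: Y_def)
        finally show ?case .
      qed
      then show ?thesis by (simp add: AE_all_countable)
    qed
    have "AE \<omega> in M. (\<integral>\<^sup>+r\<in>{0<..T}. ennreal (\<Sum>i\<in>UNIV. \<bar>jacobi_drift \<kappa> p q i (Y r \<omega>)\<bar>) \<partial>lborel) \<le> ennreal (W \<omega>)"
      using AE_I AE_int AE_space
    proof eventually_elim
      case (elim \<omega>)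
      let ?v = "\<lambda>r. \<Sum>i\<in>UNIV. \<bar>jacobi_drift \<kappa> p q i (Y r \<omega>)\<bar>"
      let ?d = "\<lambda>i. LINT s:{0..T}|lborel. jacobi_drift \<kappa> p q i (Y s \<omega>)"
      let ?w = "\<lambda>r. K + 2 * (\<Sum>i\<in>UNIV. rk i * jacobi_drift \<kappa> p q i (Y r \<omega>))"
      have vw: "?v r \<le> ?w r" for r
        unfolding K_def rk_def by (rule jacobi_drift_bound[OF Yalc[OF elim(3)] \<kappa>])
      have int: "set_integrable lborel {0..T} (\<lambda>s. jacobi_drift \<kappa> p q i (Y s \<omega>))" for i using elim(2) by blast
      have K: "has_bochner_integral lborel (\<lambda>r. K * indicator {0..T} r) (K * T)"
        using has_bochner_integral_real_indicator[of "{0..T}" lborel] True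
        by (intro has_bochner_integral_mult_right) simp
      have d: "has_bochner_integral lborel (\<lambda>r. rk i * (indicator {0..T} r *\<^sub>R jacobi_drift \<kappa> p q i (Y r \<omega>))) (rk i * ?d i)" for i
        using int[of i] by (intro has_bochner_integral_mult_right)
          (simp add: has_bochner_integral_iff set_integrable_def set_lebesgue_integral_def)
      have "has_bochner_integral lborel (\<lambda>r. K * indicator {0..T} r +
          2 * (\<Sum>i\<in>UNIV. rk i * (indicator {0..T} r *\<^sub>R jacobi_drift \<kappa> p q i (Y r \<omega>)))) (K * T + 2 * (\<Sum>i\<in>UNIV. rk i * ?d i))"
        by (intro has_bochner_integral_add has_bochner_integral_mult_right has_bochner_integral_sum K d)
      moreover have "K * indicator {0..T} r + 2 * (\<Sum>i\<in>UNIV. rk i * (indicator {0..T} r *\<^sub>R jacobi_drift \<kappa> p q i (Y r \<omega>)))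
         = ?w r * indicator {0..T} r" for r
        by (simp split: split_indicator)
      ultimately have w: "has_bochner_integral lborel (\<lambda>r. ?w r * indicator {0..T} r) (K * T + 2 * (\<Sum>i\<in>UNIV. rk i * ?d i))"
        by simp
      have wnn: "0 \<le> ?w r" for r by (rule order_trans[OF _ vw]) (simp add: sum_nonneg)
      have "(\<integral>\<^sup>+r\<in>{0<..T}. ennreal (?v r) \<partial>lborel) \<le> (\<integral>\<^sup>+r. ennreal (?w r * indicator {0..T} r) \<partial>lborel)"
        using vw by (intro nn_integral_mono) (auto split: split_indicator intro!: ennreal_leI)
      also have "\<dots> = ennreal (K * T + 2 * (\<Sum>i\<in>UNIV. rk i * ?d i))"
        using w wnn by (subst nn_integral_eq_integral) (auto simp: has_bochner_integral_iff split: split_indicator)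
      also have "\<dots> \<le> ennreal (W \<omega>)"
      proof (intro ennreal_leI)
        have "(\<Sum>i\<in>UNIV. rk i * ?d i) \<le> (\<Sum>i\<in>UNIV. rk i * (2 - I i \<omega>))"
        proof (intro sum_mono mult_left_mono)
          fix i
          have "Y T \<omega> $ i = Y 0 \<omega> $ i + I i \<omega> + ?d i" using elim(1) by blast
          then show "?d i \<le> 2 - I i \<omega>"
            using Yb[OF elim(3), of T i] Yb[OF elim(3), of 0 i] by linarith
        qed (simp add: rk_def)
        also have "\<dots> = 2 * (\<Sum>i\<in>UNIV. rk i) - (\<Sum>i\<in>UNIV. rk i * I i \<omega>)"
          by (simp add: right_diff_distrib sum_subtractf sum_distrib_right[symmetric])
        finally show "K * T + 2 * (\<Sum>i\<in>UNIV. rk i * ?d i) \<le> W \<omega>"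
          by (simp add: W_def sum_negf mult.assoc flip: sum_distrib_left)
      qed
      finally show ?case .
    qed
    then have "AE \<omega> in M. (\<integral>\<^sup>+r\<in>{0<..T}. ennreal (\<Sum>i\<in>UNIV. \<bar>jacobi_drift \<kappa> p q i (Y r \<omega>)\<bar>) \<partial>lborel)\<^sup>2 \<le> ennreal ((W \<omega>)\<^sup>2)"
    proof eventually_elim
      case (elim \<omega>)
      have "(\<integral>\<^sup>+r\<in>{0<..T}. ennreal (\<Sum>i\<in>UNIV. \<bar>jacobi_drift \<kappa> p q i (Y r \<omega>)\<bar>) \<partial>lborel)\<^sup>2 \<le> (ennreal (W \<omega>))\<^sup>2"
        by (rule power_mono[OF elim]) simp
      also have "\<dots> \<le> (ennreal \<bar>W \<omega>\<bar>)\<^sup>2" by (intro power_mono ennreal_leI) auto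
      also have "\<dots> = ennreal ((W \<omega>)\<^sup>2)" by (simp add: ennreal_power)
      finally show ?case .
    qed
    then have "(\<integral>\<^sup>+\<omega>. (\<integral>\<^sup>+r\<in>{0<..T}. ennreal (\<Sum>i\<in>UNIV. \<bar>jacobi_drift \<kappa> p q i (Y r \<omega>)\<bar>) \<partial>lborel)\<^sup>2 \<partial>M) \<le> sqn M W"
      unfolding sqn_def by (rule nn_integral_mono_AE)
    also have "\<dots> < \<infinity>"
    proof -
      have fin: "sqn M (\<lambda>\<omega>. \<Sum>i\<in>UNIV. - 2 * rk i * I i \<omega>) < \<infinity>"
      proof (intro sqn_sum_finite)
        fix i
        show "(\<lambda>\<omega>. - 2 * rk i * I i \<omega>) \<in> borel_measurable M" using Im by simp
        have "sqn M (\<lambda>\<omega>. - 2 * rk i * I i \<omega>) = ennreal ((- 2 * rk i)\<^sup>2) * sqn M (I i)"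
          unfolding sqn_def using Im by (simp add: power_mult_distrib ennreal_mult nn_integral_cmult)
        also have "\<dots> < \<infinity>" using Ifin[of i] by (simp add: ennreal_mult_less_top)
        finally show "sqn M (\<lambda>\<omega>. - 2 * rk i * I i \<omega>) < \<infinity>" .
      qed simp
      have "sqn M W \<le> 2 * sqn M (\<lambda>_. K * T + 4 * (\<Sum>i\<in>UNIV. rk i)) + 2 * sqn M (\<lambda>\<omega>. \<Sum>i\<in>UNIV. - 2 * rk i * I i \<omega>)"
        unfolding W_def using Im by (intro sqn_add borel_measurable_sum) auto
      also have "\<dots> < \<infinity>"
      proof -
        have "sqn M (\<lambda>_. K * T + 4 * (\<Sum>i\<in>UNIV. rk i)) < \<infinity>" by (simp add: sqn_def emeasure_space_1)
        with fin show ?thesis by (simp add: ennreal_mult_less_top)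
      qed
      finally show ?thesis .
    qed
    finally show ?thesis .
  qed
  show ?thesis
  proof
    show "Y t \<in> borel_measurable (?F t)" if "0 \<le> t" for t using J'(3)[OF that] that by (simp add: Y_def)
    show "continuous_on UNIV (\<lambda>x. sqrt (2 * (1 - (x $ i)\<^sup>2)))" for i :: 'n by (intro continuous_intros)
    show "\<bar>sqrt (2 * (1 - (Y t \<omega> $ i)\<^sup>2))\<bar> \<le> sqrt 2" if "\<omega> \<in> space M" for \<omega> t i
      using Yb[OF that, of t i] by (simp add: abs_square_le_1)
  qed (use joint Ycont Yb jacobi_drift_borel sq sde in auto)
qed

section \<open>The Jacobi differential operator\<close>

definition root_poly :: "real ^ 'n \<Rightarrow> real poly" where
  "root_poly x = (\<Prod>i\<in>UNIV. [:- (x $ i), 1:])"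

text \<open>The hypergeometric operator of the Jacobi polynomials, shifted by the eigenvalue of
  degree \<open>n\<close>, so that the polynomial of degree \<open>n\<close> lies in its
  kernel.\<close>

definition jacobi_operator :: "nat \<Rightarrow> real \<Rightarrow> real \<Rightarrow> real poly \<Rightarrow> real poly" where
  "jacobi_operator n \<alpha> \<beta> P = [:1, 0, -1:] * pderiv (pderiv P) +
     [:\<beta> - \<alpha>, - (\<alpha> + \<beta> + 2):] * pderiv P + smult (real n * (real n + \<alpha> + \<beta> + 1)) P"

lemma root_poly_facts:
  fixes x :: "real ^ 'n"
  shows degree_root_poly: "degree (root_poly x) = CARD('n)"
    and lead_coeff_root_poly: "lead_coeff (root_poly x) = 1"
    and poly_root_poly: "poly (root_poly x) y = (\<Prod>i\<in>UNIV. y - x $ i)"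
proof -
  show "degree (root_poly x) = CARD('n)" by (simp add: root_poly_def degree_prod_sum_eq)
  show "lead_coeff (root_poly x) = 1" unfolding root_poly_def lead_coeff_prod by simp
  show "poly (root_poly x) y = (\<Prod>i\<in>UNIV. y - x $ i)" by (simp add: root_poly_def poly_prod)
qed

lemma poly_root_poly_coeffs:
  fixes x :: "real ^ 'n"
  shows "poly (root_poly x) y = (\<Sum>k\<le>CARD('n). coeff (root_poly x) k * y ^ k)"
  by (simp add: poly_altdef degree_root_poly)

text \<open>The matrix with respect to the monomials is triangular: a coefficient is affected by
  those of index \<open>k\<close>, \<open>k + 1\<close>, \<open>k + 2\<close> only. The diagonal
  entry vanishes for \<open>k = n\<close>.\<close>

lemma coeff_jacobi_operator:
  "coeff (jacobi_operator n \<alpha> \<beta> P) k =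
    (real n * (real n + \<alpha> + \<beta> + 1) - real k * (real k + \<alpha> + \<beta> + 1)) * coeff P k
    + (\<beta> - \<alpha>) * (real k + 1) * coeff P (Suc k) + (real k + 1) * (real k + 2) * coeff P (Suc (Suc k))"
proof -
  consider "k = 0" | "k = 1" | m where "k = Suc (Suc m)"
    by (metis One_nat_def not0_implies_Suc)
  then show ?thesis
    by cases (simp_all add: jacobi_operator_def coeff_pderiv algebra_simps)
qed

lemma jacobi_operator_add:
    "jacobi_operator n \<alpha> \<beta> (P + Q) = jacobi_operator n \<alpha> \<beta> P + jacobi_operator n \<alpha> \<beta> Q"
  and jacobi_operator_smult: "jacobi_operator n \<alpha> \<beta> (smult c P) = smult c (jacobi_operator n \<alpha> \<beta> P)"
  by (simp_all add: poly_eq_iff coeff_jacobi_operator algebra_simps)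

lemma jacobi_operator_sum: "jacobi_operator n \<alpha> \<beta> (\<Sum>k\<in>A. f k) = (\<Sum>k\<in>A. jacobi_operator n \<alpha> \<beta> (f k))"
proof (induction A rule: infinite_finite_induct)
  case (insert k A)
  then show ?case by (simp add: jacobi_operator_add)
qed (simp_all add: jacobi_operator_def)

lemma poly_jacobi_operator:
  "poly (jacobi_operator n \<alpha> \<beta> P) y = (1 - y\<^sup>2) * poly (pderiv (pderiv P)) y +
    (\<beta> - \<alpha> - (\<alpha> + \<beta> + 2) * y) * poly (pderiv P) y + real n * (real n + \<alpha> + \<beta> + 1) * poly P y"
  by (simp add: jacobi_operator_def power2_eq_square algebra_simps)

text \<open>In the variable \<open>w = (y - 1) / 2\<close> the operator sends the power
  \<open>k\<close> to a combination of the powers \<open>k\<close> and \<open>k - 1\<close>. The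
  recursion \<open>rec\<close> between consecutive coefficients of the Jacobi polynomial makes
  neighbouring contributions cancel.\<close>

lemma jacobi_poly_ode: "jacobi_operator n \<alpha> \<beta> (jacobi_poly n \<alpha> \<beta>) = 0"
proof (rule poly_eq_poly_eq_iff[THEN iffD1], rule ext)
  fix y :: real
  define a where "a k = real (n choose k) * pochhammer (real n + \<alpha> + \<beta> + 1) k
                    * pochhammer (\<alpha> + real k + 1) (n - k) / fact n" for k
  define w where "w = (y - 1) / 2"
  \<comment> \<open>The telescoping quantity. It is 0 at \<open>k = 0\<close> by its factor
    \<open>k\<close>, which also renders the truncated exponent harmless, and at
    \<open>Suc n\<close> because the binomial coefficient in \<open>a\<close> vanishes.\<close>
  define t where "t k = a k * (real k * (real k + \<alpha>)) * w ^ (k - 1)" for k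
  have rec: "a (Suc k) * ((real k + 1) * (real k + 1 + \<alpha>)) = a k * ((real n - real k) * (real n + real k + \<alpha> + \<beta> + 1))"
    if "k \<le> n" for k
  proof (cases "k = n")
    case True then show ?thesis by (simp add: a_def)
  next
    case False
    with that have k: "k < n" by simp
    have 1: "real (n choose Suc k) * (real k + 1) = real (n choose k) * (real n - real k)"
    proof -
      have "Suc k * (n choose Suc k) = (n - k) * (n choose k)"
        using k by (metis Suc_diff_Suc binomial_absorb_comp binomial_absorption mult.commute)
      then have "real (Suc k * (n choose Suc k)) = real ((n - k) * (n choose k))" by simp
      then show ?thesis using k by (simp add: of_nat_diff algebra_simps)
    qed
    have 2: "pochhammer (\<alpha> + real k + 1) (n - k) = (\<alpha> + real k + 1) * pochhammer (\<alpha> + real (Suc k) + 1) (n - Suc k)"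
      using k pochhammer_rec[of "\<alpha> + real k + 1" "n - Suc k"] by (simp add: Suc_diff_Suc add_ac)
    have 3: "pochhammer (real n + \<alpha> + \<beta> + 1) (Suc k) = pochhammer (real n + \<alpha> + \<beta> + 1) k * (real n + real k + \<alpha> + \<beta> + 1)"
      by (simp add: pochhammer_Suc add_ac)
    let ?p = "pochhammer (real n + \<alpha> + \<beta> + 1) k" and ?q = "pochhammer (\<alpha> + real (Suc k) + 1) (n - Suc k)"
    have "a (Suc k) * ((real k + 1) * (real k + 1 + \<alpha>)) =
      (real (n choose Suc k) * (real k + 1)) * (?p * (real n + real k + \<alpha> + \<beta> + 1)) * ((\<alpha> + real k + 1) * ?q) / fact n"
      unfolding a_def 3 by (simp add: mult_ac add_ac)
    also have "\<dots> = a k * ((real n - real k) * (real n + real k + \<alpha> + \<beta> + 1))"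
      unfolding a_def 1 2[symmetric] by (simp add: mult_ac)
    finally show ?thesis .
  qed
  define l where "l = ([:-1/2, 1/2:] :: real poly)"
  have P: "jacobi_poly n \<alpha> \<beta> = (\<Sum>k\<le>n. smult (a k) (l ^ k))"
    by (simp add: jacobi_poly_def a_def l_def)
  have w: "poly l y = w" "y = 2 * w + 1" by (simp_all add: l_def w_def field_simps)
  have "pderiv l = [:1/2:]" by (simp add: l_def pderiv_pCons)
  then have dl: "pderiv (l ^ k) = smult (real k / 2) (l ^ (k - 1))" for k
    by (cases k) (simp_all add: pderiv_power_Suc mult.commute[of "l ^ _"] del: power_Suc)
  have d1: "poly (pderiv (l ^ k)) y = real k / 2 * w ^ (k - 1)" for k
    by (simp add: dl poly_power w(1))
  have d2: "poly (pderiv (pderiv (l ^ k))) y = real k / 2 * (real (k - 1) / 2 * w ^ (k - 2))" for k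
    by (simp add: dl pderiv_smult poly_power w(1) numeral_2_eq_2)
  have op: "poly (jacobi_operator n \<alpha> \<beta> (l ^ k)) y =
      (real n - real k) * (real n + real k + \<alpha> + \<beta> + 1) * w ^ k - real k * (real k + \<alpha>) * w ^ (k - 1)" for k
  proof -
    have y2: "1 - y\<^sup>2 = - 4 * w * (w + 1)" unfolding w(2) by (simp add: power2_eq_square algebra_simps)
    consider "k = 0" | "k = 1" | m where "k = Suc (Suc m)" by (metis One_nat_def not0_implies_Suc)
    then show ?thesis
    proof cases
      case 3
      have "poly (jacobi_operator n \<alpha> \<beta> (l ^ k)) y = - 4 * w * (w + 1) * (real k / 2 * (real (k - 1) / 2 * w ^ m)) +
        (\<beta> - \<alpha> - (\<alpha> + \<beta> + 2) * (2 * w + 1)) * (real k / 2 * (w ^ m * w)) +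
         real n * (real n + \<alpha> + \<beta> + 1) * (w ^ m * w * w)"
        unfolding poly_jacobi_operator d1 d2 y2 poly_power w(1) by (subst w(2)) (simp add: 3 mult_ac)
      also have "\<dots> = (real n - real k) * (real n + real k + \<alpha> + \<beta> + 1) * (w ^ m * w * w) - real k * (real k + \<alpha>) * (w ^ m * w)"
        by (simp add: 3 field_simps)
      finally show ?thesis by (simp add: 3 mult_ac)
    next
      case 1
      then show ?thesis unfolding poly_jacobi_operator d1 d2 poly_power w(1) by simp
    next
      case 2
      have "poly (jacobi_operator n \<alpha> \<beta> (l ^ k)) y = 
        (\<beta> - \<alpha> - (\<alpha> + \<beta> + 2) * (2 * w + 1)) * (1 / 2) + real n * (real n + \<alpha> + \<beta> + 1) * w"
        unfolding poly_jacobi_operator d1 d2 poly_power w(1) by (subst w(2)) (simp add: 2)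
      also have "\<dots> = (real n - real k) * (real n + real k + \<alpha> + \<beta> + 1) * w ^ k - real k * (real k + \<alpha>) * w ^ (k - 1)"
        by (simp add: 2 field_simps)
      finally show ?thesis .
    qed
  qed
  have "poly (jacobi_operator n \<alpha> \<beta> (jacobi_poly n \<alpha> \<beta>)) y =
    (\<Sum>k\<le>n. a k * ((real n - real k) * (real n + real k + \<alpha> + \<beta> + 1) * w ^ k - real k * (real k + \<alpha>) * w ^ (k - 1)))"
    by (simp add: P jacobi_operator_sum jacobi_operator_smult poly_sum op)
  also have "\<dots> = (\<Sum>k\<le>n. t (Suc k) - t k)"
  proof (intro sum.cong refl)
    fix k assume "k \<in> {..n}"
    then have k: "k \<le> n" by simp
    have t1: "t (Suc k) = a (Suc k) * ((real k + 1) * (real k + 1 + \<alpha>)) * w ^ k"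
      by (simp add: t_def algebra_simps)
    show "a k * ((real n - real k) * (real n + real k + \<alpha> + \<beta> + 1) * w ^ k - real k * (real k + \<alpha>) * w ^ (k - 1)) = t (Suc k) - t k"
      unfolding t1 rec[OF k] t_def[of k] by (simp add: algebra_simps)
  qed
  also have "\<dots> = t (Suc n) - t 0" using sum_lessThan_telescope[of t "Suc n"] by (simp add: lessThan_Suc_atMost)
  also have "\<dots> = 0" by (simp add: t_def a_def)
  finally show "poly (jacobi_operator n \<alpha> \<beta> (jacobi_poly n \<alpha> \<beta>)) y = poly 0 y" by simp
qed

text \<open>Here \<open>f1\<close> and \<open>f2\<close> are the first two derivatives in
  \<open>y\<close>, expressed by products with one and two factors omitted. Symmetrizing the
  repulsion terms produces \<open>G i - G j\<close>, which contains the factor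
  \<open>x $ i - x $ j\<close> and so cancels the denominator.\<close>

lemma jacobi_generator:
  fixes x :: "real ^ 'n"
  assumes x: "\<And>i j. i \<noteq> j \<Longrightarrow> x $ i \<noteq> x $ j"
    and \<alpha>: "\<alpha> = q - real CARD('n)" and \<beta>: "\<beta> = p - real CARD('n)"
  shows "(\<Sum>i\<in>UNIV. (\<Prod>j\<in>UNIV - {i}. y - x $ j) * jacobi_drift \<kappa> p q i x) =
    \<kappa> * poly (jacobi_operator CARD('n) \<alpha> \<beta> (root_poly x)) y"
proof -
  let ?N = "real CARD('n)"
  define f where "f = (\<Prod>i\<in>UNIV. y - x $ i)"
  define G where "G i = (\<Prod>j\<in>UNIV - {i}. y - x $ j)" for i
  define H where "H i j = (\<Prod>l\<in>UNIV - {i} - {j}. y - x $ l)" for i j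
  define h where "h i j = (1 - x $ i * x $ j) / (x $ i - x $ j)" for i j
  define f1 where "f1 = poly (pderiv (root_poly x)) y"
  define f2 where "f2 = poly (pderiv (pderiv (root_poly x))) y"
  have Gf: "(y - x $ i) * G i = f" for i
    unfolding f_def G_def by (rule prod.remove[symmetric]) auto
  have HG: "(y - x $ j) * H i j = G i" if "i \<noteq> j" for i j
    unfolding H_def G_def using that by (intro prod.remove[symmetric]) auto
  have Hsym: "H i j = H j i" for i j
    unfolding H_def by (intro prod.cong) auto
  have pG: "pderiv (\<Prod>j\<in>S. [:- (x $ j), 1:]) = (\<Sum>i\<in>S. \<Prod>j\<in>S - {i}. [:- (x $ j), 1:])" for S
    by (simp add: pderiv_prod pderiv_pCons)
  have pderiv_sum: "pderiv (\<Sum>i\<in>S. g i) = (\<Sum>i\<in>S. pderiv (g i))" for g :: "'n \<Rightarrow> real poly" and S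
    by (induction S rule: infinite_finite_induct) (simp_all add: pderiv_add)
  have f1: "f1 = (\<Sum>i\<in>UNIV. G i)"
    unfolding f1_def root_poly_def pG by (simp add: poly_sum poly_prod G_def)
  have f2: "f2 = (\<Sum>i\<in>UNIV. \<Sum>j\<in>UNIV - {i}. H i j)"
    unfolding f2_def root_poly_def pG by (simp add: pderiv_sum pG poly_sum poly_prod H_def)
  have swap: "(\<Sum>i\<in>UNIV. \<Sum>j\<in>UNIV - {i}. g i j) = (\<Sum>i\<in>UNIV. \<Sum>j\<in>UNIV - {i}. g j i)" for g :: "'n \<Rightarrow> 'n \<Rightarrow> real"
  proof -
    have "(\<Sum>i\<in>UNIV. \<Sum>j\<in>UNIV - {i}. g i j) = (\<Sum>i\<in>UNIV. \<Sum>j | j \<in> UNIV \<and> i \<noteq> j. g i j)"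
      by (intro sum.cong) auto
    also have "\<dots> = (\<Sum>j\<in>UNIV. \<Sum>i | i \<in> UNIV \<and> i \<noteq> j. g i j)" by (rule sum.swap_restrict) auto
    also have "\<dots> = (\<Sum>i\<in>UNIV. \<Sum>j\<in>UNIV - {i}. g j i)"
      by (intro sum.cong) auto
    finally show ?thesis .
  qed
  have card1: "(\<Sum>i\<in>UNIV. \<Sum>j\<in>UNIV - {i}. g i) = (?N - 1) * (\<Sum>i\<in>UNIV. g i)" for g :: "'n \<Rightarrow> real"
  proof -
    have "real (CARD('n) - 1) = ?N - 1" by (simp add: of_nat_diff Suc_leI)
    then show ?thesis by (simp add: card_Diff_singleton sum_distrib_left)
  qed
  have inter: "2 * (\<Sum>i\<in>UNIV. \<Sum>j\<in>UNIV - {i}. G i * h i j) =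
     (1 - y\<^sup>2) * f2 - ?N * (?N - 1) * f + 2 * (?N - 1) * y * f1"
  proof -
    have anti: "h j i = - h i j" for i j
      unfolding h_def by (metis minus_diff_eq minus_divide_right mult.commute)
    have "(\<Sum>i\<in>UNIV. \<Sum>j\<in>UNIV - {i}. G i * h i j) = (\<Sum>i\<in>UNIV. \<Sum>j\<in>UNIV - {i}. G j * h j i)" by (rule swap)
    also have "\<dots> = (\<Sum>i\<in>UNIV. \<Sum>j\<in>UNIV - {i}. G j * - h i j)"
      unfolding anti[symmetric] by (rule refl)
    finally have "2 * (\<Sum>i\<in>UNIV. \<Sum>j\<in>UNIV - {i}. G i * h i j) = (\<Sum>i\<in>UNIV. \<Sum>j\<in>UNIV - {i}. (G i - G j) * h i j)"
      by (simp add: left_diff_distrib sum_subtractf sum_negf)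
    also have "\<dots> = (\<Sum>i\<in>UNIV. \<Sum>j\<in>UNIV - {i}. (1 - y\<^sup>2) * H i j - f + y * G i + y * G j)"
    proof (intro sum.cong refl)
      fix i j :: 'n assume "j \<in> UNIV - {i}"
      then have ij: "i \<noteq> j" by auto
      have Gi: "(y - x $ j) * H i j = G i" and Gj: "(y - x $ i) * H i j = G j"
        using HG[OF ij] HG[of j i] ij Hsym[of i j] by auto
      have "f = (y - x $ i) * ((y - x $ j) * H i j)" using Gf[of i] Gi by simp
      \<comment> \<open>With \<open>a = y - x $ i\<close> and \<open>b = y - x $ j\<close> this is
        \<open>1 - x $ i * x $ j = (1 - y\<^sup>2) + y * a + y * b - a * b\<close>, multiplied by
        \<open>H i j\<close>.\<close>
      then have F: "(1 - x $ i * x $ j) * H i j = (1 - y\<^sup>2) * H i j - f + y * ((y - x $ j) * H i j) + y * ((y - x $ i) * H i j)"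
        by (simp add: power2_eq_square algebra_simps)
      have "G i - G j = (x $ i - x $ j) * H i j" unfolding Gi[symmetric] Gj[symmetric] by (simp add: algebra_simps)
      then have "(G i - G j) * h i j = (1 - x $ i * x $ j) * H i j" using x[OF ij] by (simp add: h_def)
      then show "(G i - G j) * h i j = (1 - y\<^sup>2) * H i j - f + y * G i + y * G j"
        unfolding F by (simp only: Gi Gj)
    qed
    also have "\<dots> = (1 - y\<^sup>2) * f2 - (\<Sum>i\<in>(UNIV::'n set). \<Sum>j\<in>UNIV - {i}. f) + (\<Sum>i\<in>UNIV. \<Sum>j\<in>UNIV - {i}. y * G i) +
       (\<Sum>i\<in>UNIV. \<Sum>j\<in>UNIV - {i}. y * G j)"
      by (simp only: sum.distrib sum_subtractf f2 sum_distrib_left)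
    also have "(\<Sum>i\<in>UNIV. \<Sum>j\<in>UNIV - {i}. y * G j) = (\<Sum>i\<in>UNIV. \<Sum>j\<in>UNIV - {i}. y * G i)" by (rule swap)
    also have "(\<Sum>i\<in>UNIV. \<Sum>j\<in>UNIV - {i}. y * G i) = (?N - 1) * (y * f1)"
      unfolding card1 f1 sum_distrib_left ..
    also have "(\<Sum>i\<in>(UNIV::'n set). \<Sum>j\<in>UNIV - {i}. f) = (?N - 1) * (?N * f)"
      unfolding card1[of "\<lambda>_. f"] by simp
    finally show ?thesis by (simp add: algebra_simps)
  qed
  have lin: "(\<Sum>i\<in>UNIV. G i * ((p - q) - (p + q) * x $ i)) = (p - q) * f1 - (p + q) * (y * f1 - ?N * f)"
  proof -
    have "(\<Sum>i\<in>UNIV. G i * ((p - q) - (p + q) * x $ i)) = (\<Sum>i\<in>UNIV. (p - q) * G i - (p + q) * (y * G i - f))"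
    proof (intro sum.cong refl)
      fix i
      have "y * G i - f = x $ i * G i" using Gf[of i] by (simp add: algebra_simps)
      then show "G i * ((p - q) - (p + q) * x $ i) = (p - q) * G i - (p + q) * (y * G i - f)"
        by (simp only:) (simp add: algebra_simps)
    qed
    also have "\<dots> = (p - q) * f1 - (p + q) * (y * f1 - ?N * f)"
      unfolding f1 by (simp add: sum_subtractf sum_distrib_left[symmetric])
    finally show ?thesis .
  qed
  have "(\<Sum>i\<in>UNIV. G i * jacobi_drift \<kappa> p q i x) =
    \<kappa> * ((\<Sum>i\<in>UNIV. G i * ((p - q) - (p + q) * x $ i)) + 2 * (\<Sum>i\<in>UNIV. \<Sum>j\<in>UNIV - {i}. G i * h i j))"
    unfolding jacobi_drift_def h_def[symmetric]
    by (simp add: sum_distrib_left distrib_left sum.distrib mult_ac)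
  also have "\<dots> = \<kappa> * ((p - q) * f1 - (p + q) * (y * f1 - ?N * f) + ((1 - y\<^sup>2) * f2 - ?N * (?N - 1) * f + 2 * (?N - 1) * y * f1))"
    unfolding lin inter ..
  \<comment> \<open>Since \<alpha> + \<beta> equals \<open>p + q - 2 * ?N\<close>, the factors of
    \<open>f1\<close>, \<open>y * f1\<close> and \<open>f\<close> become
    \<open>\<beta> - \<alpha>\<close>, \<open>- (\<alpha> + \<beta> + 2)\<close> and the eigenvalue
    \<open>?N * (?N + \<alpha> + \<beta> + 1)\<close>.\<close>
  also have "\<dots> = \<kappa> * poly (jacobi_operator CARD('n) \<alpha> \<beta> (root_poly x)) y"
    unfolding poly_jacobi_operator f1_def[symmetric] f2_def[symmetric] poly_root_poly f_def[symmetric] \<alpha> \<beta>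
    by (simp add: algebra_simps)
  finally show ?thesis unfolding G_def .
qed

section \<open>Recovering a polynomial from its ordered zeros, and its coefficients\<close>

lemma prod_mset_linear_dvd:
  fixes p :: "'a::idom poly"
  assumes "p \<noteq> 0" "A \<subseteq># proots p"
  shows "(\<Prod>x\<in>#A. [:- x, 1:]) dvd p"
  using assms(2)
proof (induction A)
  case (add x A)
  then have "A \<subseteq># proots p" by (meson mset_subset_eq_insertD subset_mset.less_imp_le)
  then obtain r where r: "p = (\<Prod>x\<in>#A. [:- x, 1:]) * r" using add.IH by (auto simp: dvd_def)
  then have nz: "(\<Prod>x\<in>#A. [:- x, 1:]) \<noteq> 0" "r \<noteq> 0" using assms(1) by auto
  \<comment> \<open>The roots of \<open>p\<close> not yet accounted for are then exactly those of
    the cofactor \<open>r\<close>, with multiplicity, so a further root can be split off from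
    \<open>r\<close>.\<close>
  have "proots (\<Prod>x\<in>#A. [:- x, 1:]) = A"
  proof (induction A)
    case (add x A)
    have "(\<Prod>x\<in>#A. [:- x, 1:]) \<noteq> 0" by (auto simp: prod_mset_zero_iff)
    then have "proots ([:- x, 1:] * (\<Prod>x\<in>#A. [:- x, 1:])) = proots [:- x, 1:] + proots (\<Prod>x\<in>#A. [:- x, 1:])"
      by (intro proots_mult) auto
    with add show ?case by (simp del: mult_pCons_left)
  qed simp
  then have "proots p = A + proots r" using r nz by (simp add: proots_mult)
  then have "A + {#x#} \<subseteq># A + proots r" using add.prems by simp
  then have "x \<in># proots r" by (simp only: subset_mset.add_le_cancel_left single_subset_iff)
  then have "[:- x, 1:] dvd r" using nz(2) by (simp add: poly_eq_0_iff_dvd)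
  then have "[:- x, 1:] * (\<Prod>x\<in>#A. [:- x, 1:]) dvd r * (\<Prod>x\<in>#A. [:- x, 1:])"
    by (rule mult_dvd_mono) simp
  then show ?case by (simp only: r mult.commute[of _ r] image_mset_add_mset prod_mset.add_mset)
qed simp

text \<open>Because multiplicities are counted, the entries of \<open>z\<close> form the whole
  multiset of real roots, so \<open>root_poly z\<close> divides \<open>P\<close>. It already has
  degree \<open>CARD('n)\<close>, and the cofactor must be constant.\<close>

lemma ordered_zeros_root_poly:
  fixes z :: "real ^ 'n::{finite,linorder}"
  assumes z: "ordered_zeros P z" and P: "P \<noteq> 0" "degree P \<le> CARD('n)"
  shows "P = smult (lead_coeff P) (root_poly z)"
proof -
  let ?A = "image_mset (\<lambda>i. z $ i) (mset_set UNIV)"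
  have A: "root_poly z = (\<Prod>x\<in>#?A. [:- x, 1:])"
    by (simp add: root_poly_def prod_unfold_prod_mset image_mset.compositionality comp_def)
  have "?A = proots P"
  proof (rule multiset_eqI)
    fix x
    have "count ?A x = card {i. z $ i = x}"
      by (simp add: count_image_mset vimage_def)
    then show "count ?A x = count (proots P) x" using z P(1) by (simp add: ordered_zeros_def)
  qed
  then have "root_poly z dvd P" unfolding A by (intro prod_mset_linear_dvd P) simp
  then obtain r where r: "P = root_poly z * r" by (auto simp: dvd_def)
  then have "root_poly z \<noteq> 0" "r \<noteq> 0" using P by auto
  then have "degree P = CARD('n) + degree r" by (simp add: r degree_mult_eq degree_root_poly)
  then have "degree r = 0" using P(2) by simp
  then obtain c where "r = [:c:]" by (rule degree_eq_zeroE)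
  then have "P = smult c (root_poly z)" by (simp add: r)
  then show ?thesis by (simp add: lead_coeff_root_poly)
qed

lemma coeff_jacobi_poly:
  "coeff (jacobi_poly n \<alpha> \<beta>) j = (\<Sum>l = j..n. real (n choose l) * pochhammer (real n + \<alpha> + \<beta> + 1) l *
     pochhammer (\<alpha> + real l + 1) (n - l) / fact n * (real (l choose j) * (1/2) ^ j * (-1/2) ^ (l - j)))"
proof -
  let ?a = "\<lambda>l. real (n choose l) * pochhammer (real n + \<alpha> + \<beta> + 1) l *
     pochhammer (\<alpha> + real l + 1) (n - l) / fact n"
  have "coeff (jacobi_poly n \<alpha> \<beta>) j = (\<Sum>l\<le>n. ?a l * coeff ([:-1/2, 1/2:] ^ l) j)"
    by (simp add: jacobi_poly_def coeff_sum)
  also have "\<dots> = (\<Sum>l = j..n. ?a l * coeff ([:-1/2, 1/2:] ^ l) j)"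
  proof (intro sum.mono_neutral_right ballI)
    fix l assume "l \<in> {..n} - {j..n}"
    then have "degree ([:-1/2, 1/2:] ^ l :: real poly) < j"
      using degree_power_le[of "[:-1/2, 1/2:] :: real poly" l] by auto
    then show "?a l * coeff ([:-1/2, 1/2:] ^ l) j = 0" by (simp add: coeff_eq_0)
  qed auto
  also have "\<dots> = (\<Sum>l = j..n. ?a l * (real (l choose j) * (1/2) ^ j * (-1/2) ^ (l - j)))"
    by (intro sum.cong refl arg_cong2[where f = "(*)"] coeff_linear_poly_power) auto
  finally show ?thesis .
qed

section \<open>Evolution of the mean root polynomial\<close>

text \<open>By adjoining one factor at a time: a coefficient of the new product combines two old
  ones, so the bound at most doubles.\<close>

lemma coeff_prod_linear:
  fixes S :: "'n::finite set" and x :: "real ^ 'n"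
  shows "continuous_on UNIV (\<lambda>x::real^'n. coeff (\<Prod>i\<in>S. [:- (x $ i), 1:]) k)"
    and "(\<And>i. \<bar>x $ i\<bar> \<le> 1) \<Longrightarrow> \<bar>coeff (\<Prod>i\<in>S. [:- (x $ i), 1:]) k\<bar> \<le> 2 ^ card S"
proof -
  have "finite S" by simp
  then have "\<forall>k. continuous_on UNIV (\<lambda>x::real^'n. coeff (\<Prod>i\<in>S. [:- (x $ i), 1:]) k) \<and>
    ((\<forall>i. \<bar>x $ i\<bar> \<le> 1) \<longrightarrow> \<bar>coeff (\<Prod>i\<in>S. [:- (x $ i), 1:]) k\<bar> \<le> 2 ^ card S)"
  proof (induction S rule: finite_induct)
    case empty
    show ?case by (auto simp: coeff_1)
  next
    case (insert i S)
    have step: "coeff (\<Prod>i\<in>insert i S. [:- (x $ i), 1:]) k =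
      - (x $ i) * coeff (\<Prod>i\<in>S. [:- (x $ i), 1:]) k + (case k of 0 \<Rightarrow> 0 | Suc j \<Rightarrow> coeff (\<Prod>i\<in>S. [:- (x $ i), 1:]) j)"
      for x :: "real^'n" and k
      using insert by (simp add: coeff_pCons split: nat.split)
    show ?case
    proof (intro allI conjI impI)
      fix k
      show "continuous_on UNIV (\<lambda>x::real^'n. coeff (\<Prod>i\<in>insert i S. [:- (x $ i), 1:]) k)"
        unfolding step using insert.IH by (cases k) (auto intro!: continuous_intros)
      assume x: "\<forall>i. \<bar>x $ i\<bar> \<le> 1"
      have IH: "\<bar>coeff (\<Prod>i\<in>S. [:- (x $ i), 1:]) k\<bar> \<le> 2 ^ card S" for k using insert.IH x by blast
      have "\<bar>- (x $ i) * coeff (\<Prod>i\<in>S. [:- (x $ i), 1:]) k\<bar> \<le> 1 * 2 ^ card S"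
        unfolding abs_mult abs_minus_cancel by (intro mult_mono IH) (use x in auto)
      moreover have "\<bar>case k of 0 \<Rightarrow> 0 | Suc j \<Rightarrow> coeff (\<Prod>i\<in>S. [:- (x $ i), 1:]) j\<bar> \<le> 2 ^ card S"
        using IH by (auto split: nat.split)
      ultimately have "\<bar>coeff (\<Prod>i\<in>insert i S. [:- (x $ i), 1:]) k\<bar> \<le> 1 * 2 ^ card S + 2 ^ card S"
        unfolding step by linarith
      then show "\<bar>coeff (\<Prod>i\<in>insert i S. [:- (x $ i), 1:]) k\<bar> \<le> 2 ^ card (insert i S)"
        using insert by simp
    qed
  qed
  then show "continuous_on UNIV (\<lambda>x::real^'n. coeff (\<Prod>i\<in>S. [:- (x $ i), 1:]) k)"
    and "(\<And>i. \<bar>x $ i\<bar> \<le> 1) \<Longrightarrow> \<bar>coeff (\<Prod>i\<in>S. [:- (x $ i), 1:]) k\<bar> \<le> 2 ^ card S" by auto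
qed

lemma coeff_root_poly_continuous: "continuous_on UNIV (\<lambda>x::real^'n. coeff (root_poly x) k)"
  unfolding root_poly_def by (rule coeff_prod_linear)

lemma coeff_root_poly_bounded:
  "(\<And>i. \<bar>x $ i\<bar> \<le> 1) \<Longrightarrow> \<bar>coeff (root_poly x) k\<bar> \<le> 2 ^ CARD('n)" for x :: "real ^ 'n"
  unfolding root_poly_def by (rule coeff_prod_linear)

text \<open>With the integrating factor \<open>exp (- a * t)\<close>, the product with the primitive
  of \<open>d\<close> has derivative zero and starts at 0.\<close>

lemma linear_volterra_zero:
  fixes d :: "real \<Rightarrow> real"
  assumes cont: "continuous_on UNIV d"
    and eq: "\<And>T. 0 \<le> T \<Longrightarrow> d T = a * (LINT r:{0<..T}|lborel. d r)" and "0 \<le> T"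
  shows "d T = 0"
proof -
  have c: "continuous_on {0..T} d" using cont continuous_on_subset by blast
  define I where "I t = integral {0..t} d" for t
  have I: "(LINT r:{0<..t}|lborel. d r) = I t" for t
  proof -
    have "(LINT r:{0<..t}|lborel. d r) = (LINT r:{0..t}|lborel. d r)"
      using borel_measurable_continuous_onI[OF cont] by (intro set_integral_Icc_Ioc[symmetric]) simp
    also have "\<dots> = I t"
      unfolding I_def by (intro set_borel_integral_eq_integral(2) borel_integrable_atLeastAtMost'
          continuous_on_subset[OF cont]) auto
    finally show ?thesis .
  qed
  have "((\<lambda>t. exp (- a * t) * I t) has_field_derivative 0) (at t within {0..T})" if t: "t \<in> {0..T}" for t
  proof -
    have "(I has_field_derivative d t) (at t within {0..T})"
      unfolding I_def using integral_has_real_derivative[OF c t] .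
    then have "((\<lambda>t. exp (- a * t) * I t) has_field_derivative
        (exp (- a * t) * (- a)) * I t + d t * exp (- a * t)) (at t within {0..T})"
      by (auto intro!: derivative_eq_intros)
    moreover have "d t = a * I t" using eq[of t] t I by simp
    ultimately show ?thesis by (simp add: mult_ac)
  qed
  from has_field_derivative_zero_constant[OF convex_real_interval(5) this]
  obtain C where C: "\<And>t. t \<in> {0..T} \<Longrightarrow> exp (- a * t) * I t = C" by blast
  have "C = 0" using C[of 0] assms(3) by (simp add: I_def)
  then have "I T = 0" using C[of T] assms(3) by simp
  then show ?thesis using eq[OF assms(3)] I by simp
qed

section \<open>Expectations of functions of the state and their time integrals\<close>

context bounded_diffusion
begin

context
  fixes \<phi> :: "real ^ 'n \<Rightarrow> real" and L :: real
  assumes \<phi>_bounded: "\<And>t \<omega>. \<omega> \<in> space M \<Longrightarrow> \<bar>\<phi> (X t \<omega>)\<bar> \<le> L"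
begin

lemma state_function_integrable:
  "0 \<le> t \<Longrightarrow> \<phi> \<in> borel_measurable borel \<Longrightarrow> integrable M (\<lambda>\<omega>. \<phi> (X t \<omega>))"
  using \<phi>_bounded by (intro bounded_at_integrable[of t] bounded_at_state[where C = L])

text \<open>Negative times are included, where adaptedness says nothing; joint measurability is used
  instead.\<close>

lemma X_measurable_all: "X t \<in> borel_measurable M"
  using measurable_compose[OF measurable_Pair2' X_joint, of t] by simp

lemma expectation_state_continuous:
  assumes "continuous_on UNIV \<phi>"
  shows "continuous_on UNIV (\<lambda>t. expectation (\<lambda>\<omega>. \<phi> (X t \<omega>)))"
proof (rule continuous_at_imp_continuous_on, intro ballI)
  fix t
  have [measurable]: "\<phi> \<in> borel_measurable borel" by (intro borel_measurable_continuous_onI assms)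
  show "isCont (\<lambda>t. expectation (\<lambda>\<omega>. \<phi> (X t \<omega>))) t"
    unfolding continuous_at_sequentially
  proof (intro allI impI)
    fix u assume u: "u \<longlonglongrightarrow> t"
    show "((\<lambda>t. expectation (\<lambda>\<omega>. \<phi> (X t \<omega>))) \<circ> u) \<longlonglongrightarrow> expectation (\<lambda>\<omega>. \<phi> (X t \<omega>))"
      unfolding comp_def
    proof (rule integral_dominated_convergence[where w = "\<lambda>_. L"])
      show "AE \<omega> in M. (\<lambda>m. \<phi> (X (u m) \<omega>)) \<longlonglongrightarrow> \<phi> (X t \<omega>)"
        by (intro AE_I2 continuous_on_tendsto_compose[OF assms(1)] path_tendsto u) auto
      show "AE \<omega> in M. norm (\<phi> (X (u m) \<omega>)) \<le> L" for m
        using \<phi>_bounded by (intro AE_I2) auto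
    qed (use X_measurable_all in auto)
  qed
qed

lemma fubini_state:
  assumes [measurable]: "\<phi> \<in> borel_measurable borel"
  shows "integrable M (\<lambda>\<omega>. LINT r:{0<..T}|lborel. \<phi> (X r \<omega>))"
    and "expectation (\<lambda>\<omega>. LINT r:{0<..T}|lborel. \<phi> (X r \<omega>)) = (LINT r:{0<..T}|lborel. expectation (\<lambda>\<omega>. \<phi> (X r \<omega>)))"
    and "\<omega> \<in> space M \<Longrightarrow> set_integrable lborel {0<..T} (\<lambda>r. \<phi> (X r \<omega>))"
proof -
  interpret P: pair_sigma_finite M lborel ..
  let ?f = "\<lambda>\<omega> r. indicat_real {0<..T} r *\<^sub>R \<phi> (X r \<omega>)"
  have le: "ennreal (norm (?f \<omega> r)) \<le> ennreal \<bar>L\<bar> * indicator {0<..T} r" if "\<omega> \<in> space M" for \<omega> r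
    using order_trans[OF \<phi>_bounded[OF that] abs_ge_self] by (auto split: split_indicator intro!: ennreal_leI)
  have fin: "(\<integral>\<^sup>+r. ennreal \<bar>L\<bar> * indicator {0<..T} r \<partial>lborel) < \<infinity>"
    by (cases "0 \<le> T") (simp_all add: nn_integral_cmult_indicator ennreal_mult_less_top)
  have int: "integrable (M \<Otimes>\<^sub>M lborel) (\<lambda>(\<omega>, r). ?f \<omega> r)"
  proof -
    have m: "(\<lambda>(\<omega>, r). ?f \<omega> r) \<in> borel_measurable (M \<Otimes>\<^sub>M lborel)" by measurable
    have "(\<integral>\<^sup>+x. ennreal (norm (case x of (\<omega>, r) \<Rightarrow> ?f \<omega> r)) \<partial>(M \<Otimes>\<^sub>M lborel)) =
      (\<integral>\<^sup>+\<omega>. (\<integral>\<^sup>+r. ennreal (norm (?f \<omega> r)) \<partial>lborel) \<partial>M)"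
      using m by (subst lborel.nn_integral_fst[symmetric]) auto
    also have "\<dots> \<le> (\<integral>\<^sup>+\<omega>. (\<integral>\<^sup>+r. ennreal \<bar>L\<bar> * indicator {0<..T} r \<partial>lborel) \<partial>M)"
      by (intro nn_integral_mono le) auto
    also have "\<dots> < \<infinity>" using fin by (simp add: emeasure_space_1)
    finally show ?thesis using m by (simp add: integrable_iff_bounded)
  qed
  show "integrable M (\<lambda>\<omega>. LINT r:{0<..T}|lborel. \<phi> (X r \<omega>))"
    using P.integrable_fst'[OF int] by (simp add: set_lebesgue_integral_def)
  show "expectation (\<lambda>\<omega>. LINT r:{0<..T}|lborel. \<phi> (X r \<omega>)) = (LINT r:{0<..T}|lborel. expectation (\<lambda>\<omega>. \<phi> (X r \<omega>)))"
    using P.Fubini_integral[OF int] by (simp add: set_lebesgue_integral_def)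
  assume w: "\<omega> \<in> space M"
  note [measurable] = path_measurable[OF w]
  have "(\<integral>\<^sup>+r. ennreal (norm (?f \<omega> r)) \<partial>lborel) \<le> (\<integral>\<^sup>+r. ennreal \<bar>L\<bar> * indicator {0<..T} r \<partial>lborel)"
    by (intro nn_integral_mono le w)
  then show "set_integrable lborel {0<..T} (\<lambda>r. \<phi> (X r \<omega>))"
    using fin unfolding set_integrable_def integrable_iff_bounded by (auto intro: order.strict_trans1)
qed

end

end

text \<open>The argument runs on the deviations \<open>d k\<close> of the mean coefficients from
  their initial values. Once the higher deviations vanish, \<open>d k\<close> satisfies a scalar
  homogeneous integral equation. The starting point enters solely through the polynomial equation
  \<open>ode\<close>.\<close>

lemma jacobi_root_poly_mean:
  fixes X :: "real \<Rightarrow> 'a \<Rightarrow> real ^ 'n::{finite,linorder}"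
  assumes J: "jacobi_process M B \<kappa> p q x0 X" and \<kappa>: "0 \<le> \<kappa>"
    and ode: "jacobi_operator CARD('n) (q - real CARD('n)) (p - real CARD('n)) (root_poly x0) = 0"
    and T: "0 \<le> T"
  shows "integrable M (\<lambda>\<omega>. coeff (root_poly (X T \<omega>)) k)"
    and "(\<integral>\<omega>. coeff (root_poly (X T \<omega>)) k \<partial>M) = coeff (root_poly x0) k"
proof -
  define Y where "Y t = X (max 0 t)" for t
  define N where "N = CARD('n)"
  let ?J = "jacobi_operator N (q - real N) (p - real N)"
  interpret bounded_diffusion M "augmented_filtration M B" B Y "\<lambda>i x. sqrt (2 * (1 - (x $ i)\<^sup>2))"
    "jacobi_drift \<kappa> p q" 1 "sqrt 2"
    unfolding Y_def by (rule jacobi_process_diffusion[OF J \<kappa>])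
  have alc: "Y t \<omega> \<in> jacobi_alcove" if "\<omega> \<in> space M" for t \<omega>
    using J that by (simp add: jacobi_process_def Let_def Y_def)
  have start: "AE \<omega> in M. Y 0 \<omega> = x0"
    using J by (simp add: jacobi_process_def Let_def Y_def)
  \<comment> \<open>This is where the reflection condition is used: outside a null set of times the
    process is in the interior of the alcove, so its coordinates are distinct and
    \<open>jacobi_generator\<close> applies.\<close>
  have front: "AE \<omega> in M. AE r in lborel. 0 < r \<longrightarrow> (\<forall>i j. i \<noteq> j \<longrightarrow> Y r \<omega> $ i \<noteq> Y r \<omega> $ j)"
  proof -
    have "AE \<omega> in M. {t. 0 \<le> t \<and> X t \<omega> \<in> frontier jacobi_alcove} \<in> null_sets lborel"
      using J by (simp add: jacobi_process_def Let_def)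
    then show ?thesis using AE_space
    proof eventually_elim
      case (elim \<omega>)
      have "AE r in lborel. r \<notin> {t. 0 \<le> t \<and> X t \<omega> \<in> frontier jacobi_alcove}"
        by (rule AE_not_in[OF elim(1)])
      then show ?case
      proof eventually_elim
        case (elim r)
        show ?case
        proof (intro impI allI)
          fix i j :: 'n assume r: "0 < r" and ij: "i \<noteq> j"
          then have "Y r \<omega> \<notin> frontier jacobi_alcove" using elim by (simp add: Y_def)
          then have "Y r \<omega> \<in> interior jacobi_alcove"
            using alc[OF \<open>\<omega> \<in> space M\<close>, of r] closure_subset by (auto simp: frontier_def)
          then show "Y r \<omega> $ i \<noteq> Y r \<omega> $ j" using ij by (rule interior_jacobi_alcove_neq)
        qed
      qed
    qed
  qed
  define \<phi> where "\<phi> k x = coeff (root_poly x) k" for k and x :: "(real, 'n) vec"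
  define c where "c k t = expectation (\<lambda>\<omega>. \<phi> k (Y t \<omega>))" for k t
  have \<phi>c: "continuous_on UNIV (\<phi> k)" for k unfolding \<phi>_def by (rule coeff_root_poly_continuous)
  then have \<phi>m: "\<phi> k \<in> borel_measurable borel" for k by (rule borel_measurable_continuous_onI)
  have \<phi>b: "\<bar>\<phi> k (Y t \<omega>)\<bar> \<le> 2 ^ N" if "\<omega> \<in> space M" for k t \<omega>
    unfolding \<phi>_def N_def using X_bounded[OF that] by (rule coeff_root_poly_bounded)
  have cc: "continuous_on UNIV (c k)" for k
    unfolding c_def by (rule expectation_state_continuous[OF \<phi>b \<phi>c])
  have \<phi>int: "integrable M (\<lambda>\<omega>. \<phi> k (Y t \<omega>))" if "0 \<le> t" for k t
    by (rule state_function_integrable[OF \<phi>b that \<phi>m])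
  have c0: "c k 0 = \<phi> k x0" for k
  proof -
    have "c k 0 = expectation (\<lambda>\<omega>. \<phi> k x0)"
      unfolding c_def using start \<phi>int[of 0 k] by (intro Bochner_Integration.integral_cong_AE) auto
    then show ?thesis by (simp add: prob_space)
  qed
  have poly\<phi>: "(\<Prod>i\<in>UNIV. y - x $ i) = (\<Sum>k\<le>N. \<phi> k x * y ^ k)" for x :: "(real, 'n) vec" and y
    using poly_root_poly_coeffs[of x y] by (simp add: poly_root_poly \<phi>_def N_def)
  define U where "U t = (\<Sum>k\<le>N. monom (c k t) k)" for t
  define V where "V t = (\<Sum>k\<le>N. monom (LINT r:{0<..t}|lborel. c k r) k)" for t
  have EU: "expectation (\<lambda>\<omega>. \<Prod>i\<in>UNIV. y - Y t \<omega> $ i) = poly (U t) y" if "0 \<le> t" for t y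
  proof -
    have "expectation (\<lambda>\<omega>. \<Prod>i\<in>UNIV. y - Y t \<omega> $ i) = (\<Sum>k\<le>N. expectation (\<lambda>\<omega>. \<phi> k (Y t \<omega>) * y ^ k))"
      unfolding poly\<phi> using \<phi>int[OF that] by (intro Bochner_Integration.integral_sum) auto
    also have "\<dots> = poly (U t) y" by (simp add: U_def poly_sum poly_monom c_def)
    finally show ?thesis .
  qed
  have U0: "U 0 = root_poly x0"
    unfolding U_def c0 \<phi>_def N_def by (rule poly_as_sum_of_monoms') (simp add: degree_root_poly)
  have evolution: "U t - U 0 = - smult \<kappa> (?J (V t))" if t: "0 < t" for t
  proof (rule poly_eq_poly_eq_iff[THEN iffD1], rule ext)
    fix y
    \<comment> \<open>Evaluation of \<kappa> times the operator at \<open>y\<close> is linear in the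
      coefficients, and \<open>e k\<close> is its value on the monomial of degree \<open>k\<close>.
      Expectation and time integral can thus be moved to the coefficients.\<close>
    define e where "e k = \<kappa> * poly (?J (monom 1 k)) y" for k
    have Je: "\<kappa> * poly (?J (\<Sum>k\<le>N. monom (a k) k)) y = (\<Sum>k\<le>N. a k * e k)" for a
    proof -
      have "monom (a k) k = smult (a k) (monom 1 k)" for k by (simp add: smult_monom)
      then show ?thesis
        by (simp add: jacobi_operator_sum jacobi_operator_smult poly_sum e_def sum_distrib_left mult_ac)
    qed
    have gen: "AE \<omega> in M. (LINT r:{0<..t}|lborel. (\<Sum>i\<in>UNIV. (\<Prod>j\<in>UNIV - {i}. y - Y r \<omega> $ j) * jacobi_drift \<kappa> p q i (Y r \<omega>)))
       = (\<Sum>k\<le>N. (LINT r:{0<..t}|lborel. \<phi> k (Y r \<omega>)) * e k)"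
      using front AE_space
    proof eventually_elim
      case (elim \<omega>)
      note [measurable] = path_measurable[OF elim(2)] \<phi>m b_measurable
      have "(LINT r:{0<..t}|lborel. (\<Sum>i\<in>UNIV. (\<Prod>j\<in>UNIV - {i}. y - Y r \<omega> $ j) * jacobi_drift \<kappa> p q i (Y r \<omega>)))
        = (LINT r:{0<..t}|lborel. (\<Sum>k\<le>N. \<phi> k (Y r \<omega>) * e k))"
        unfolding set_lebesgue_integral_def
      proof (rule Bochner_Integration.integral_cong_AE)
        show "AE r in lborel. indicat_real {0<..t} r *\<^sub>R (\<Sum>i\<in>UNIV. (\<Prod>j\<in>UNIV - {i}. y - Y r \<omega> $ j) * jacobi_drift \<kappa> p q i (Y r \<omega>))
           = indicat_real {0<..t} r *\<^sub>R (\<Sum>k\<le>N. \<phi> k (Y r \<omega>) * e k)"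
          using elim(1)
        proof eventually_elim
          case (elim r)
          show ?case
          proof (cases "0 < r")
            case True
            have "root_poly (Y r \<omega>) = (\<Sum>k\<le>N. monom (\<phi> k (Y r \<omega>)) k)"
              unfolding \<phi>_def N_def by (rule poly_as_sum_of_monoms'[symmetric]) (simp add: degree_root_poly)
            moreover have "(\<Sum>i\<in>UNIV. (\<Prod>j\<in>UNIV - {i}. y - Y r \<omega> $ j) * jacobi_drift \<kappa> p q i (Y r \<omega>)) =
              \<kappa> * poly (?J (root_poly (Y r \<omega>))) y"
              unfolding N_def using elim True by (intro jacobi_generator) auto
            ultimately show ?thesis by (simp add: Je)
          qed simp
        qed
      qed measurable
      also have "\<dots> = (\<Sum>k\<le>N. (LINT r:{0<..t}|lborel. \<phi> k (Y r \<omega>)) * e k)"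
        using fubini_state(3)[OF \<phi>b \<phi>m elim(2), of t]
        unfolding set_lebesgue_integral_def set_integrable_def scaleR_sum_right
        by (subst Bochner_Integration.integral_sum) (auto simp flip: mult.assoc)
      finally show ?case .
    qed
    have "poly (U t) y = poly (U 0) y - expectation (\<lambda>\<omega>. LINT r:{0<..t}|lborel.
        (\<Sum>i\<in>UNIV. (\<Prod>j\<in>UNIV - {i}. y - Y r \<omega> $ j) * jacobi_drift \<kappa> p q i (Y r \<omega>)))"
      using dynkin_product[OF t, of y] EU[of t y] EU[of 0 y] t by simp
    also have "expectation (\<lambda>\<omega>. LINT r:{0<..t}|lborel.
        (\<Sum>i\<in>UNIV. (\<Prod>j\<in>UNIV - {i}. y - Y r \<omega> $ j) * jacobi_drift \<kappa> p q i (Y r \<omega>))) =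
        expectation (\<lambda>\<omega>. \<Sum>k\<le>N. (LINT r:{0<..t}|lborel. \<phi> k (Y r \<omega>)) * e k)"
    proof (rule Bochner_Integration.integral_cong_AE[OF _ _ gen])
      show "(\<lambda>\<omega>. LINT r:{0<..t}|lborel.
        (\<Sum>i\<in>UNIV. (\<Prod>j\<in>UNIV - {i}. y - Y r \<omega> $ j) * jacobi_drift \<kappa> p q i (Y r \<omega>))) \<in> borel_measurable M"
        unfolding set_lebesgue_integral_def by measurable
      show "(\<lambda>\<omega>. \<Sum>k\<le>N. (LINT r:{0<..t}|lborel. \<phi> k (Y r \<omega>)) * e k) \<in> borel_measurable M"
        using fubini_state(1)[OF \<phi>b \<phi>m, of t] by (intro borel_measurable_sum borel_measurable_times) auto
    qed
    also have "\<dots> = (\<Sum>k\<le>N. (LINT r:{0<..t}|lborel. c k r) * e k)"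
      using fubini_state(1,2)[OF \<phi>b \<phi>m, of t] by (simp add: c_def)
    also have "\<dots> = \<kappa> * poly (?J (V t)) y" unfolding V_def Je ..
    finally show "poly (U t - U 0) y = poly (- smult \<kappa> (?J (V t))) y" by simp
  qed
  define d where "d k t = c k t - \<phi> k x0" for k t
  have dc: "continuous_on UNIV (d k)" for k
    unfolding d_def by (intro continuous_on_diff cc continuous_on_const)
  define D where "D t = (\<Sum>k\<le>N. monom (LINT r:{0<..t}|lborel. d k r) k)" for t
  \<comment> \<open>\<open>V t\<close> differs from \<open>D t\<close> by \<open>t\<close> times the
    initial polynomial, which the operator annihilates.\<close>
  have JD: "?J (V t) = ?J (D t)" if t: "0 < t" for t
  proof -
    have "(LINT r:{0<..t}|lborel. d k r) = (LINT r:{0<..t}|lborel. c k r) - t * \<phi> k x0" for k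
    proof -
      have "set_integrable lborel {0..t} (c k)"
        by (intro borel_integrable_atLeastAtMost' continuous_on_subset[OF cc]) auto
      then have 1: "set_integrable lborel {0<..t} (c k)" by (rule set_integrable_subset) auto
      have 2: "set_integrable lborel {0<..t} (\<lambda>r. \<phi> k x0)"
        unfolding set_integrable_def using t by (simp add: integrable_real_indicator)
      have "(LINT r:{0<..t}|lborel. \<phi> k x0) = t * \<phi> k x0"
        unfolding set_lebesgue_integral_def using t by simp
      then show ?thesis unfolding d_def using set_integral_diff[OF 1 2] by simp
    qed
    then have "V t = D t + smult t (U 0)"
      by (simp add: poly_eq_iff V_def D_def U_def c0 coeff_sum)
    then show ?thesis using ode by (simp add: jacobi_operator_add jacobi_operator_smult U0 N_def)
  qed
  have coeffD: "coeff (D t) k = (LINT r:{0<..t}|lborel. d k r)" if "k \<le> N" for k t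
    using that by (simp add: D_def coeff_sum)
  \<comment> \<open>The measure \<open>N - k\<close> lets the induction descend from the leading
    coefficient. It is also 0 for \<open>k > N\<close>, where the coefficients vanish for reasons of
    degree.\<close>
  have zero: "d k t = 0" if "0 \<le> t" for k t
    using that
  proof (induction "N - k" arbitrary: k t rule: less_induct)
    case less
    show ?case
    proof (cases "k \<le> N")
      case False
      then have "\<phi> k x = 0" for x unfolding \<phi>_def N_def by (intro coeff_eq_0) (simp add: degree_root_poly)
      then show ?thesis by (simp add: d_def c_def)
    next
      case True
      have hi: "coeff (D t) j = 0" if j: "k < j" "0 \<le> t" for j t
      proof (cases "j \<le> N")
        case True
        have "N - j < N - k" using True j by simp
        then have dj: "d j s = 0" if "0 \<le> s" for s using less.hyps that by blast
        have "(LINT r:{0<..t}|lborel. d j r) = (LINT r:{0<..t}|lborel. 0)"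
          by (rule set_lebesgue_integral_cong) (auto simp: dj)
        then show ?thesis using True by (simp add: coeffD)
      next
        case False
        then show ?thesis by (auto simp: D_def coeff_sum intro!: sum.neutral)
      qed
      let ?l = "real N * (real N + (q - real N) + (p - real N) + 1) - real k * (real k + (q - real N) + (p - real N) + 1)"
      \<comment> \<open>By triangularity only the diagonal entry \<open>?l\<close> of the operator
        is left. It is 0 at \<open>k = N\<close>, in accordance with the constant leading
        coefficient.\<close>
      have eq: "d k s = (- \<kappa> * ?l) * (LINT r:{0<..s}|lborel. d k r)" if s: "0 \<le> s" for s
      proof (cases "s = 0")
        case True
        then show ?thesis by (simp add: d_def c0 set_lebesgue_integral_def)
      next
        case False
        with s have s: "0 < s" by simp
        have "coeff (U s - U 0) k = coeff (- smult \<kappa> (?J (D s))) k"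
          using evolution[OF s] JD[OF s] by simp
        moreover have "coeff (U s - U 0) k = d k s" using True by (simp add: U_def d_def c0 coeff_sum)
        ultimately show ?thesis using hi[of _ s] s True by (simp add: coeff_jacobi_operator coeffD)
      qed
      show ?thesis by (rule linear_volterra_zero[OF dc eq less.prems])
    qed
  qed
  have YX: "Y T = X T" using T by (simp add: Y_def)
  show "integrable M (\<lambda>\<omega>. coeff (root_poly (X T \<omega>)) k)"
    using \<phi>int[OF T, of k] by (simp add: \<phi>_def YX)
  show "expectation (\<lambda>\<omega>. coeff (root_poly (X T \<omega>)) k) = coeff (root_poly x0) k"
    using zero[OF T, of k] by (simp add: d_def c_def \<phi>_def YX)
qed

text \<open>The leading coefficient is nonzero because the Pochhammer symbol starts at
  \<open>real n + \<alpha> + \<beta> + 1\<close>, which is positive: the sum of \<alpha> and \<beta>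
  exceeds -2 and \<open>n\<close> is at least 1.\<close>

lemma lead_coeff_jacobi_poly:
  assumes "1 \<le> n" "- 1 < \<alpha>" "- 1 < \<beta>"
  shows "coeff (jacobi_poly n \<alpha> \<beta>) n = ((2 * real n + \<alpha> + \<beta>) gchoose n) / 2 ^ n"
    and "(2 * real n + \<alpha> + \<beta>) gchoose n \<noteq> 0"
    and "degree (jacobi_poly n \<alpha> \<beta>) = n"
proof -
  have g: "(2 * real n + \<alpha> + \<beta>) gchoose n = pochhammer (real n + \<alpha> + \<beta> + 1) n / fact n"
    unfolding gbinomial_pochhammer' by (simp add: algebra_simps)
  show c: "coeff (jacobi_poly n \<alpha> \<beta>) n = ((2 * real n + \<alpha> + \<beta>) gchoose n) / 2 ^ n"
    by (simp add: coeff_jacobi_poly g power_divide)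
  have "0 < real n + \<alpha> + \<beta> + 1" using assms by linarith
  then have "0 < pochhammer (real n + \<alpha> + \<beta> + 1) n" by (rule pochhammer_pos)
  then show nz: "(2 * real n + \<alpha> + \<beta>) gchoose n \<noteq> 0" by (simp add: g)
  show "degree (jacobi_poly n \<alpha> \<beta>) = n"
  proof (rule antisym)
    show "degree (jacobi_poly n \<alpha> \<beta>) \<le> n"
      by (rule degree_le) (simp add: coeff_jacobi_poly)
    show "n \<le> degree (jacobi_poly n \<alpha> \<beta>)" by (rule le_degree) (simp add: c nz)
  qed
qed

theorem theorem4p5:
  fixes N :: nat and \<kappa> p q \<alpha> \<beta> :: real
    and z :: "real ^ ('n::{finite,linorder})"
    and M :: "'a measure"
    and B X :: "real \<Rightarrow> 'a \<Rightarrow> real ^ ('n::{finite,linorder})"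
  assumes "N = CARD('n)"
    and "\<kappa> > 0"
    and "p > real N - 1" and "q > real N - 1"
    and "\<alpha> = q - real N" and "\<beta> = p - real N"
    and "z \<in> jacobi_alcove"
    and "ordered_zeros (jacobi_poly N \<alpha> \<beta>) z"
    and "jacobi_process M B \<kappa> p q z X"
  shows "(\<forall>t\<ge>0. \<forall>y. prob_space.expectation M (\<lambda>\<omega>. \<Prod>i\<in>UNIV. (y - X t \<omega> $ i)) =
            1 / lead_coeff (jacobi_poly N \<alpha> \<beta>) * poly (jacobi_poly N \<alpha> \<beta>) y) \<and>
         (\<forall>n\<le>N. \<forall>t\<ge>0.
            prob_space.expectation M (\<lambda>\<omega>. elem_sym n (X t \<omega>)) = elem_sym n z \<and>
            elem_sym n z =
              2 ^ N / ((2 * real N + \<alpha> + \<beta>) gchoose N) *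
              (\<Sum>l = N - n..N. (-1) ^ (N - l) * real (N choose l) * real (l choose (N - n)) *
                 (pochhammer (real N + \<alpha> + \<beta> + 1) l * pochhammer (\<alpha> + real l + 1) (N - l)
                  / (fact N * 2 ^ l))))"
proof -
  define P where "P = jacobi_poly N \<alpha> \<beta>"
  have \<alpha>\<beta>: "- 1 < \<alpha>" "- 1 < \<beta>" and N: "1 \<le> N" using assms(1,3-6) by (auto simp: Suc_leI)
  note lc = lead_coeff_jacobi_poly[OF N \<alpha>\<beta>]
  let ?g = "(2 * real N + \<alpha> + \<beta>) gchoose N"
  have lcP: "lead_coeff P = ?g / 2 ^ N" using lc by (simp add: P_def)
  then have lnz: "lead_coeff P \<noteq> 0" using lc(2) by simp
  have Pz: "P = smult (lead_coeff P) (root_poly z)"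
    using assms(8) lnz lc(3) assms(1) unfolding P_def by (intro ordered_zeros_root_poly) auto
  \<comment> \<open>The operator is linear, so the equation for the Jacobi polynomial passes to the
    monic root polynomial after division by the nonzero leading coefficient.\<close>
  have "smult (lead_coeff P) (jacobi_operator N \<alpha> \<beta> (root_poly z)) = 0"
    using jacobi_poly_ode[of N \<alpha> \<beta>] Pz unfolding P_def[symmetric] jacobi_operator_smult[symmetric] by simp
  then have ode: "jacobi_operator CARD('n) (q - real CARD('n)) (p - real CARD('n)) (root_poly z) = 0"
    using lnz assms(1,5,6) by simp
  have \<kappa>: "0 \<le> \<kappa>" using assms(2) by simp
  note mean = jacobi_root_poly_mean[OF assms(9) \<kappa> ode]
  have coeffz: "coeff (root_poly z) k = coeff P k / lead_coeff P" for k
    using arg_cong[OF Pz, of "\<lambda>p. coeff p k"] lnz by (simp only: coeff_smult nonzero_mult_div_cancel_left not_False_eq_True)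
  have es: "elem_sym n x = (- 1) ^ n * coeff (root_poly x) (N - n)" if "n \<le> N" for n and x :: "(real, 'n) vec"
    using that assms(1) by (simp add: elem_sym_def root_poly_def)
  show ?thesis
  proof (intro conjI allI impI)
    fix t y :: real assume t: "0 \<le> t"
    have "(\<integral>\<omega>. (\<Prod>i\<in>UNIV. y - X t \<omega> $ i) \<partial>M) = (\<integral>\<omega>. (\<Sum>k\<le>CARD('n). coeff (root_poly (X t \<omega>)) k * y ^ k) \<partial>M)"
      by (simp only: poly_root_poly[symmetric] poly_root_poly_coeffs)
    also have "\<dots> = (\<Sum>k\<le>CARD('n). coeff (root_poly z) k * y ^ k)"
      using mean[OF t] by (simp add: Bochner_Integration.integral_sum)
    also have "\<dots> = poly (root_poly z) y" by (rule poly_root_poly_coeffs[symmetric])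
    also have "\<dots> = 1 / lead_coeff P * poly P y"
      using arg_cong[OF Pz, of "\<lambda>p. poly p y"] lnz by (simp only: poly_smult) simp
    finally show "(\<integral>\<omega>. (\<Prod>i\<in>UNIV. y - X t \<omega> $ i) \<partial>M) =
        1 / lead_coeff (jacobi_poly N \<alpha> \<beta>) * poly (jacobi_poly N \<alpha> \<beta>) y" by (simp only: P_def)
  next
    fix n and t :: real assume n: "n \<le> N" and t: "0 \<le> t"
    show "(\<integral>\<omega>. elem_sym n (X t \<omega>) \<partial>M) = elem_sym n z"
      unfolding es[OF n] using mean[OF t] by simp
  next
    fix n assume n: "n \<le> N"
    let ?t = "\<lambda>l. (-1) ^ (N - l) * real (N choose l) * real (l choose (N - n)) *
                 (pochhammer (real N + \<alpha> + \<beta> + 1) l * pochhammer (\<alpha> + real l + 1) (N - l) / (fact N * 2 ^ l))"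
    have "elem_sym n z = 2 ^ N / ?g * ((- 1) ^ n * coeff P (N - n))"
      by (simp add: es[OF n] coeffz lcP)
    also have "(- 1) ^ n * coeff P (N - n) = (\<Sum>l = N - n..N. ?t l)"
      unfolding P_def coeff_jacobi_poly sum_distrib_left
    proof (intro sum.cong refl)
      fix l assume "l \<in> {N - n..N}"
      then have l: "N - n \<le> l" "l \<le> N" by auto
      define r where "r = l - (N - n)"
      have lr: "l = N - n + r" using l by (simp add: r_def)
      \<comment> \<open>This relation settles the sign: the powers of -1 with exponents
        \<open>n\<close> and \<open>r\<close> multiply to the one with exponent
        \<open>N - l\<close>, since \<open>r\<close> occurs twice.\<close>
      have nr: "n = (N - l) + r" using l n by (simp add: r_def)
      have "(- 1) ^ n * ((1 / 2) ^ (N - n) * (- 1 / 2) ^ r) = (- 1 :: real) ^ n * (- 1) ^ r * (1 / 2) ^ (N - n + r)"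
      proof -
        have "(- 1 / 2 :: real) ^ r = (- 1) ^ r * (1 / 2) ^ r" by (simp flip: power_mult_distrib)
        then show ?thesis by (simp only: power_add mult_ac)
      qed
      also have "(- 1 :: real) ^ n * (- 1) ^ r = (- 1) ^ (N - l) * ((- 1) ^ r * (- 1) ^ r)"
        by (subst nr) (simp add: power_add)
      also have "(- 1 :: real) ^ r * (- 1) ^ r = 1" by (simp flip: power_mult_distrib)
      finally have s: "(- 1) ^ n * ((1 / 2) ^ (N - n) * (- 1 / 2) ^ r) = (- 1 :: real) ^ (N - l) / 2 ^ l"
        by (simp add: lr[symmetric] power_divide)
      have "(- 1) ^ n * (real (N choose l) * pochhammer (real N + \<alpha> + \<beta> + 1) l * pochhammer (\<alpha> + real l + 1) (N - l) / fact N *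
          (real (l choose (N - n)) * (1 / 2) ^ (N - n) * (- 1 / 2) ^ (l - (N - n)))) =
         ((- 1) ^ n * ((1 / 2) ^ (N - n) * (- 1 / 2) ^ r)) * (real (N choose l) * pochhammer (real N + \<alpha> + \<beta> + 1) l *
           pochhammer (\<alpha> + real l + 1) (N - l) / fact N * real (l choose (N - n)))"
        by (simp add: r_def)
      also have "\<dots> = ?t l" unfolding s by (simp add: field_simps)
      finally show "(- 1) ^ n * (real (N choose l) * pochhammer (real N + \<alpha> + \<beta> + 1) l * pochhammer (\<alpha> + real l + 1) (N - l) / fact N *
          (real (l choose (N - n)) * (1 / 2) ^ (N - n) * (- 1 / 2) ^ (l - (N - n)))) = ?t l" .
    qed
    finally show "elem_sym n z = 2 ^ N / ?g * (\<Sum>l = N - n..N. ?t l)" .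
  qed
qed

end
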